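(* Assume the Riemann hypothesis. Then for every good kernel $f\in\mathcal G$, the function $f$ belongs to the closure in $L_2(0,\infty)$ of $\mathcal B(Pf)$.
   Context: $L_2=L_2(0,\infty)$. A good kernel is a continuously differentiable function $f:[0,\infty)\to\mathbb C$ with $f(x)\to0$ as $x\to\infty$, $f\in L_1(0,\infty)$, and $\int_0^\infty t|f'(t)|\,dt<\infty$; $\mathcal G$ denotes the class of good kernels. For $f\in\mathcal G$ the Müntz operator is $Pf(x):=\sum_{n=1}^\infty f(nx)-\frac1x\int_0^\infty f(t)\,dt$, defined for a.e. $x>0$. For $\lambda>0$, the dilation is $K_\lambda g(x):=g(\lambda x)$. For a function $g$ on $(0,\infty)$, $\mathcal B(g)$ is the linear span (over $\mathbb C$) of $\{K_n g:n\in\mathbb N\}$. *)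

theory Defs
  imports "HOL-Analysis.Analysis"
begin

(* Dirichlet eta function, sum_{n>=1} (-1)^(n-1) n^(-s); converges for Re s > 0 *)
definition dirichlet_eta :: "complex \<Rightarrow> complex" where
  "dirichlet_eta s = (\<Sum>n. (-1) ^ n / (of_nat (Suc n)) powr s)"

(* Riemann zeta function on the half-plane Re s > 0 (s \<noteq> 1), via its standard
   continuation zeta(s) = eta(s) / (1 - 2^(1-s)) *)
definition riemann_zeta :: "complex \<Rightarrow> complex" where
  "riemann_zeta s = dirichlet_eta s / (1 - 2 powr (1 - s))"

definition riemann_hypothesis :: bool where
  "riemann_hypothesis \<longleftrightarrow>
     (\<forall>s. 0 < Re s \<and> Re s < 1 \<and> riemann_zeta s = 0 \<longrightarrow> Re s = 1/2)"

definition good_kernel :: "(real \<Rightarrow> complex) \<Rightarrow> bool" where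
  "good_kernel f \<longleftrightarrow>
     (\<exists>f'. (\<forall>x\<in>{0..}. (f has_vector_derivative f' x) (at x within {0..}))
           \<and> continuous_on {0..} f'
           \<and> (f \<longlongrightarrow> 0) at_top
           \<and> set_integrable lborel {0..} f
           \<and> set_integrable lborel {0..} (\<lambda>t. t * norm (f' t)))"

definition muntz_op :: "(real \<Rightarrow> complex) \<Rightarrow> real \<Rightarrow> complex" where
  "muntz_op f x = (\<Sum>n. f (real (Suc n) * x))
                  - complex_of_real (1 / x) * set_lebesgue_integral lborel {0<..} f"

definition dilation :: "real \<Rightarrow> (real \<Rightarrow> complex) \<Rightarrow> real \<Rightarrow> complex" where
  "dilation l g x = g (l * x)"

definition dilation_span :: "(real \<Rightarrow> complex) \<Rightarrow> (real \<Rightarrow> complex) set" where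
  "dilation_span g = {(\<lambda>x. \<Sum>n\<in>{1..N}. c n * dilation (real n) g x) | N c. True}"

definition L2_closure :: "(real \<Rightarrow> complex) set \<Rightarrow> (real \<Rightarrow> complex) set" where
  "L2_closure S = {h. \<forall>e::real>0. \<exists>g\<in>S.
      set_nn_integral lborel {0<..} (\<lambda>x. ennreal ((cmod (h x - g x))\<^sup>2)) < ennreal e}"

end

(* Mellin-Plancherel on the line s = 1/2 + it turns f - sum c_n K_n Pf into F(s) (1 - zeta(s) D(s)), where F is the
   Mellin transform of f and D(s) = sum c_n n^(-s). Since F(s) = O(1/|s|), it suffices to find Dirichlet polynomials D
   for which (1 - zeta D) / (|t| + 4) is small in L2 of the line.

   Under RH, D is taken close to 1/zeta(s + e) with e > 0 small. Letting e tend to 0 is justified by dominated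
   convergence, because zeta(s) / zeta(s + e) = O(|t|^k) uniformly in e: every zero near s is at least as far from
   s + e as from s, and after the zeros are divided out, Borel-Caratheodory controls what remains. In particular the
   functional equation is not needed. For fixed e, 1/zeta(s + e) is the sum of the Taylor series of 1/zeta about s + 4,
   whose coefficients are uniform limits of Dirichlet polynomials in s; the terms are controlled by Littlewood's bound
   1/zeta = O(|t|^k) to the right of the critical line, for which Mertens' argument is needed as well, since the
   hypothesis says nothing about zeros with real part 1. *)
theory Submission
  imports Defs
    "HOL-Complex_Analysis.Complex_Analysis"
    "HOL-Number_Theory.Prime_Powers"
    "HOL-Probability.Probability"
    "HOL-Real_Asymp.Real_Asymp"
begin

text \<open>Off these countably many points zeta(s) / zeta(s + e) tends to 1, and a mean-square
  argument only lacks an integrable majorant. The exponents: the square of the decay of F leaves the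
  weight (|t| + 4)^(-2), so any power of |t| below 1/2 may be lost in zeta D. The proof allows 1/4,
  made of 1/8 from zeta and 1/8 from 1/zeta. Zeros are divided out of \<open>zeta_reg\<close>, the
  continuation of (s - 1) zeta(s) to Re s > 0, because it is holomorphic at 1 as well. Under x = exp
  y, dilations become translations, x^(it) becomes a character and L2(0, infinity) becomes L2 of the
  line. Pf is O(1) at 0, where the sum and the 1/x term cancel, and O(1/x) at infinity; this is why
  its Mellin integral converges absolutely on the critical line.\<close>

section \<open>Bounds for holomorphic functions\<close>

text \<open>The map u / (2 M - u) takes the half-plane Re u < M into the unit disc and fixes 0, so
  Schwarz's lemma applies to \<open>g\<close> after rescaling. This gives |f z| \<le> q (2 M + |f
  z|) with q = |z - c| / R, which is solved for |f z|.\<close>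

theorem borel_caratheodory:
  assumes f: "f holomorphic_on ball c R" and c: "f c = 0"
    and M: "\<And>z. z \<in> ball c R \<Longrightarrow> Re (f z) < M" and z: "z \<in> ball c R"
  shows "norm (f z) \<le> 2 * M * dist c z / (R - dist c z)"
proof -
  have R: "R > 0" using z by (metis ball_eq_empty empty_iff not_le)
  have M0: "M > 0" using M[of c] c R by simp
  define g where "g w = f (c + of_real R * w) / (2 * of_real M - f (c + of_real R * w))" for w
  have in_ball: "c + of_real R * w \<in> ball c R" if "norm w < 1" for w
    using that R by (simp add: dist_norm norm_mult)
  have lt: "norm u < norm (2 * of_real M - u)" if "Re u < M" for u
  proof -
    have "(norm u)\<^sup>2 < (norm (2 * of_real M - u))\<^sup>2"
      using mult_strict_left_mono[OF that M0] unfolding cmod_power2 by (simp add: power2_eq_square algebra_simps)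
    then show ?thesis by (simp add: power2_less_imp_less)
  qed
  have nz: "2 * of_real M - u \<noteq> 0" if "Re u < M" for u
    using lt[OF that] by (metis norm_ge_zero norm_zero not_less)
  have "f holomorphic_on (\<lambda>w. c + of_real R * w) ` ball 0 1"
    using in_ball by (intro holomorphic_on_subset[OF f]) auto
  then have comp: "(\<lambda>w. f (c + of_real R * w)) holomorphic_on ball 0 1"
    using holomorphic_on_compose[of "\<lambda>w. c + of_real R * w" "ball 0 1" f]
    by (simp add: o_def holomorphic_intros)
  have "g holomorphic_on ball 0 1"
    unfolding g_def using comp nz M in_ball by (intro holomorphic_intros) auto
  moreover have "g 0 = 0" by (simp add: g_def c)
  moreover have "norm (g w) < 1" if "norm w < 1" for w
    using lt[OF M[OF in_ball[OF that]]] nz[OF M[OF in_ball[OF that]]]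
    by (simp add: g_def norm_divide)
  moreover define w where "w = (z - c) / of_real R"
  have wn: "norm w = dist c z / R" using R by (simp add: w_def norm_divide dist_norm norm_minus_commute)
  moreover have w1: "norm w < 1" using wn z R by simp
  ultimately have gw: "norm (g w) \<le> dist c z / R"
    using Schwarz_Lemma(1)[of g w] by auto
  have cw: "c + of_real R * w = z" using R by (simp add: w_def)
  let ?q = "dist c z / R"
  have q: "?q < 1" "?q \<ge> 0" using z R by auto
  have nzz: "2 * of_real M - f z \<noteq> 0" using nz M z by blast
  have "norm (f z) \<le> ?q * norm (2 * of_real M - f z)"
    using gw nzz by (simp add: g_def cw norm_divide pos_divide_le_eq)
  also have "\<dots> \<le> ?q * (2 * M + norm (f z))"
  proof (rule mult_left_mono)
    show "norm (2 * of_real M - f z) \<le> 2 * M + norm (f z)"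
      using norm_triangle_ineq4[of "2 * of_real M" "f z"] M0 by (simp add: norm_mult)
  qed (use q in auto)
  finally have "norm (f z) * (R - dist c z) \<le> 2 * M * dist c z"
    using R by (simp add: field_simps)
  then show ?thesis using z by (simp add: field_simps)
qed

lemma holomorphic_log_normalised:
  assumes f: "f holomorphic_on ball c R" and nz: "\<And>z. z \<in> ball c R \<Longrightarrow> f z \<noteq> 0" and "R > 0"
  obtains h where "h holomorphic_on ball c R" "h c = 0"
    "\<And>z. z \<in> ball c R \<Longrightarrow> f z = f c * exp (h z)"
proof -
  obtain g where g: "g holomorphic_on ball c R" "\<And>z. z \<in> ball c R \<Longrightarrow> f z = exp (g z)"
    using contractible_imp_holomorphic_log[OF f convex_imp_contractible[OF convex_ball] nz] by metis
  show ?thesis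
  proof (rule that[of "\<lambda>z. g z - g c"])
    show "(\<lambda>z. g z - g c) holomorphic_on ball c R" using g by (intro holomorphic_intros)
    show "f z = f c * exp (g z - g c)" if "z \<in> ball c R" for z
      using g(2)[OF that] g(2)[of c] \<open>R > 0\<close> by (simp add: exp_diff)
  qed simp
qed

text \<open>A bound on |f| is an upper bound on the real part of its logarithm, which is all that
  Borel-Caratheodory asks for.\<close>

lemma nonvanishing_log_bound:
  assumes f: "f holomorphic_on ball c R" and nz: "\<And>z. z \<in> ball c R \<Longrightarrow> f z \<noteq> 0"
    and R: "R > 0" and M: "\<And>z. z \<in> ball c R \<Longrightarrow> norm (f z) < exp M * norm (f c)"
  obtains h where "h holomorphic_on ball c R" "\<And>z. z \<in> ball c R \<Longrightarrow> f z = f c * exp (h z)"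
    "\<And>z. z \<in> ball c R \<Longrightarrow> norm (h z) \<le> 2 * M * dist c z / (R - dist c z)"
proof -
  obtain h where h: "h holomorphic_on ball c R" "h c = 0"
    "\<And>z. z \<in> ball c R \<Longrightarrow> f z = f c * exp (h z)"
    using holomorphic_log_normalised[OF f nz R] by blast
  have "Re (h z) < M" if "z \<in> ball c R" for z
  proof -
    have "norm (f c) * exp (Re (h z)) < exp M * norm (f c)"
      using M[OF that] h(3)[OF that] by (simp add: norm_mult)
    then have "exp (Re (h z)) < exp M"
      using nz[of c] R by (simp add: mult.commute)
    then show ?thesis by simp
  qed
  with h show ?thesis using borel_caratheodory[OF h(1,2)] that by blast
qed

text \<open>Compare logarithms. On radius 4 R / 5 Borel-Caratheodory bounds \<open>h\<close> by 2 M
  (4/5) / (1/5) = 8 M; Cauchy's inequality on circles of radius R / 5 then bounds its derivative by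
  40 M / R on radius 3 R / 5, and the mean value inequality finishes.\<close>

lemma nonvanishing_norm_ratio:
  assumes f: "f holomorphic_on ball c R" and nz: "\<And>z. z \<in> ball c R \<Longrightarrow> f z \<noteq> 0"
    and R: "R > 0" and M: "\<And>z. z \<in> ball c R \<Longrightarrow> norm (f z) < exp M * norm (f c)"
    and s: "s \<in> cball c (3 * R / 5)" and s': "s' \<in> cball c (3 * R / 5)"
  shows "norm (f s) \<le> norm (f s') * exp (40 * M * norm (s - s') / R)"
proof -
  obtain h where h: "h holomorphic_on ball c R" "\<And>z. z \<in> ball c R \<Longrightarrow> f z = f c * exp (h z)"
    "\<And>z. z \<in> ball c R \<Longrightarrow> norm (h z) \<le> 2 * M * dist c z / (R - dist c z)"
    using nonvanishing_log_bound[OF f nz R M] by metis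
  have M0: "M > 0" using M[of c] R nz[of c] by simp
  have hb: "norm (h z) \<le> 8 * M" if "dist c z \<le> 4 * R / 5" for z
  proof -
    have "norm (h z) \<le> 2 * M * dist c z / (R - dist c z)" using h(3)[of z] that R by simp
    also have "\<dots> \<le> 2 * M * (4 * R / 5) / (R - 4 * R / 5)"
      using that R M0 by (intro frac_le mult_left_mono mult_nonneg_nonneg) auto
    also have "\<dots> = 8 * M" using R by (simp add: field_simps)
    finally show ?thesis .
  qed
  have hd: "norm (deriv h z) \<le> 40 * M / R" if z: "z \<in> cball c (3 * R / 5)" for z
  proof -
    have sub: "cball z (R / 5) \<subseteq> cball c (4 * R / 5)"
    proof
      fix x assume "x \<in> cball z (R / 5)"
      then show "x \<in> cball c (4 * R / 5)" using z dist_triangle[of c x z] by simp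
    qed
    also have sub2: "\<dots> \<subseteq> ball c R" using R by auto
    finally have 1: "h holomorphic_on cball z (R / 5)" using h(1) holomorphic_on_subset by blast
    have "norm ((deriv ^^ 1) h z) \<le> fact 1 * (8 * M) / (R / 5) ^ 1"
    proof (rule Cauchy_inequality)
      show "h holomorphic_on ball z (R / 5)" using 1 holomorphic_on_subset ball_subset_cball by blast
      show "continuous_on (cball z (R / 5)) h" using 1 holomorphic_on_imp_continuous_on by blast
      fix x assume "norm (z - x) = R / 5"
      then have "x \<in> cball z (R / 5)" by (simp add: dist_norm)
      with sub show "norm (h x) \<le> 8 * M" using hb by (auto simp: subset_iff)
    qed (use R in auto)
    then show ?thesis by (simp add: field_simps)
  qed
  have "norm (h s - h s') \<le> 40 * M / R * norm (s - s')"
  proof (rule field_differentiable_bound[OF convex_cball _ hd s s'])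
    fix z assume "z \<in> cball c (3 * R / 5)"
    moreover have "cball c (3 * R / 5) \<subseteq> ball c R" using R by auto
    ultimately show "(h has_field_derivative deriv h z) (at z within cball c (3 * R / 5))"
      using h(1) by (meson has_field_derivative_at_within holomorphic_derivI open_ball subsetD)
  qed
  then have "Re (h s) \<le> Re (h s') + 40 * M * norm (s - s') / R"
    using complex_Re_le_cmod[of "h s - h s'"] by simp
  then have "exp (Re (h s)) \<le> exp (Re (h s')) * exp (40 * M * norm (s - s') / R)"
    by (metis exp_add exp_le_cancel_iff)
  moreover have "s \<in> ball c R" "s' \<in> ball c R" using s s' R by auto
  ultimately show ?thesis
    using h(2)[of s] h(2)[of s'] mult_left_mono[of _ _ "norm (f c)"]
    by (simp add: norm_mult mult.assoc)
qed

(* Dividing out one zero near the centre halves the ratio max|f| / |f c|; hence the induction on n. *)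
lemma norm_ratio_le_exp:
  assumes S: "open S" "cball c R \<subseteq> S" and R: "R > 0"
    and s: "s \<in> cball c (R / 5)" and s': "s' \<in> cball c (R / 5)"
    and f: "f holomorphic_on S" "f c \<noteq> 0"
    and bound: "\<And>z. z \<in> cball c R \<Longrightarrow> norm (f z) \<le> 2 ^ n * norm (f c)"
    and zeros: "\<And>\<rho>. \<rho> \<in> ball c (R / 3) \<Longrightarrow> f \<rho> = 0 \<Longrightarrow> norm (s - \<rho>) \<le> norm (s' - \<rho>)"
  shows "norm (f s) \<le> norm (f s') * exp (120 * real (n + 1) * norm (s - s') / R)"
proof -
  have sub3: "ball c (R / 3) \<subseteq> S" using S(2) R by (intro order_trans[OF _ S(2)]) auto
  have sub1: "ball c R \<subseteq> S" using S(2) ball_subset_cball by blast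
  show ?thesis
    using f bound zeros
  proof (induction n arbitrary: f)
    case prems: (0 f)
    \<comment> \<open>For n = 0 the centre maximises |f| on the disc, so f is constant
      there.\<close>
    have nz: "f \<rho> \<noteq> 0" if \<rho>: "\<rho> \<in> ball c (R / 3)" for \<rho>
    proof
      assume "f \<rho> = 0"
      have "f constant_on ball c R"
      proof (rule maximum_modulus_principle[of f "ball c R" "ball c R" c])
        show "f holomorphic_on ball c R" by (rule holomorphic_on_subset[OF prems(1) sub1])
      qed (use prems R in auto)
      then have "f \<rho> = f c" using \<rho> R unfolding constant_on_def by force
      with \<open>f \<rho> = 0\<close> prems show False by simp
    qed
    \<comment> \<open>The zero-free disc has radius R / 3. Three fifths of this is R / 5, where s
      and s' lie, and 40 / (R / 3) is the constant 120 / R.\<close>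
    have "norm (f s) \<le> norm (f s') * exp (40 * 1 * norm (s - s') / (R / 3))"
    proof (rule nonvanishing_norm_ratio[OF _ nz])
      show "f holomorphic_on ball c (R / 3)" using sub3
        by (rule holomorphic_on_subset[OF prems(1)])
      show "norm (f z) < exp 1 * norm (f c)" if "z \<in> ball c (R / 3)" for z
      proof -
        have "norm (f z) \<le> 1 * norm (f c)" using prems(3)[of z] that R by auto
        also have "\<dots> < exp 1 * norm (f c)" using prems(2) by (intro mult_strict_right_mono) auto
        finally show ?thesis .
      qed
    qed (use R s s' in auto)
    then show ?case by (simp add: algebra_simps)
  next
    case (Suc n f)
    show ?case
    proof (cases "\<exists>\<rho>\<in>ball c (R / 3). f \<rho> = 0")
      case True
      then obtain \<rho> where \<rho>: "\<rho> \<in> ball c (R / 3)" "f \<rho> = 0" by blast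
      define g where "g z = (if z = \<rho> then deriv f \<rho> else (f z - f \<rho>) / (z - \<rho>))" for z
      have fg: "f z = (z - \<rho>) * g z" for z using \<rho> by (simp add: g_def)
      have g: "g holomorphic_on S" unfolding g_def
        using pole_lemma_open[OF Suc.prems(1) S(1)] by simp
      have gc: "g c \<noteq> 0" using fg[of c] Suc.prems(2) by auto
      have c\<rho>: "norm (c - \<rho>) \<le> R / 3" using \<rho> by (simp add: dist_norm)
      have gb: "norm (g z) \<le> 2 ^ n * norm (g c)" if "z \<in> cball c R" for z
      proof (rule maximum_modulus_frontier[of g "cball c R"])
        show "g holomorphic_on interior (cball c R)" using sub1 by (simp add: holomorphic_on_subset[OF g])
        show "continuous_on (closure (cball c R)) g"
          using S by (auto intro!: holomorphic_on_imp_continuous_on holomorphic_on_subset[OF g])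
        fix w assume "w \<in> frontier (cball c R)"
        then have w: "dist c w = R" using R by (simp add: frontier_cball)
        \<comment> \<open>The zero is at distance at least 2 R / 3 from the circle and at most R / 3
          from the centre; the quotient of these distances is the factor 2 gained.\<close>
        have w\<rho>: "2 * R / 3 \<le> norm (w - \<rho>)"
          using norm_triangle_ineq[of "c - \<rho>" "w - c"] norm_triangle_ineq[of "w - \<rho>" "\<rho> - c"] w c\<rho>
          by (simp add: dist_norm norm_minus_commute)
        have "norm (w - \<rho>) * norm (g w) \<le> 2 ^ Suc n * (norm (c - \<rho>) * norm (g c))"
          using Suc.prems(3)[of w] w unfolding fg[of w] fg[of c] norm_mult by simp
        also have "\<dots> \<le> 2 ^ Suc n * (R / 3 * norm (g c))"
          using c\<rho> by (intro mult_left_mono mult_right_mono) auto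
        also have "\<dots> = 2 * R / 3 * (2 ^ n * norm (g c))" by simp
        finally have "2 * R / 3 * norm (g w) \<le> 2 * R / 3 * (2 ^ n * norm (g c))"
          using mult_right_mono[OF w\<rho> norm_ge_zero[of "g w"]] by linarith
        then show "norm (g w) \<le> 2 ^ n * norm (g c)" using R by simp
      qed (use that in auto)
      have "norm (g s) \<le> norm (g s') * exp (120 * real (n + 1) * norm (s - s') / R)"
      proof (rule Suc.IH[OF g gc gb])
        show "norm (s - \<rho>') \<le> norm (s' - \<rho>')" if "\<rho>' \<in> ball c (R / 3)" "g \<rho>' = 0" for \<rho>'
          using Suc.prems(4)[OF that(1)] that(2) by (simp add: fg)
      qed
      \<comment> \<open>Putting the zero back costs nothing, since s is at most as far from it as
        s'.\<close>
      then have "norm (s - \<rho>) * norm (g s) \<le> norm (s' - \<rho>) * (norm (g s') * exp (120 * real (n + 1) * norm (s - s') / R))"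
        using Suc.prems(4)[OF \<rho>] by (intro mult_mono) auto
      also have "\<dots> \<le> norm (s' - \<rho>) * (norm (g s') * exp (120 * real (Suc n + 1) * norm (s - s') / R))"
        using R by (intro mult_left_mono) (auto intro!: divide_right_mono mult_right_mono)
      finally show ?thesis by (simp add: fg[of s] fg[of s'] norm_mult mult.assoc)
    next
      case False
      have "norm (f s) \<le> norm (f s') * exp (40 * real (Suc n + 1) * norm (s - s') / (R / 3))"
      proof (rule nonvanishing_norm_ratio)
        show "f holomorphic_on ball c (R / 3)" using sub3
          by (rule holomorphic_on_subset[OF Suc.prems(1)])
        show "norm (f z) < exp (real (Suc n + 1)) * norm (f c)" if "z \<in> ball c (R / 3)" for z
        proof -
          have "norm (f z) \<le> 2 ^ Suc n * norm (f c)" using Suc.prems(3)[of z] that R by auto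
          also have "\<dots> < exp (real (Suc n + 1)) * norm (f c)"
          proof (rule mult_strict_right_mono)
            have "(2::real) ^ Suc n \<le> exp 1 ^ Suc n" using exp_ge_add_one_self[of 1] by (intro power_mono) auto
            also have "\<dots> < exp (real (Suc n + 1))" by (simp flip: exp_of_nat_mult exp_add)
            finally show "(2::real) ^ Suc n < exp (real (Suc n + 1))" .
          qed (use Suc.prems in auto)
          finally show ?thesis .
        qed
      qed (use False R s s' in auto)
      then show ?thesis by (simp add: algebra_simps)
    qed
  qed
qed

text \<open>It plays the part of the three-circles theorem: the first N Taylor coefficients are
  estimated by m on the small disc, the tail by M on the large one. N and C depend on the radii and
  \<kappa> alone, so the same C serves all functions and centres.\<close>

lemma taylor_two_radii_bound:
  assumes "0 < r1" "0 \<le> r" "r < R1" "R1 < R" "r1 < R" "0 < \<kappa>"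
  obtains C where "C \<ge> 0"
    "\<And>h c z m M. h holomorphic_on ball c R \<Longrightarrow> (\<And>w. w \<in> cball c R1 \<Longrightarrow> norm (h w) \<le> M) \<Longrightarrow>
       (\<And>w. w \<in> cball c r1 \<Longrightarrow> norm (h w) \<le> m) \<Longrightarrow> z \<in> cball c r \<Longrightarrow>
       norm (h z :: complex) \<le> C * m + \<kappa> * M"
proof -
  define q where "q = r / R1"
  have q: "0 \<le> q" "q < 1" using assms by (auto simp: q_def)
  have "(\<lambda>N. q ^ N / (1 - q)) \<longlonglongrightarrow> 0 / (1 - q)"
    using q by (intro tendsto_divide LIMSEQ_power_zero tendsto_const) auto
  then have "eventually (\<lambda>N. q ^ N / (1 - q) < \<kappa>) sequentially"
    using assms(6) by (intro order_tendstoD) auto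
  then obtain N where N: "q ^ N / (1 - q) < \<kappa>" by (meson eventually_happens sequentially_bot)
  show ?thesis
  proof (rule that[of "\<Sum>n<N. (r / r1) ^ n"])
    fix h :: "complex \<Rightarrow> complex" and c z m M
    assume h: "h holomorphic_on ball c R" and hM: "\<And>w. w \<in> cball c R1 \<Longrightarrow> norm (h w) \<le> M"
      and hm: "\<And>w. w \<in> cball c r1 \<Longrightarrow> norm (h w) \<le> m" and z: "z \<in> cball c r"
    define a where "a n = (deriv ^^ n) h c / fact n" for n
    have M0: "0 \<le> M" using hM[of c] assms norm_ge_zero by (smt (verit) centre_in_cball)
    have cauchy: "norm (a n) \<le> B / \<rho> ^ n"
      if \<rho>: "0 < \<rho>" "\<rho> < R" and B: "\<And>w. w \<in> cball c \<rho> \<Longrightarrow> norm (h w) \<le> B" for n \<rho> B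
    proof -
      have 1: "h holomorphic_on cball c \<rho>" using h \<rho> by (auto intro: holomorphic_on_subset)
      have "norm ((deriv ^^ n) h c) \<le> fact n * B / \<rho> ^ n"
      proof (rule Cauchy_inequality[OF _ _ \<rho>(1)])
        show "h holomorphic_on ball c \<rho>" using 1 holomorphic_on_subset ball_subset_cball by blast
        show "continuous_on (cball c \<rho>) h" using 1 holomorphic_on_imp_continuous_on by blast
      qed (use B in \<open>auto simp: dist_norm\<close>)
      then show ?thesis by (simp add: a_def norm_divide field_simps)
    qed
    have zr: "norm (z - c) \<le> r" using z by (simp add: dist_norm norm_minus_commute)
    have tb: "norm (a n * (z - c) ^ n) \<le> B * (r / \<rho>) ^ n"
      if \<rho>: "0 < \<rho>" "\<rho> < R" and B: "\<And>w. w \<in> cball c \<rho> \<Longrightarrow> norm (h w) \<le> B" for n \<rho> B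
    proof -
      have "norm (a n * (z - c) ^ n) = norm (a n) * norm (z - c) ^ n" by (simp add: norm_mult norm_power)
      also have "\<dots> \<le> B / \<rho> ^ n * r ^ n"
        using cauchy[OF that, of n] zr by (intro mult_mono power_mono) (auto intro: order_trans[OF norm_ge_zero])
      finally show ?thesis by (simp add: power_divide)
    qed
    have t1: "norm (a n * (z - c) ^ n) \<le> m * (r / r1) ^ n" for n using tb[of r1 m n] hm assms by auto
    have t2: "norm (a n * (z - c) ^ n) \<le> M * q ^ n" for n using tb[of R1 M n] hM assms by (auto simp: q_def)
    have sums: "(\<lambda>n. a n * (z - c) ^ n) sums h z"
      unfolding a_def using z assms by (intro holomorphic_power_series[OF h]) auto
    then have summ: "summable (\<lambda>n. a n * (z - c) ^ n)" by (rule sums_summable)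
    have geo: "(\<lambda>n. M * q ^ (n + N)) sums (M * q ^ N / (1 - q))"
      using sums_mult[OF geometric_sums[of q], of "M * q ^ N"] q by (simp add: power_add algebra_simps)
    have "h z = (\<Sum>n. a n * (z - c) ^ n)" using sums by (simp add: sums_iff)
    also have "\<dots> = (\<Sum>n. a (n + N) * (z - c) ^ (n + N)) + (\<Sum>n<N. a n * (z - c) ^ n)"
      by (rule suminf_split_initial_segment[OF summ])
    finally have "norm (h z) \<le> norm (\<Sum>n. a (n + N) * (z - c) ^ (n + N)) + norm (\<Sum>n<N. a n * (z - c) ^ n)"
      using norm_triangle_ineq by simp
    also have "norm (\<Sum>n. a (n + N) * (z - c) ^ (n + N)) \<le> (\<Sum>n. M * q ^ (n + N))"
      by (rule norm_suminf_le[OF t2 sums_summable[OF geo]])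
    also have "\<dots> = M * q ^ N / (1 - q)" using geo by (simp add: sums_iff)
    also have "\<dots> \<le> \<kappa> * M" using N M0 mult_left_mono[of "q ^ N / (1 - q)" \<kappa> M] by (simp add: mult.commute)
    also have "norm (\<Sum>n<N. a n * (z - c) ^ n) \<le> (\<Sum>n<N. m * (r / r1) ^ n)"
      by (rule sum_norm_le) (rule t1)
    finally show "norm (h z) \<le> (\<Sum>n<N. (r / r1) ^ n) * m + \<kappa> * M"
      by (simp add: sum_distrib_left mult.commute)
  qed (use assms in \<open>auto intro: sum_nonneg\<close>)
qed

section \<open>The zeta function to the right of the imaginary axis\<close>

lemma Ln_of_nat_pos: "n > 0 \<Longrightarrow> Ln (of_nat n :: complex) = of_real (ln (real n))"
  using Ln_of_real[of "real n"] by auto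

lemma norm_nat_powr: "norm ((of_nat n :: complex) powr s) = real n powr Re s"
  by (subst norm_powr_real_powr) auto

(* (s - 1) times n^(-s) minus the integral of x^(-s) over [n, n + 1], at n + 1 in place of n; the sum continues
   (s - 1) zeta(s) to Re s > 0. *)
definition zeta_term :: "nat \<Rightarrow> complex \<Rightarrow> complex" where
  "zeta_term n s = (s - 1) * of_nat (Suc n) powr (-s) + of_nat (Suc (Suc n)) powr (1 - s) - of_nat (Suc n) powr (1 - s)"

text \<open>The summand 1 is (s - 1) times the integral of x^(-s) over [1, infinity).\<close>

definition zeta_reg :: "complex \<Rightarrow> complex" where
  "zeta_reg s = 1 + (\<Sum>n. zeta_term n s)"

lemma sum_zeta_term:
  "(\<Sum>n<N. zeta_term n s) = (s - 1) * (\<Sum>n<N. of_nat (Suc n) powr (-s)) + of_nat (Suc N) powr (1 - s) - 1"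
  by (induction N) (auto simp: zeta_term_def algebra_simps)

lemma closed_segment_nat:
  assumes "z \<in> closed_segment (of_nat m) (of_nat (Suc m) :: complex)"
  shows "Im z = 0" "real m \<le> Re z" "Re z \<le> real m + 1" "norm (z - of_nat m) \<le> 1" "norm z = \<bar>Re z\<bar>"
proof -
  obtain u where u: "0 \<le> u" "u \<le> 1" "z = (1 - of_real u) * of_nat m + of_real u * of_nat (Suc m)"
    using assms by (auto simp: in_segment scaleR_conv_of_real)
  then have z: "z = of_nat m + of_real u" by (simp add: algebra_simps)
  show "Im z = 0" "real m \<le> Re z" "Re z \<le> real m + 1" "norm (z - of_nat m) \<le> 1" using z u by auto
  then show "norm z = \<bar>Re z\<bar>" by (simp add: cmod_eq_Re)
qed

text \<open>The mean value inequality is applied twice on [m, m + 1]. The term is the increment of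
  \<open>G\<close>, whose derivative is (1 - s) (w^(-s) - m^(-s)), and this difference is itself an
  increment. The exponent gained makes the series converge for Re s > 0.\<close>

lemma norm_zeta_term_le:
  assumes s: "Re s \<ge> 0"
  shows "norm (zeta_term n s) \<le> norm (s - 1) * norm s * real (Suc n) powr (- Re s - 1)"
proof -
  define m where "m = Suc n"
  define L where "L = closed_segment (of_nat m) (of_nat (Suc m) :: complex)"
  have convL: "convex L" by (simp add: L_def)
  have Lm: "of_nat m \<in> L" "of_nat (Suc m) \<in> L" by (simp_all add: L_def)
  have nonpos: "z \<notin> \<real>\<^sub>\<le>\<^sub>0" if "z \<in> L" for z
    using closed_segment_nat(2)[of z m] that by (auto simp: L_def m_def complex_nonpos_Reals_iff)
  have pw: "norm (z powr a) \<le> real m powr Re a" if "z \<in> L" "Re a \<le> 0" for z a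
  proof -
    note z = closed_segment_nat[OF that(1)[unfolded L_def]]
    have "norm (z powr a) = Re z powr Re a"
      using z by (intro norm_powr_real_powr) (auto simp: complex_is_Real_iff)
    also have "\<dots> \<le> real m powr Re a"
      using z that(2) by (intro powr_mono2') (auto simp: m_def)
    finally show ?thesis .
  qed
  have step1: "norm (z powr (-s) - of_nat m powr (-s)) \<le> norm s * real m powr (- Re s - 1)" if z: "z \<in> L" for z
  proof -
    have "norm (z powr (-s) - of_nat m powr (-s)) \<le> (norm s * real m powr (- Re s - 1)) * norm (z - of_nat m)"
    proof (rule field_differentiable_bound[OF convL _ _ z Lm(1)])
      fix w assume w: "w \<in> L"
      show "((\<lambda>w. w powr (-s)) has_field_derivative (-s * w powr (-s - 1))) (at w within L)"
        using has_field_derivative_powr[OF nonpos[OF w], of "-s"] has_field_derivative_at_within by blast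
      show "norm (-s * w powr (-s - 1)) \<le> norm s * real m powr (- Re s - 1)"
        using pw[OF w, of "-s - 1"] s by (auto simp: norm_mult intro!: mult_left_mono)
    qed
    also have "\<dots> \<le> (norm s * real m powr (- Re s - 1)) * 1"
      using closed_segment_nat(4)[OF z[unfolded L_def]] by (intro mult_left_mono) auto
    finally show ?thesis by simp
  qed
  define G where "G z = z powr (1 - s) + (s - 1) * of_nat m powr (-s) * z" for z
  have "norm (G (of_nat (Suc m)) - G (of_nat m)) \<le> (norm (s - 1) * norm s * real m powr (- Re s - 1)) * norm (of_nat (Suc m) - of_nat m :: complex)"
  proof (rule field_differentiable_bound[OF convL _ _ Lm(2,1)])
    fix w assume w: "w \<in> L"
    show "(G has_field_derivative (1 - s) * w powr (1 - s - 1) + (s - 1) * of_nat m powr (-s)) (at w within L)"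
      unfolding G_def by (rule derivative_eq_intros has_field_derivative_at_within has_field_derivative_powr nonpos[OF w] refl | simp)+
    have "(1 - s) * w powr (1 - s - 1) + (s - 1) * of_nat m powr (-s) = (1 - s) * (w powr (-s) - of_nat m powr (-s))"
      by (simp add: algebra_simps)
    then show "norm ((1 - s) * w powr (1 - s - 1) + (s - 1) * of_nat m powr (-s)) \<le> norm (s - 1) * norm s * real m powr (- Re s - 1)"
      using mult_left_mono[OF step1[OF w] norm_ge_zero[of "s - 1"]] by (simp add: norm_mult norm_minus_commute mult.assoc)
  qed
  moreover have "G (of_nat (Suc m)) - G (of_nat m) = zeta_term n s"
    by (simp add: G_def zeta_term_def m_def algebra_simps)
  ultimately show ?thesis by (simp add: m_def)
qed

lemma summable_Suc_powr: "a < -1 \<Longrightarrow> summable (\<lambda>n. real (Suc n) powr a)"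
  using summable_real_powr_iff[of a] summable_Suc_iff[of "\<lambda>n. real n powr a"] by simp

lemma norm_zeta_term_le_uniform:
  assumes "0 < \<sigma>" "\<sigma> \<le> Re s"
  shows "norm (zeta_term n s) \<le> (1 + norm s)\<^sup>2 * real (Suc n) powr (- \<sigma> - 1)"
proof -
  have "norm (zeta_term n s) \<le> norm (s - 1) * norm s * real (Suc n) powr (- Re s - 1)"
    using assms by (intro norm_zeta_term_le) auto
  also have "\<dots> \<le> (1 + norm s) * (1 + norm s) * real (Suc n) powr (- \<sigma> - 1)"
    using assms norm_triangle_ineq4[of s 1] by (intro mult_mono powr_mono) auto
  finally show ?thesis by (simp add: power2_eq_square)
qed

lemma zeta_term_sums:
  assumes "Re s > 0"
  shows "(\<lambda>n. zeta_term n s) sums (zeta_reg s - 1)"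
proof -
  have "summable (\<lambda>n. zeta_term n s)"
    by (rule summable_comparison_test'[OF summable_mult[OF summable_Suc_powr] norm_zeta_term_le_uniform])
       (use assms in auto)
  then show ?thesis by (simp add: zeta_reg_def summable_sums)
qed

lemma zeta_reg_bound:
  assumes "\<sigma> > 0"
  obtains C where "C \<ge> 1" "\<And>s. Re s \<ge> \<sigma> \<Longrightarrow> norm (zeta_reg s) \<le> C * (1 + norm s)\<^sup>2"
proof -
  define K where "K = (\<Sum>n. real (Suc n) powr (- \<sigma> - 1))"
  have summ: "summable (\<lambda>n. real (Suc n) powr (- \<sigma> - 1))" using assms by (intro summable_Suc_powr) auto
  have K0: "K \<ge> 0" unfolding K_def by (intro suminf_nonneg summ) auto
  show ?thesis
  proof (rule that[of "1 + K"])
    fix s assume s: "Re s \<ge> \<sigma>"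
    have "norm (\<Sum>n. zeta_term n s) \<le> (\<Sum>n. (1 + norm s)\<^sup>2 * real (Suc n) powr (- \<sigma> - 1))"
      by (rule norm_suminf_le[OF norm_zeta_term_le_uniform summable_mult[OF summ]]) (use assms s in auto)
    also have "\<dots> = (1 + norm s)\<^sup>2 * K" unfolding K_def by (rule suminf_mult[OF summ])
    finally have "norm (zeta_reg s) \<le> 1 + (1 + norm s)\<^sup>2 * K"
      unfolding zeta_reg_def using norm_triangle_ineq[of 1 "\<Sum>n. zeta_term n s"] by simp
    moreover have "1 \<le> (1 + norm s)\<^sup>2" by simp
    ultimately show "norm (zeta_reg s) \<le> (1 + K) * (1 + norm s)\<^sup>2"
      unfolding distrib_right mult.commute[of K] mult_1_left by linarith
  qed (use K0 in auto)
qed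

lemma holomorphic_zeta_reg: "zeta_reg holomorphic_on {s. Re s > 0}"
proof (rule holomorphic_uniform_sequence[of _ "\<lambda>N s. 1 + (\<Sum>n<N. zeta_term n s)"])
  show "open {s. Re s > 0}" by (rule open_halfspace_Re_gt)
  show "(\<lambda>s. 1 + (\<Sum>n<N. zeta_term n s)) holomorphic_on {s. Re s > 0}" for N
    unfolding zeta_term_def by (intro holomorphic_intros) (auto simp: complex_nonpos_Reals_iff)
  fix x :: complex assume "x \<in> {s. Re s > 0}"
  then have x: "Re x > 0" by simp
  define d where "d = Re x / 2"
  have re: "d \<le> Re y" if "y \<in> cball x d" for y
    using that abs_Re_le_cmod[of "x - y"] by (simp add: d_def dist_norm)
  have "uniform_limit (cball x d) (\<lambda>N s. \<Sum>n<N. zeta_term n s) (\<lambda>s. \<Sum>n. zeta_term n s) sequentially"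
  proof (rule Weierstrass_m_test)
    fix n y assume y: "y \<in> cball x d"
    have "norm (zeta_term n y) \<le> (1 + norm y)\<^sup>2 * real (Suc n) powr (- d - 1)"
      using re[OF y] x by (intro norm_zeta_term_le_uniform) (auto simp: d_def)
    also have "\<dots> \<le> (1 + (norm x + d))\<^sup>2 * real (Suc n) powr (- d - 1)"
      using y norm_triangle_ineq3[of y x] by (intro mult_right_mono power_mono) (auto simp: dist_norm norm_minus_commute)
    finally show "norm (zeta_term n y) \<le> (1 + (norm x + d))\<^sup>2 * real (Suc n) powr (- d - 1)" .
  qed (use x in \<open>auto simp: d_def simp del: of_nat_Suc intro!: summable_mult summable_Suc_powr\<close>)
  then have "uniform_limit (cball x d) (\<lambda>N s. 1 + (\<Sum>n<N. zeta_term n s)) zeta_reg sequentially"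
    unfolding zeta_reg_def by (intro uniform_limit_intros)
  moreover have "cball x d \<subseteq> {s. Re s > 0}" using re x by (force simp: d_def)
  ultimately show "\<exists>d>0. cball x d \<subseteq> {s. 0 < Re s} \<and>
      uniform_limit (cball x d) (\<lambda>N s. 1 + (\<Sum>n<N. zeta_term n s)) zeta_reg sequentially"
    using x by (intro exI[of _ d]) (auto simp: d_def)
qed

lemma tendsto_Suc_powr_0: "Re a < 0 \<Longrightarrow> (\<lambda>n. of_nat (Suc n) powr a :: complex) \<longlonglongrightarrow> 0"
  by (rule tendsto_norm_zero_cancel, unfold norm_nat_powr,
      rule tendsto_neg_powr[OF _ filterlim_compose[OF filterlim_real_sequentially filterlim_Suc]]) auto

text \<open>By the telescoped form of the partial sums, since (N + 1)^(1 - s) tends to 0 when Re s >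
  1.\<close>

lemma zeta_series_sums:
  assumes "Re s > 1"
  shows "(\<lambda>n. of_nat (Suc n) powr (-s)) sums (zeta_reg s / (s - 1))"
proof -
  have s1: "s \<noteq> 1" using assms by auto
  have "(\<lambda>N. ((\<Sum>n<N. zeta_term n s) + 1 - of_nat (Suc N) powr (1 - s)) / (s - 1)) \<longlonglongrightarrow> (zeta_reg s - 1 + 1 - 0) / (s - 1)"
    using zeta_term_sums[of s] assms unfolding sums_def
    by (intro tendsto_intros tendsto_Suc_powr_0) (auto simp: s1)
  moreover have "((\<Sum>n<N. zeta_term n s) + 1 - of_nat (Suc N) powr (1 - s)) / (s - 1) = (\<Sum>n<N. of_nat (Suc n) powr (-s))" for N
    using s1 by (simp add: sum_zeta_term)
  ultimately show ?thesis by (simp add: sums_def)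
qed

section \<open>The alternating series and its link with \<open>dirichlet_eta\<close>\<close>

lemma LIMSEQ_even_odd:
  fixes X :: "nat \<Rightarrow> 'a::metric_space"
  assumes "(\<lambda>n. X (2 * n)) \<longlonglongrightarrow> L" "(\<lambda>n. X (2 * n + 1)) \<longlonglongrightarrow> L"
  shows "X \<longlonglongrightarrow> L"
proof (rule metric_LIMSEQ_I)
  fix r :: real assume "r > 0"
  then obtain A B where A: "\<And>n. n \<ge> A \<Longrightarrow> dist (X (2 * n)) L < r" and B: "\<And>n. n \<ge> B \<Longrightarrow> dist (X (2 * n + 1)) L < r"
    using assms[THEN metric_LIMSEQ_D] by meson
  have "dist (X n) L < r" if "n \<ge> 2 * (A + B) + 1" for n
  proof (cases "even n")
    case True
    then show ?thesis using A[of "n div 2"] that by auto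
  next
    case False
    then show ?thesis using B[of "n div 2"] that by (auto elim!: oddE)
  qed
  then show "\<exists>no. \<forall>n\<ge>no. dist (X n) L < r" by blast
qed

lemma two_Suc_powr: "of_nat (Suc (2 * n + 1)) powr a = 2 powr a * (of_nat (Suc n) :: complex) powr a"
proof -
  have "(of_nat (Suc (2 * n + 1)) :: complex) = 2 * of_nat (Suc n)" by simp
  also have "\<dots> powr a = 2 powr a * of_nat (Suc n) powr a"
    by (rule powr_times_real) (auto simp del: of_nat_Suc)
  finally show ?thesis .
qed

text \<open>Passing to alternating signs subtracts each even-numbered term twice. This is eta = (1 -
  2^(1 - s)) zeta at the level of partial sums, of length 2 N on one side and N on the
  other.\<close>

lemma sum_alternating_powr:
  "(\<Sum>n<2 * N. (-1) ^ n * of_nat (Suc n) powr (-s)) =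
   (\<Sum>n<2 * N. of_nat (Suc n) powr (-s)) - 2 powr (1 - s) * (\<Sum>n<N. of_nat (Suc n) powr (-s) :: complex)"
proof (induction N)
  case (Suc N)
  have "2 powr (1 - s) = 2 * 2 powr (-s)" by (simp add: powr_diff powr_minus_divide)
  then have "2 powr (1 - s) * of_nat (Suc N) powr (-s) = 2 * of_nat (Suc (2 * N + 1)) powr (-s)"
    unfolding two_Suc_powr by (simp add: mult.assoc)
  then show ?case using Suc.IH by (simp add: algebra_simps del: of_nat_Suc)
qed simp

text \<open>For Re s \<le> 1 the partial sums of the zeta series carry the term (N + 1)^(1 - s),
  which does not vanish in the limit. Between the lengths 2 N and N these terms cancel up to
  \<open>zeta_term (2 * N) s\<close> and a multiple of (2 N + 1)^(-s), both of which tend to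
  0.\<close>

lemma eta_sums:
  assumes s: "Re s > 0" "s \<noteq> 1"
  shows "(\<lambda>n. (-1) ^ n * of_nat (Suc n) powr (-s)) sums ((1 - 2 powr (1 - s)) * zeta_reg s / (s - 1))"
proof -
  define A where "A N = (\<Sum>n<N. zeta_term n s)" for N
  define p where "p n = (of_nat (Suc n) :: complex) powr (1 - s)" for n
  have A: "A \<longlonglongrightarrow> zeta_reg s - 1" using zeta_term_sums[OF s(1)] by (simp add: A_def[abs_def] sums_def)
  have t2: "filterlim (\<lambda>n::nat. 2 * n) sequentially sequentially" by (rule mult_nat_left_at_top) simp
  have A2: "(\<lambda>N. A (2 * N)) \<longlonglongrightarrow> zeta_reg s - 1" by (rule filterlim_compose[OF A t2])
  have pw0: "(\<lambda>N. of_nat (Suc (2 * N)) powr (-s) :: complex) \<longlonglongrightarrow> 0"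
    by (rule filterlim_compose[OF tendsto_Suc_powr_0 t2]) (use s in auto)
  have tz: "(\<lambda>N. zeta_term (2 * N) s) \<longlonglongrightarrow> 0"
    by (rule filterlim_compose[OF summable_LIMSEQ_zero t2]) (use zeta_term_sums[OF s(1)] sums_summable in blast)
  have X: "(\<Sum>n<2 * N. (-1) ^ n * of_nat (Suc n) powr (-s)) =
     (A (2 * N) + 1 - 2 powr (1 - s) * (A N + 1) + (zeta_term (2 * N) s - (s - 1) * of_nat (Suc (2 * N)) powr (-s))) / (s - 1)" for N
  proof -
    have a: "(s - 1) * (\<Sum>n<M. of_nat (Suc n) powr (-s)) = A M - p M + 1" for M
      by (simp add: A_def sum_zeta_term p_def)
    have b: "2 powr (1 - s) * p N = zeta_term (2 * N) s - (s - 1) * of_nat (Suc (2 * N)) powr (-s) + p (2 * N)"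
      using two_Suc_powr[of N "1 - s"] by (simp add: p_def zeta_term_def del: of_nat_Suc)
    have "(s - 1) * (\<Sum>n<2 * N. (-1) ^ n * of_nat (Suc n) powr (-s)) = (A (2 * N) - p (2 * N) + 1) - 2 powr (1 - s) * (A N - p N + 1)"
      unfolding sum_alternating_powr a[symmetric] by (simp add: algebra_simps)
    also have "\<dots> = A (2 * N) + 1 - 2 powr (1 - s) * (A N + 1) + (2 powr (1 - s) * p N - p (2 * N))"
      by (simp add: algebra_simps)
    finally show ?thesis unfolding b using s by (simp add: field_simps)
  qed
  have ev: "(\<lambda>N. \<Sum>n<2 * N. (-1) ^ n * of_nat (Suc n) powr (-s)) \<longlonglongrightarrow>
     (zeta_reg s - 1 + 1 - 2 powr (1 - s) * (zeta_reg s - 1 + 1) + (0 - (s - 1) * 0)) / (s - 1)"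
    unfolding X using s by (intro tendsto_intros A A2 tz pw0) auto
  have "(\<lambda>N. (\<Sum>n<2 * N. (-1) ^ n * of_nat (Suc n) powr (-s)) + of_nat (Suc (2 * N)) powr (-s)) \<longlonglongrightarrow>
     (zeta_reg s - 1 + 1 - 2 powr (1 - s) * (zeta_reg s - 1 + 1) + (0 - (s - 1) * 0)) / (s - 1) + 0"
    by (intro tendsto_add ev pw0)
  then have "(\<lambda>N. \<Sum>n<2 * N + 1. (-1) ^ n * of_nat (Suc n) powr (-s)) \<longlonglongrightarrow>
     (zeta_reg s - 1 + 1 - 2 powr (1 - s) * (zeta_reg s - 1 + 1) + (0 - (s - 1) * 0)) / (s - 1)"
    by simp
  from LIMSEQ_even_odd[OF ev this] show ?thesis by (simp add: sums_def algebra_simps)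
qed

lemma dirichlet_eta_eq:
  assumes "Re s > 0" "s \<noteq> 1"
  shows "dirichlet_eta s = (1 - 2 powr (1 - s)) * zeta_reg s / (s - 1)"
  using eta_sums[OF assms] by (simp add: dirichlet_eta_def sums_iff powr_minus_divide)

text \<open>A zero of \<open>zeta_reg\<close> makes the numerator \<open>dirichlet_eta\<close> of
  \<open>riemann_zeta\<close> vanish, so the quotient is 0 whatever its denominator.\<close>

lemma RH_zeta_reg_strip:
  assumes "riemann_hypothesis" "1/2 < Re s" "Re s < 1"
  shows "zeta_reg s \<noteq> 0"
proof
  assume "zeta_reg s = 0"
  then have "riemann_zeta s = 0" using assms by (cases "s = 1") (simp_all add: riemann_zeta_def dirichlet_eta_eq)
  then show False using assms unfolding riemann_hypothesis_def by force
qed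

lemma zeta_reg_1 [simp]: "zeta_reg 1 = 1"
  by (simp add: zeta_reg_def zeta_term_def del: of_nat_Suc)

section \<open>Non-vanishing on the line of abscissa one\<close>

lemma dirichlet_zeta_derivative:
  assumes \<sigma>: "\<sigma> > 1"
  shows "\<And>s. Re s > \<sigma> \<Longrightarrow> summable (\<lambda>n. of_real (ln (real (Suc n))) * of_nat (Suc n) powr (-s) :: complex)"
    and "\<And>s. Re s > \<sigma> \<Longrightarrow> ((\<lambda>s. \<Sum>n. of_nat (Suc n) powr (-s)) has_field_derivative
           - (\<Sum>n. of_real (ln (real (Suc n))) * of_nat (Suc n) powr (-s))) (at s)"
proof -
  define S where "S = {s. Re s > \<sigma>}"
  obtain g g' where g: "\<forall>x\<in>S. (\<lambda>n. of_nat (Suc n) powr (-x)) sums g x \<and>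
      (\<lambda>n. - of_real (ln (real (Suc n))) * of_nat (Suc n) powr (-x)) sums g' x \<and> (g has_field_derivative g' x) (at x)"
  proof (rule series_and_derivative_comparison)
    show "open S" unfolding S_def by (rule open_halfspace_Re_gt)
    show "summable (\<lambda>n. real (Suc n) powr (-\<sigma>))" using \<sigma> by (intro summable_Suc_powr) auto
    show "\<forall>\<^sub>F n in sequentially. \<forall>x\<in>S. norm (of_nat (Suc n) powr (-x) :: complex) \<le> real (Suc n) powr (-\<sigma>)"
      unfolding norm_nat_powr by (intro always_eventually allI ballI powr_mono) (auto simp: S_def)
    fix n and x :: complex
    have e: "of_nat (Suc n) powr a = exp (a * of_real (ln (real (Suc n))))" for a :: complex
      using Ln_of_nat_pos[of "Suc n"] by (simp add: powr_def del: of_nat_Suc)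
    show "((\<lambda>x. of_nat (Suc n) powr (-x)) has_field_derivative
        - of_real (ln (real (Suc n))) * of_nat (Suc n) powr (-x)) (at x)"
      unfolding e by (auto intro!: derivative_eq_intros)
  qed blast
  fix s assume s: "Re s > \<sigma>"
  then have "summable (\<lambda>n. - of_real (ln (real (Suc n))) * of_nat (Suc n) powr (-s) :: complex)"
    using g sums_summable by (auto simp: S_def)
  from summable_minus[OF this]
  show sm: "summable (\<lambda>n. of_real (ln (real (Suc n))) * of_nat (Suc n) powr (-s) :: complex)"
    by simp
  have "(g has_field_derivative g' s) (at s)" using g s by (auto simp: S_def)
  also have "g' s = - (\<Sum>n. of_real (ln (real (Suc n))) * of_nat (Suc n) powr (-s))"
    using g s sums_unique[of _ "g' s"] suminf_minus[OF sm] by (force simp: S_def)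
  finally show "((\<lambda>s. \<Sum>n. of_nat (Suc n) powr (-s)) has_field_derivative
           - (\<Sum>n. of_real (ln (real (Suc n))) * of_nat (Suc n) powr (-s))) (at s)"
  proof (rule DERIV_cong_ev[THEN iffD1, rotated 3])
    have "eventually (\<lambda>x. x \<in> S) (nhds s)"
      using s unfolding S_def by (intro eventually_nhds_in_open open_halfspace_Re_gt) auto
    then show "\<forall>\<^sub>F x in nhds s. g x = (\<Sum>n. of_nat (Suc n) powr (-x))"
      by eventually_elim (use g sums_unique in blast)
  qed auto
qed

text \<open>For Re s > 1 this is -zeta'/zeta.\<close>

definition mangoldt_series :: "complex \<Rightarrow> complex" where
  "mangoldt_series s = (\<Sum>n. mangoldt n * of_nat n powr (-s))"

lemma norm_mangoldt_term:
  "norm (mangoldt n * of_nat n powr (-s) :: complex) = mangoldt n * real n powr (- Re s)"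
  by (simp add: norm_mult norm_nat_powr)

lemma mangoldt_summable:
  assumes "\<sigma> > 1"
  shows "summable (\<lambda>n. mangoldt n * real n powr (-\<sigma>))"
proof -
  have "summable (\<lambda>n. of_real (ln (real (Suc n))) * of_nat (Suc n) powr (-of_real \<sigma>) :: complex)"
    using dirichlet_zeta_derivative(1)[of "(1 + \<sigma>) / 2" "of_real \<sigma>"] assms by simp
  also have "(\<lambda>n. of_real (ln (real (Suc n))) * of_nat (Suc n) powr (-of_real \<sigma>) :: complex) =
      (\<lambda>n. of_real (ln (real (Suc n)) * real (Suc n) powr (-\<sigma>)))"
    by (simp add: powr_of_real[symmetric] del: of_nat_Suc powr_of_real)
  finally have "summable (\<lambda>n. ln (real (Suc n)) * real (Suc n) powr (-\<sigma>))"
    by (subst (asm) summable_complex_of_real)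
  then have "summable (\<lambda>n. mangoldt (Suc n) * real (Suc n) powr (-\<sigma>))"
    by (rule summable_comparison_test')
       (auto simp: mangoldt_nonneg abs_mult intro!: mult_right_mono mangoldt_le simp del: of_nat_Suc)
  then show ?thesis by (subst (asm) summable_Suc_iff)
qed

text \<open>The absolutely convergent double series over (m, d) is regrouped by the product n = m d;
  the sum of the Mangoldt function over the divisors of n is ln n.\<close>

lemma mangoldt_series_mult_zeta:
  assumes s: "Re s > 1"
  shows "mangoldt_series s * (\<Sum>n. of_nat (Suc n) powr (-s)) = (\<Sum>n. of_real (ln (real (Suc n))) * of_nat (Suc n) powr (-s))"
proof -
  define a where "a n = (mangoldt n * of_nat n powr (-s) :: complex)" for n
  define b where "b n = (of_nat n powr (-s) :: complex)" for n
  have sa: "summable (\<lambda>n. norm (a n))"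
    unfolding a_def norm_mangoldt_term using mangoldt_summable[OF s] .
  have sb: "summable (\<lambda>n. norm (b n))"
    unfolding b_def norm_nat_powr using s summable_real_powr_iff[of "-Re s"] by simp
  have a: "(a has_sum mangoldt_series s) UNIV"
    using norm_summable_imp_has_sum[OF sa summable_sums[OF summable_norm_cancel[OF sa]]]
    by (simp add: mangoldt_series_def a_def[abs_def])
  have b0: "(\<lambda>n. b (Suc n)) sums (\<Sum>n. b (Suc n))"
    using summable_Suc_iff summable_norm_cancel[OF sb] summable_sums by blast
  then have "b sums (\<Sum>n. b (Suc n))" using sums_Suc_iff[of b] by (simp add: b_def)
  then have b: "(b has_sum (\<Sum>n. b (Suc n))) UNIV" using norm_summable_imp_has_sum[OF sb] by blast
  define B where "B = (\<Sum>n. b (Suc n))"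
  have nsb: "(\<lambda>n. norm (b n)) summable_on UNIV"
    using norm_summable_imp_summable_on[of b] sb norm_summable_imp_summable_on[of "\<lambda>n. norm (b n)"] by simp
  have nsa: "(\<lambda>n. norm (a n)) summable_on UNIV"
    using sa norm_summable_imp_summable_on[of "\<lambda>n. norm (a n)"] by simp
  have "(\<lambda>z. norm (case z of (m,d) \<Rightarrow> a m * b d)) summable_on (UNIV \<times> UNIV)"
    unfolding Infinite_Sum.abs_summable_on_Sigma_iff
    using nsa nsb by (auto simp: norm_mult abs_mult infsum_cmult_right' intro!: summable_on_cmult_right summable_on_cmult_left)
  then have summ: "(\<lambda>(m,d). a m * b d) summable_on (UNIV \<times> UNIV)"
    by (rule abs_summable_summable)
  have AB: "((\<lambda>(m,d). a m * b d) has_sum (mangoldt_series s * B)) (UNIV \<times> UNIV)"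
  proof (rule has_sum_SigmaI[OF _ _ summ])
    show "((\<lambda>d. case (m, d) of (m, d) \<Rightarrow> a m * b d) has_sum (a m * B)) UNIV" for m
      using has_sum_cmult_right[OF b, of "a m"] by (simp add: B_def)
    show "((\<lambda>m. a m * B) has_sum (mangoldt_series s * B)) UNIV"
      by (rule has_sum_cmult_left[OF a])
  qed
  \<comment> \<open>The index 0 contributes nothing because 0 powr w = 0. It is removed since (m, d)
    is recovered from (m d, m) for positive indices only.\<close>
  have "((\<lambda>(m,d). a m * b d) has_sum (mangoldt_series s * B)) ({0<..} \<times> {0<..})"
    by (rule has_sum_cong_neutral[THEN iffD1, OF _ _ _ AB]) (auto simp: a_def b_def)
  moreover have pos: "0 < m" "0 < n div m" if "0 < n" "m dvd n" for m n :: nat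
    using that dvd_imp_le[of m n] by (auto intro: dvd_pos_nat simp: div_greater_zero_iff)
  have "((\<lambda>(m,d). a m * b d) has_sum (mangoldt_series s * B)) ({0<..} \<times> {0<..})
      \<longleftrightarrow> ((\<lambda>(n,m). a m * b (n div m)) has_sum (mangoldt_series s * B)) (Sigma {0<..} (\<lambda>n. {m. m dvd n}))"
    by (rule has_sum_reindex_bij_witness[where i = "\<lambda>(n,m). (m, n div m)" and j = "\<lambda>(m,d). (m * d, m)"])
       (auto simp: pos)
  ultimately have dbl: "((\<lambda>(n,m). a m * b (n div m)) has_sum (mangoldt_series s * B)) (Sigma {0<..} (\<lambda>n. {m. m dvd n}))" by blast
  have "((\<lambda>n. of_real (ln (real n)) * of_nat n powr (-s)) has_sum (mangoldt_series s * B)) {0<..}"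
  proof (rule has_sum_SigmaD[OF dbl])
    fix n :: nat assume n: "n \<in> {0<..}"
    have "a m * b (n div m) = mangoldt m * of_nat n powr (-s)" if m: "m dvd n" for m
    proof -
      obtain d where d: "n = m * d" using m by (rule dvdE)
      then have "n div m = d" using n by simp
      moreover have "(of_nat m * of_nat d) powr (-s) = of_nat m powr (-s) * (of_nat d :: complex) powr (-s)"
        by (rule powr_times_real) auto
      ultimately show ?thesis using d by (simp add: a_def b_def mult.assoc)
    qed
    then have "(\<Sum>m | m dvd n. a m * b (n div m)) = of_real (ln (real n)) * of_nat n powr (-s)"
      using n mangoldt_sum[of n, where 'a = complex] by (simp flip: sum_distrib_right)
    then show "((\<lambda>m. case (n, m) of (n, m) \<Rightarrow> a m * b (n div m)) has_sum of_real (ln (real n)) * of_nat n powr (-s)) {m. m dvd n}"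
      using has_sum_finite[of "{m. m dvd n}" "\<lambda>m. a m * b (n div m)"] n by simp
  qed
  then have "((\<lambda>n. of_real (ln (real n)) * of_nat n powr (-s)) has_sum (mangoldt_series s * B)) UNIV"
    by (rule has_sum_cong_neutral[THEN iffD1, rotated -1]) auto
  then have "(\<lambda>n. of_real (ln (real n)) * of_nat n powr (-s)) sums (mangoldt_series s * B)"
    by (rule has_sum_imp_sums)
  then have "(\<lambda>n. of_real (ln (real (Suc n))) * of_nat (Suc n) powr (-s)) sums (mangoldt_series s * B)"
    by (subst sums_Suc_iff) simp
  then show ?thesis by (simp add: sums_iff B_def b_def)
qed

text \<open>The identity is multiplied through by \<open>zeta_reg s\<close> to avoid dividing by a
  value that might be 0: non-vanishing for Re s > 1 is deduced from it afterwards.\<close>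

lemma mangoldt_series_eq:
  assumes s: "Re s > 1"
  shows "mangoldt_series s * zeta_reg s = zeta_reg s / (s - 1) - deriv zeta_reg s"
proof -
  have s1: "s - 1 \<noteq> 0" using s by auto
  have Z: "(zeta_reg has_field_derivative deriv zeta_reg s) (at s)"
    using s by (intro holomorphic_derivI[OF holomorphic_zeta_reg open_halfspace_Re_gt]) auto
  have eq: "(\<Sum>n. of_nat (Suc n) powr (-z)) = zeta_reg z / (z - 1)" if "Re z > 1" for z
    using zeta_series_sums[OF that] by (simp add: sums_iff)
  define L where "L = (\<Sum>n. of_real (ln (real (Suc n))) * of_nat (Suc n) powr (-s) :: complex)"
  have "((\<lambda>s. \<Sum>n. of_nat (Suc n) powr (-s)) has_field_derivative - L) (at s)"
    using dirichlet_zeta_derivative(2)[of "(1 + Re s) / 2" s] s by (simp add: L_def)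
  then have "((\<lambda>z. zeta_reg z / (z - 1)) has_field_derivative - L) (at s)"
  proof (rule DERIV_cong_ev[THEN iffD1, rotated 3])
    have "eventually (\<lambda>x. x \<in> {z. Re z > 1}) (nhds s)"
      using s by (intro eventually_nhds_in_open open_halfspace_Re_gt) auto
    then show "\<forall>\<^sub>F x in nhds s. (\<Sum>n. of_nat (Suc n) powr (-x)) = zeta_reg x / (x - 1)"
      by eventually_elim (use eq in auto)
  qed auto
  moreover have "((\<lambda>z. zeta_reg z / (z - 1)) has_field_derivative
      (deriv zeta_reg s * (s - 1) - zeta_reg s) / (s - 1)\<^sup>2) (at s)"
    using s1 by (auto intro!: derivative_eq_intros Z simp: power2_eq_square)
  ultimately have "- L = (deriv zeta_reg s * (s - 1) - zeta_reg s) / (s - 1)\<^sup>2"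
    by (rule DERIV_unique)
  moreover have "mangoldt_series s * (zeta_reg s / (s - 1)) = L"
    using mangoldt_series_mult_zeta[OF s] eq[OF s] by (simp add: L_def)
  ultimately have *: "mangoldt_series s * (zeta_reg s / (s - 1)) = (zeta_reg s - deriv zeta_reg s * (s - 1)) / (s - 1)\<^sup>2"
    by (metis minus_diff_eq minus_divide_left minus_minus)
  have "mangoldt_series s * zeta_reg s = (s - 1) * (mangoldt_series s * (zeta_reg s / (s - 1)))" using s1 by simp
  also have "\<dots> = (zeta_reg s - deriv zeta_reg s * (s - 1)) / (s - 1)"
    unfolding * using s1 by (simp add: power2_eq_square)
  also have "\<dots> = zeta_reg s / (s - 1) - deriv zeta_reg s" using s1 by (simp add: diff_divide_distrib)
  finally show ?thesis .
qed

text \<open>The number k is the order of vanishing of f at z. The point w excludes the zero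
  function, for which there is no such order.\<close>

lemma logderiv_limit:
  assumes f: "f holomorphic_on S" and S: "open S" "connected S" and z: "z \<in> S" and w: "w \<in> S" "f w \<noteq> 0"
  obtains k :: nat where "((\<lambda>x. (x - z) * deriv f x / f x) \<longlongrightarrow> of_nat k) (at z)" "k = 0 \<longleftrightarrow> f z \<noteq> 0"
    "eventually (\<lambda>x. f x \<noteq> 0) (at z)"
proof (cases "f z = 0")
  case False
  have d: "f analytic_on {z}" using f S z analytic_on_open analytic_on_subset by (metis empty_subsetI insert_subset)
  have c: "f \<midarrow>z\<rightarrow> f z" "deriv f \<midarrow>z\<rightarrow> deriv f z"
    using isContD analytic_at_imp_isCont d analytic_deriv by blast+
  have "((\<lambda>x. (x - z) * deriv f x / f x) \<longlongrightarrow> (z - z) * deriv f z / f z) (at z)"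
    by (intro tendsto_intros c False)
  moreover have "eventually (\<lambda>x. f x \<noteq> 0) (at z)" using c(1) False by (rule tendsto_imp_eventually_ne)
  ultimately show ?thesis using that[of 0] False by simp
next
  case True
  have "\<not> f constant_on S" using True w z unfolding constant_on_def by metis
  then obtain g r n where g: "0 < n" "0 < r" "ball z r \<subseteq> S" "g holomorphic_on ball z r"
    "\<And>w. w \<in> ball z r \<Longrightarrow> f w = (w - z) ^ n * g w" "\<And>w. w \<in> ball z r \<Longrightarrow> g w \<noteq> 0"
    using holomorphic_factor_zero_nonconstant[OF f S z True] by metis
  have d: "g analytic_on {z}" using g analytic_on_open analytic_on_subset
    by (metis centre_in_ball empty_subsetI insert_subset open_ball)
  have c: "g \<midarrow>z\<rightarrow> g z" "deriv g \<midarrow>z\<rightarrow> deriv g z"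
    using isContD analytic_at_imp_isCont d analytic_deriv by blast+
  have ev: "eventually (\<lambda>x. x \<in> ball z r - {z}) (at z)"
    using g(2) by (intro eventually_at_in_open) auto
  have "((\<lambda>x. of_nat n + (x - z) * deriv g x / g x) \<longlongrightarrow> of_nat n + (z - z) * deriv g z / g z) (at z)"
    using g by (intro tendsto_intros c) auto
  then have "((\<lambda>x. of_nat n + (x - z) * deriv g x / g x) \<longlongrightarrow> of_nat n) (at z)" by simp
  moreover have "eventually (\<lambda>x. of_nat n + (x - z) * deriv g x / g x = (x - z) * deriv f x / f x) (at z)"
    using ev
  proof eventually_elim
    case (elim x)
    have gd: "(g has_field_derivative deriv g x) (at x)"
      using elim g(4) by (intro holomorphic_derivI[of _ "ball z r"]) auto
    have "((\<lambda>w. (w - z) ^ n * g w) has_field_derivative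
        of_nat n * (x - z) ^ (n - 1) * g x + (x - z) ^ n * deriv g x) (at x)"
      by (auto intro!: derivative_eq_intros gd)
    then have "(f has_field_derivative of_nat n * (x - z) ^ (n - 1) * g x + (x - z) ^ n * deriv g x) (at x)"
    proof (rule DERIV_cong_ev[THEN iffD1, rotated 3])
      have "eventually (\<lambda>w. w \<in> ball z r) (nhds x)" using elim by (intro eventually_nhds_in_open) auto
      then show "\<forall>\<^sub>F w in nhds x. (w - z) ^ n * g w = f w" by eventually_elim (simp add: g(5))
    qed auto
    then have "deriv f x = of_nat n * (x - z) ^ (n - 1) * g x + (x - z) ^ n * deriv g x"
      by (rule DERIV_imp_deriv)
    moreover have "(x - z) ^ n = (x - z) ^ (n - 1) * (x - z)" using g(1) by (metis power_minus_mult)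
    moreover have "of_nat n + u * g' / y = u * (of_nat n * P * y + P * u * g') / (P * u * y)"
      if "P \<noteq> 0" "u \<noteq> 0" "y \<noteq> 0" for P u y g' :: complex
      using that by (simp add: field_simps)
    ultimately have "of_nat n + u * deriv g x / g x = u * deriv f x / f x" if "u = x - z" for u
      using elim g(5)[of x] g(6)[of x] that by (metis (no_types) DiffD1 DiffD2 power_not_zero right_minus_eq singletonI)
    then show ?case by simp
  qed
  ultimately have "((\<lambda>x. (x - z) * deriv f x / f x) \<longlongrightarrow> of_nat n) (at z)"
    by (rule Lim_transform_eventually)
  moreover have "eventually (\<lambda>x. f x \<noteq> 0) (at z)"
    using ev by eventually_elim (use g(5,6) in auto)
  ultimately show ?thesis using that[of n] True g(1) by simp
qed

lemma zeta_reg_logderiv_limit: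
  assumes "Re z > 0"
  obtains k :: nat where "((\<lambda>x. (x - z) * deriv zeta_reg x / zeta_reg x) \<longlongrightarrow> of_nat k) (at z)" "k = 0 \<longleftrightarrow> zeta_reg z \<noteq> 0"
    "eventually (\<lambda>x. zeta_reg x \<noteq> 0) (at z)"
proof -
  have 1: "connected {s. Re s > 0}" by (rule convex_connected[OF convex_halfspace_Re_gt])
  have 2: "z \<in> {s. Re s > 0}" and 3: "1 \<in> {s. Re s > 0}" and 4: "zeta_reg 1 \<noteq> 0" using assms by simp_all
  show ?thesis
    by (rule logderiv_limit[OF holomorphic_zeta_reg open_halfspace_Re_gt 1 2 3 4]) (rule that)
qed

lemma mangoldt_term_summable:
  assumes "Re s > 1"
  shows "summable (\<lambda>n. mangoldt n * of_nat n powr (-s) :: complex)"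
proof (rule summable_norm_cancel)
  show "summable (\<lambda>n. norm (mangoldt n * of_nat n powr (-s) :: complex))"
    unfolding norm_mangoldt_term by (rule mangoldt_summable[OF assms])
qed

text \<open>The limit is the residue of -zeta'/zeta at z: 1 from the pole at 1, minus the order k of
  the zero of \<open>zeta_reg\<close>. It is approached along the horizontal ray to the right of z,
  where the series converges.\<close>

lemma mangoldt_series_limit:
  assumes "Re z \<ge> 1"
  obtains k :: nat where "((\<lambda>x. of_real x * mangoldt_series (z + of_real x)) \<longlongrightarrow> (if z = 1 then 1 else 0) - of_nat k) (at_right 0)"
    "k = 0 \<longleftrightarrow> zeta_reg z \<noteq> 0"
proof -
  obtain k :: nat where k: "((\<lambda>x. (x - z) * deriv zeta_reg x / zeta_reg x) \<longlongrightarrow> of_nat k) (at z)"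
    "k = 0 \<longleftrightarrow> zeta_reg z \<noteq> 0" "eventually (\<lambda>x. zeta_reg x \<noteq> 0) (at z)"
    using assms by - (rule zeta_reg_logderiv_limit[of z], simp, blast)
  have path: "filterlim (\<lambda>x::real. z + of_real x) (at z) (at_right 0)"
  proof (rule filterlim_atI)
    have "((\<lambda>x::real. z + of_real x) \<longlongrightarrow> z + of_real 0) (at_right 0)" by (intro tendsto_intros)
    then show "((\<lambda>x::real. z + of_real x) \<longlongrightarrow> z) (at_right 0)" by simp
    show "\<forall>\<^sub>F x in at_right (0::real). z + of_real x \<noteq> z"
      using eventually_at_right_less[of "0::real"] by eventually_elim auto
  qed
  have l1: "((\<lambda>x::real. (z + of_real x - z) * deriv zeta_reg (z + of_real x) / zeta_reg (z + of_real x)) \<longlongrightarrow> of_nat k) (at_right 0)"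
    by (rule filterlim_compose[OF k(1) path])
  have l2: "((\<lambda>x::real. of_real x / (z + of_real x - 1)) \<longlongrightarrow> (if z = 1 then 1 else 0)) (at_right 0)"
  proof (cases "z = 1")
    case True
    have "((\<lambda>x::real. 1::complex) \<longlongrightarrow> 1) (at_right 0)" by simp
    moreover have "eventually (\<lambda>x::real. 1 = of_real x / (z + of_real x - 1)) (at_right 0)"
      using eventually_at_right_less[of "0::real"] by eventually_elim (simp add: True)
    ultimately show ?thesis using True by (auto intro: Lim_transform_eventually)
  next
    case False
    have "((\<lambda>x::real. of_real x / (z + of_real x - 1)) \<longlongrightarrow> of_real 0 / (z + of_real 0 - 1)) (at_right 0)"
      using False by (intro tendsto_intros) auto
    then show ?thesis using False by simp
  qed
  have "((\<lambda>x::real. of_real x / (z + of_real x - 1) - (z + of_real x - z) * deriv zeta_reg (z + of_real x) / zeta_reg (z + of_real x)) \<longlongrightarrow>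
      (if z = 1 then 1 else 0) - of_nat k) (at_right 0)"
    by (intro tendsto_diff l1 l2)
  moreover have "\<forall>\<^sub>F x in at_right 0. of_real x / (z + of_real x - 1) - (z + of_real x - z) * deriv zeta_reg (z + of_real x) / zeta_reg (z + of_real x)
      = of_real x * mangoldt_series (z + of_real x)"
    using eventually_at_right_less[of "0::real"] filterlim_iff[THEN iffD1, OF path, rule_format, OF k(3)]
  proof eventually_elim
    case (elim x)
    have "mangoldt_series (z + of_real x) = 1 / (z + of_real x - 1) - deriv zeta_reg (z + of_real x) / zeta_reg (z + of_real x)"
      using mangoldt_series_eq[of "z + of_real x"] elim assms by (simp add: field_simps)
    then show ?case by (simp add: right_diff_distrib)
  qed
  ultimately have "((\<lambda>x. of_real x * mangoldt_series (z + of_real x)) \<longlongrightarrow> (if z = 1 then 1 else 0) - of_nat k) (at_right 0)"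
    by (rule Lim_transform_eventually)
  then show ?thesis using that k(2) by blast
qed

text \<open>The series for -zeta'/zeta converges absolutely at z itself, so it stays bounded along
  the ray and the residue -k must be 0.\<close>

lemma zeta_reg_nonzero_gt_1:
  assumes "Re z > 1"
  shows "zeta_reg z \<noteq> 0"
proof
  assume z0: "zeta_reg z = 0"
  obtain k :: nat where k: "((\<lambda>x. of_real x * mangoldt_series (z + of_real x)) \<longlongrightarrow> (if z = 1 then 1 else 0) - of_nat k) (at_right 0)"
    "k = 0 \<longleftrightarrow> zeta_reg z \<noteq> 0"
    using assms by - (rule mangoldt_series_limit[of z], simp, blast)
  define B where "B = (\<Sum>n. mangoldt n * real n powr (- Re z))"
  have bound: "norm (mangoldt_series (z + of_real x)) \<le> B" if "x > 0" for x :: real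
    unfolding mangoldt_series_def B_def
  proof (rule norm_suminf_le[OF _ mangoldt_summable[OF assms]])
    fix n
    show "norm (mangoldt n * of_nat n powr - (z + of_real x) :: complex) \<le> mangoldt n * real n powr (- Re z)"
      unfolding norm_mangoldt_term
      by (cases "n = 0") (use that in \<open>auto intro!: mult_left_mono powr_mono simp: mangoldt_nonneg\<close>)
  qed
  have "((\<lambda>x. of_real x * mangoldt_series (z + of_real x)) \<longlongrightarrow> 0) (at_right 0)"
  proof (rule Lim_null_comparison)
    show "\<forall>\<^sub>F x in at_right 0. norm (of_real x * mangoldt_series (z + of_real x)) \<le> x * B"
      using eventually_at_right_less[of "0::real"]
      by eventually_elim (use bound in \<open>auto simp: norm_mult intro!: mult_left_mono\<close>)
    have "((\<lambda>x. x * B) \<longlongrightarrow> 0 * B) (at_right 0)" by (intro tendsto_intros)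
    then show "((\<lambda>x. x * B) \<longlongrightarrow> 0) (at_right 0)" by simp
  qed
  from tendsto_unique[OF _ this k(1)] have "k = 0" using assms by (auto split: if_splits)
  with k(2) z0 show False by simp
qed

(* Mertens: 3 + 4 cos t + cos 2t = 2 (1 + cos t)^2 >= 0. *)
lemma zeta_reg_nonzero_eq_1:
  assumes "Re z = 1"
  shows "zeta_reg z \<noteq> 0"
proof
  assume z0: "zeta_reg z = 0"
  define b where "b = Im z"
  have z: "z = Complex 1 b" using assms by (simp add: b_def complex_eq_iff)
  have "z \<noteq> 1" using z0 by auto
  then have b: "b \<noteq> 0" by (simp add: z complex_eq_iff)
  define z2 where "z2 = Complex 1 (2 * b)"
  have "z2 \<noteq> 1" using b by (simp add: z2_def complex_eq_iff)
  obtain k1 :: nat where k1: "((\<lambda>x. of_real x * mangoldt_series (1 + of_real x)) \<longlongrightarrow> 1 - of_nat k1) (at_right 0)" "k1 = 0"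
    by (rule mangoldt_series_limit[of 1]) auto
  obtain k :: nat where k: "((\<lambda>x. of_real x * mangoldt_series (z + of_real x)) \<longlongrightarrow> 0 - of_nat k) (at_right 0)" "k > 0"
    by (rule mangoldt_series_limit[of z]) (use \<open>z \<noteq> 1\<close> assms z0 in auto)
  obtain k2 :: nat where k2: "((\<lambda>x. of_real x * mangoldt_series (z2 + of_real x)) \<longlongrightarrow> 0 - of_nat k2) (at_right 0)"
    by (rule mangoldt_series_limit[of z2]) (use \<open>z2 \<noteq> 1\<close> in \<open>auto simp: z2_def\<close>)
  \<comment> \<open>Since k1 = 0, the limit is 3 - 4 k - k2, which is negative because k \<ge> 1;
    positivity of the trigonometric polynomial will contradict this.\<close>
  have "((\<lambda>x. Re (3 * (of_real x * mangoldt_series (1 + of_real x)) + 4 * (of_real x * mangoldt_series (z + of_real x))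
       + of_real x * mangoldt_series (z2 + of_real x))) \<longlongrightarrow> Re (3 * (1 - of_nat k1) + 4 * (0 - of_nat k) + (0 - of_nat k2))) (at_right 0)"
    by (intro tendsto_intros k1 k k2)
  moreover have "\<forall>\<^sub>F x in at_right 0. Re (3 * (of_real x * mangoldt_series (1 + of_real x)) + 4 * (of_real x * mangoldt_series (z + of_real x))
       + of_real x * mangoldt_series (z2 + of_real x)) \<ge> 0"
    using eventually_at_right_less[of "0::real"]
  proof eventually_elim
    case (elim x)
    define t where "t w n = (mangoldt n * of_nat n powr - (w + of_real x) :: complex)" for w n
    have sm: "summable (t 1)" "summable (t z)" "summable (t z2)"
      using elim unfolding t_def by - (rule mangoldt_term_summable; simp add: z z2_def)+
    have ser: "mangoldt_series (w + of_real x) = suminf (t w)" for w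
      by (simp add: mangoldt_series_def t_def[abs_def])
    have sums: "(\<lambda>n. 3 * t 1 n + 4 * t z n + t z2 n) sums (3 * suminf (t 1) + 4 * suminf (t z) + suminf (t z2))"
      by (intro sums_add sums_mult summable_sums sm)
    have "Re (3 * suminf (t 1) + 4 * suminf (t z) + suminf (t z2)) \<ge> 0"
    proof (rule sums_le[OF _ sums_zero sums_Re[OF sums]])
      fix n :: nat
      show "0 \<le> Re (3 * t 1 n + 4 * t z n + t z2 n)"
      proof (cases "n = 0")
        case False
        define \<theta> where "\<theta> = b * ln (real n)"
        have arg: "- (Complex 1 c + of_real x) * of_real l = Complex ((- 1 - x) * l) (- c * l)" for c l
          by (simp add: complex_eq_iff algebra_simps)
        have pw: "of_nat n powr - (Complex 1 c + of_real x) = of_real (real n powr (- 1 - x)) * cis (- c * ln (real n))" for c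
        proof -
          have "Ln (of_nat n :: complex) = of_real (ln (real n))" using False by (intro Ln_of_nat_pos) simp
          then have "of_nat n powr - (Complex 1 c + of_real x) = exp (Complex ((- 1 - x) * ln (real n)) (- c * ln (real n)))"
            using False arg[of c "ln (real n)"] by (simp only: powr_def of_nat_eq_0_iff if_False)
          also have "\<dots> = of_real (real n powr (- 1 - x)) * cis (- c * ln (real n))"
            using False by (simp add: exp_eq_polar powr_def)
          finally show ?thesis .
        qed
        have 1: "(1::complex) = Complex 1 0" by (simp add: complex_eq_iff)
        have "Re (3 * t 1 n + 4 * t z n + t z2 n) = mangoldt n * real n powr (- 1 - x) * (3 + 4 * cos \<theta> + cos (2 * \<theta>))"
          unfolding t_def 1 z z2_def pw by (simp add: \<theta>_def algebra_simps)
        also have "3 + 4 * cos \<theta> + cos (2 * \<theta>) = 2 * (1 + cos \<theta>)\<^sup>2"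
          unfolding cos_double_cos power2_eq_square by (simp add: algebra_simps)
        also have "mangoldt n * real n powr (- 1 - x) * (2 * (1 + cos \<theta>)\<^sup>2) \<ge> 0"
          by (intro mult_nonneg_nonneg mangoldt_nonneg) auto
        finally show ?thesis .
      qed (simp add: t_def)
    qed
    then have "x * Re (3 * mangoldt_series (1 + of_real x) + 4 * mangoldt_series (z + of_real x) + mangoldt_series (z2 + of_real x)) \<ge> 0"
      using elim by (simp add: ser)
    then show ?case by (simp add: algebra_simps)
  qed
  ultimately have "Re (3 * (1 - of_nat k1) + 4 * (0 - of_nat k) + (0 - of_nat k2)) \<ge> 0"
    by (rule tendsto_lowerbound) simp
  then show False using k1(2) k(2) by simp
qed

theorem RH_zeta_reg_nonzero:
  assumes "riemann_hypothesis" "Re s > 1/2"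
  shows "zeta_reg s \<noteq> 0"
proof (cases "Re s" "1 :: real" rule: linorder_cases)
  case less then show ?thesis using RH_zeta_reg_strip assms by blast
next
  case equal then show ?thesis by (rule zeta_reg_nonzero_eq_1)
next
  case greater then show ?thesis by (rule zeta_reg_nonzero_gt_1)
qed

section \<open>Bounds for zeta under the Riemann hypothesis\<close>

(* At the pole, zeta 1 = 0 by the convention x / 0 = 0, whereas inv_zeta 1 = 0 is the true value. *)
definition zeta :: "complex \<Rightarrow> complex" where
  "zeta s = zeta_reg s / (s - 1)"

definition inv_zeta :: "complex \<Rightarrow> complex" where
  "inv_zeta s = (s - 1) / zeta_reg s"

text \<open>The bound is 1/4 for the first term plus 1/2 for the rest, which is compared with the
  telescoping sum of 1/(k - 1) - 1/k. That it is below 1 keeps zeta away from 0 and makes the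
  geometric series in zeta - 1 converge; partial sums are treated because they enter that series
  too.\<close>

lemma zeta_partial_tail_bound:
  assumes "Re s \<ge> 2"
  shows "norm (\<Sum>n<N. of_nat (n + 2) powr (-s) :: complex) \<le> 3/4"
proof -
  have partial: "(\<Sum>n<N. 1 / (real (n + 2))\<^sup>2) \<le> 3/4 - (if N = 0 then 0 else 1 / real (N + 1))" for N
  proof (induction N)
    case (Suc N)
    have "1 / (real (N + 2))\<^sup>2 \<le> 1 / (real (N + 1) * real (N + 2))"
      unfolding power2_eq_square by (intro frac_le mult_right_mono) auto
    also have "\<dots> = 1 / real (N + 1) - 1 / real (N + 2)"
      by (simp add: field_simps)
    finally have "1 / (real (N + 2))\<^sup>2 \<le> 1 / real (N + 1) - 1 / real (N + 2)" .
    then show ?case using Suc by (cases "N = 0") (auto simp: add_ac)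
  qed simp
  have "norm (\<Sum>n<N. of_nat (n + 2) powr (-s) :: complex) \<le> (\<Sum>n<N. 1 / (real (n + 2))\<^sup>2)"
  proof (rule sum_norm_le)
    fix n
    have "norm (of_nat (n + 2) powr (-s) :: complex) \<le> real (n + 2) powr (-2)"
      unfolding norm_nat_powr using assms by (auto intro!: powr_mono)
    then show "norm (of_nat (n + 2) powr (-s) :: complex) \<le> 1 / (real (n + 2))\<^sup>2"
      by (simp add: powr_minus divide_inverse)
  qed
  also have "\<dots> \<le> 3/4" by (rule order_trans[OF partial]) simp
  finally show ?thesis .
qed

lemma zeta_minus_1_sums:
  assumes "Re s > 1"
  shows "(\<lambda>n. of_nat (n + 2) powr (-s)) sums (zeta s - 1)"
proof -
  have "(\<lambda>n. of_nat (Suc n) powr (-s)) sums zeta s"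
    unfolding zeta_def using assms by (intro zeta_series_sums) auto
  then have "(\<lambda>n. of_nat (Suc (Suc n)) powr (-s)) sums (zeta s - 1)"
    by (subst sums_Suc_iff) simp
  then show ?thesis by (simp add: add_ac)
qed

lemma zeta_tail_bound:
  assumes "Re s \<ge> 2"
  shows "norm (zeta s - 1) \<le> 3/4"
proof (rule LIMSEQ_le_const2)
  show "(\<lambda>N. norm (\<Sum>n<N. of_nat (n + 2) powr (-s))) \<longlonglongrightarrow> norm (zeta s - 1)"
    using zeta_minus_1_sums[of s] assms unfolding sums_def by (intro tendsto_norm) auto
qed (use zeta_partial_tail_bound[OF assms] in blast)

lemma zeta_bounds_ge_2:
  assumes "Re s \<ge> 2"
  shows "1/4 \<le> norm (zeta s)" "norm (zeta s) \<le> 7/4"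
  using zeta_tail_bound[OF assms] norm_triangle_ineq3[of "zeta s" 1] by auto

lemma norm_inv_zeta: "norm (inv_zeta s) = 1 / norm (zeta s)"
  by (simp add: inv_zeta_def zeta_def norm_divide)

lemma norm_inv_zeta_ge_2:
  assumes "Re s \<ge> 2"
  shows "norm (inv_zeta s) \<le> 4"
proof -
  have "1 / norm (zeta s) \<le> 1 / (1/4)" using zeta_bounds_ge_2[OF assms] by (intro frac_le) auto
  then show ?thesis by (simp add: norm_inv_zeta)
qed

lemma holomorphic_zeta:
  assumes "S \<subseteq> {s. Re s > 0} - {1}"
  shows "zeta holomorphic_on S"
  unfolding zeta_def using assms
  by (intro holomorphic_intros holomorphic_on_subset[OF holomorphic_zeta_reg]) auto

lemma holomorphic_inv_zeta:
  assumes "riemann_hypothesis" "S \<subseteq> {s. Re s > 1/2}"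
  shows "inv_zeta holomorphic_on S"
  unfolding inv_zeta_def using assms(2) RH_zeta_reg_nonzero[OF assms(1)]
  by (intro holomorphic_intros holomorphic_on_subset[OF holomorphic_zeta_reg]) fastforce+

(* Littlewood: Borel-Caratheodory bounds log zeta by O(log |t|), and expansion about 4 + it, near which log zeta is
   bounded, lowers this to an arbitrarily small multiple of log |t|. *)
lemma zeta_subpower_high:
  assumes RH: "riemann_hypothesis" and \<delta>: "0 < \<delta>" "\<delta> < 1" and \<kappa>: "0 < \<kappa>"
  obtains C where "C > 0"
    "\<And>s. 1/2 + \<delta> \<le> Re s \<Longrightarrow> \<bar>Im s\<bar> \<ge> 4 \<Longrightarrow>
       norm (zeta s) \<le> C * (\<bar>Im s\<bar> + 4) powr \<kappa> \<and> norm (inv_zeta s) \<le> C * (\<bar>Im s\<bar> + 4) powr \<kappa>"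
proof -
  obtain K where K: "K \<ge> 1" "\<And>s. Re s \<ge> 1/2 \<Longrightarrow> norm (zeta_reg s) \<le> K * (1 + norm s)\<^sup>2"
    using zeta_reg_bound[of "1/2"] by auto
  \<comment> \<open>Borel-Caratheodory will give |h| \<le> 14 M / \<delta> with M equal to 2 ln
    \<tau> plus a constant; \<open>\<kappa>'\<close> is chosen so that \<open>\<kappa>'\<close>
    times this is \<kappa> ln \<tau> plus a constant.\<close>
  define \<kappa>' where "\<kappa>' = \<kappa> * \<delta> / 28"
  have \<kappa>': "\<kappa>' > 0" using \<delta> \<kappa> by (simp add: \<kappa>'_def)
  obtain C0 where C0: "C0 \<ge> 0" "\<And>h c z m M. h holomorphic_on ball c (7/2) \<Longrightarrow> (\<And>w. w \<in> cball c (7/2 - \<delta>/2) \<Longrightarrow> norm (h w) \<le> M) \<Longrightarrow>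
       (\<And>w. w \<in> cball c 1 \<Longrightarrow> norm (h w) \<le> m) \<Longrightarrow> z \<in> cball c (7/2 - \<delta>) \<Longrightarrow>
       norm (h z :: complex) \<le> C0 * m + \<kappa>' * M"
    using taylor_two_radii_bound[of 1 "7/2 - \<delta>" "7/2 - \<delta>/2" "7/2" \<kappa>'] \<delta> \<kappa>' by auto
  define B where "B = C0 * 6 + \<kappa> * ln (80 * K) / 2"
  have B0: "B \<ge> 0" using C0 \<kappa> K by (auto simp: B_def)
  show ?thesis
  proof (rule that[of "4 * exp B"])
    fix s assume s: "1/2 + \<delta> \<le> Re s" "\<bar>Im s\<bar> \<ge> 4"
    define T where "T = Im s"
    define \<tau> where "\<tau> = \<bar>T\<bar> + 4"
    have \<tau>: "\<tau> \<ge> 8" using s by (simp add: \<tau>_def T_def)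
    show "norm (zeta s) \<le> 4 * exp B * (\<bar>Im s\<bar> + 4) powr \<kappa> \<and> norm (inv_zeta s) \<le> 4 * exp B * (\<bar>Im s\<bar> + 4) powr \<kappa>"
    proof (cases "Re s \<le> 4")
      case False
      have "exp B * \<tau> powr \<kappa> \<ge> 1 * 1"
        using B0 \<tau> \<kappa> by (intro mult_mono) (auto intro: ge_one_powr_ge_zero)
      then have big: "4 * exp B * \<tau> powr \<kappa> \<ge> 4" by simp
      have z: "1/4 \<le> norm (zeta s)" "norm (zeta s) \<le> 7/4" using zeta_bounds_ge_2[of s] False by auto
      have "norm (inv_zeta s) \<le> 4" using norm_inv_zeta_ge_2[of s] False by simp
      with big z show ?thesis by (simp add: \<tau>_def T_def)
    next
      case True
      \<comment> \<open>The disc of radius 7/2 about 4 + iT just touches the critical line, and |T|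
        \<ge> 4 keeps the pole at distance at least 1/2.\<close>
      define c where "c = Complex 4 T"
      have geo: "Re z > 1/2" "z \<noteq> 1" "norm z \<le> 2 * \<tau>" "norm (z - 1) \<ge> 1/2" if "z \<in> ball c (7/2)" for z
      proof -
        have d: "norm (z - c) < 7/2" using that by (simp add: dist_norm norm_minus_commute)
        have *: "\<bar>Re z - 4\<bar> < 7/2" "\<bar>Im z - T\<bar> < 7/2" "\<bar>T\<bar> \<ge> 4"
          using abs_Re_le_cmod[of "z - c"] abs_Im_le_cmod[of "z - c"] d s by (auto simp: c_def T_def)
        have "Re z > 1/2" using *(1) by arith
        moreover have "\<bar>Im z\<bar> \<ge> 1/2" using *(2,3) by arith
        ultimately show "Re z > 1/2" "z \<noteq> 1" "norm (z - 1) \<ge> 1/2"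
          using abs_Im_le_cmod[of "z - 1"] by auto
        have "norm c \<le> 4 + \<bar>T\<bar>" using cmod_le[of c] by (simp add: c_def)
        then show "norm z \<le> 2 * \<tau>" using norm_triangle_sub[of z c] d s by (simp add: \<tau>_def T_def)
      qed
      have hol: "zeta holomorphic_on ball c (7/2)"
        using geo by (intro holomorphic_zeta) fastforce
      have nz: "zeta z \<noteq> 0" if "z \<in> ball c (7/2)" for z
        using RH_zeta_reg_nonzero[OF RH geo(1)[OF that]] geo(2)[OF that] by (simp add: zeta_def)
      obtain h where h: "h holomorphic_on ball c (7/2)" "h c = 0" "\<And>z. z \<in> ball c (7/2) \<Longrightarrow> zeta z = zeta c * exp (h z)"
        using holomorphic_log_normalised[OF hol nz] by auto
      have zc: "1/4 \<le> norm (zeta c)" "norm (zeta c) \<le> 7/4" using zeta_bounds_ge_2[of c] by (auto simp: c_def)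
      have Re_h: "Re (h z) < M" if "z \<in> ball c (7/2)" "norm (zeta z) < exp M * (1/4)" for z M
      proof -
        have "(1/4) * exp (Re (h z)) \<le> norm (zeta c) * exp (Re (h z))" using zc by (intro mult_right_mono) auto
        also have "\<dots> < exp M * (1/4)" using that(2) h(3)[OF that(1)] by (simp add: norm_mult)
        finally show ?thesis by simp
      qed
      \<comment> \<open>On the disc |zeta z| \<le> 2 K (3 \<tau>)^2 = 18 K \<tau>^2, which is below
        80 K \<tau>^2 / 4; the 1/4 is the lower bound for |zeta c|.\<close>
      define M where "M = ln (80 * K) + 2 * ln \<tau>"
      have expM: "exp M = 80 * K * \<tau>\<^sup>2"
        using K \<tau> by (simp add: M_def exp_add exp_double[symmetric] flip: exp_of_nat_mult) (simp add: exp_double)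
      have M0: "M \<ge> 0" using K \<tau> by (simp add: M_def)
      have hM: "norm (h w) \<le> 14 * M / \<delta>" if w: "w \<in> cball c (7/2 - \<delta>/2)" for w
      proof -
        have "norm (h w) \<le> 2 * M * dist c w / (7/2 - dist c w)"
        proof (rule borel_caratheodory[OF h(1,2)])
          fix z assume z: "z \<in> ball c (7/2)"
          have "norm (zeta z) = norm (zeta_reg z) / norm (z - 1)" by (simp add: zeta_def norm_divide)
          also have "\<dots> \<le> (K * (1 + norm z)\<^sup>2) / (1/2)"
            using geo[OF z] K by (intro frac_le) auto
          also have "\<dots> \<le> (K * (3 * \<tau>)\<^sup>2) / (1/2)"
            using geo[OF z] K \<tau> by (intro divide_right_mono mult_left_mono power_mono) auto
          also have "\<dots> < exp M * (1/4)"
            using K \<tau> by (simp add: expM power2_eq_square)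
          finally show "Re (h z) < M" by (rule Re_h[OF z])
        qed (use w \<delta> in auto)
        also have "\<dots> \<le> 2 * M * (7/2) / (\<delta>/2)"
          using w \<delta> M0 by (intro frac_le mult_left_mono mult_nonneg_nonneg) auto
        finally show ?thesis by simp
      qed
      \<comment> \<open>The disc of radius 2 lies in Re z > 2, where zeta is between absolute
        constants; on half that radius one gets 2 * 3 * 1 / (2 - 1) = 6.\<close>
      have hm: "norm (h w) \<le> 6" if w: "w \<in> cball c 1" for w
      proof -
        have "norm (h w) \<le> 2 * 3 * dist c w / (2 - dist c w)"
        proof (rule borel_caratheodory[OF holomorphic_on_subset[OF h(1)] h(2)])
          fix z assume z: "z \<in> ball c 2"
          have "\<bar>Re z - 4\<bar> < 2"
            using abs_Re_le_cmod[of "z - c"] z by (auto simp: c_def dist_norm norm_minus_commute)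
          then have "norm (zeta z) \<le> 7/4" using zeta_bounds_ge_2[of z] by auto
          also have "7/4 < exp 3 * (1/4 :: real)"
          proof -
            have "(2::real) ^ 3 \<le> exp 1 ^ 3" using exp_ge_add_one_self[of 1] by (intro power_mono) auto
            also have "\<dots> = exp 3" by (simp flip: exp_of_nat_mult)
            finally show ?thesis by simp
          qed
          finally show "Re (h z) < 3" using z by (intro Re_h) auto
        qed (use w in auto)
        also have "\<dots> \<le> 2 * 3 * 1 / 1" using w by (intro frac_le mult_left_mono) auto
        finally show ?thesis by simp
      qed
      have s_in: "s \<in> cball c (7/2 - \<delta>)" "s \<in> ball c (7/2)"
      proof -
        have "dist c s = \<bar>4 - Re s\<bar>" by (simp add: c_def dist_norm cmod_def T_def)
        then show "s \<in> cball c (7/2 - \<delta>)" "s \<in> ball c (7/2)" using s True \<delta> by auto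
      qed
      have "norm (h s) \<le> C0 * 6 + \<kappa>' * (14 * M / \<delta>)"
        by (rule C0(2)[OF h(1) hM hm s_in(1)])
      also have "\<dots> = B + \<kappa> * ln \<tau>"
        using \<delta> by (simp add: \<kappa>'_def B_def M_def field_simps)
      finally have hs: "norm (h s) \<le> B + \<kappa> * ln \<tau>" .
      have pw: "exp (B + \<kappa> * ln \<tau>) = exp B * \<tau> powr \<kappa>" using \<tau> by (simp add: exp_add powr_def)
      have zs: "norm (zeta s) = norm (zeta c) * exp (Re (h s))"
        using h(3)[OF s_in(2)] by (simp add: norm_mult)
      have "exp (Re (h s)) \<le> exp (B + \<kappa> * ln \<tau>)" using hs complex_Re_le_cmod[of "h s"] by simp
      then have 1: "norm (zeta s) \<le> 7/4 * (exp B * \<tau> powr \<kappa>)"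
        unfolding zs pw[symmetric] using zc by (intro mult_mono) auto
      have "- (B + \<kappa> * ln \<tau>) \<le> Re (h s)" using hs abs_Re_le_cmod[of "h s"] by linarith
      then have "exp (- (B + \<kappa> * ln \<tau>)) \<le> exp (Re (h s))" by simp
      then have "(1/4) * exp (- (B + \<kappa> * ln \<tau>)) \<le> norm (zeta s)"
        unfolding zs using zc by (intro mult_mono) auto
      then have "norm (inv_zeta s) \<le> 1 / ((1/4) * exp (- (B + \<kappa> * ln \<tau>)))"
        unfolding norm_inv_zeta by (intro frac_le) auto
      also have "\<dots> = 4 * (exp B * \<tau> powr \<kappa>)" unfolding exp_minus pw by (simp add: field_simps)
      finally have "norm (inv_zeta s) \<le> 4 * (exp B * \<tau> powr \<kappa>)" .
      moreover have "7/4 * (exp B * \<tau> powr \<kappa>) \<le> 4 * (exp B * \<tau> powr \<kappa>)" by (intro mult_right_mono) auto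
      ultimately have "norm (zeta s) \<le> 4 * (exp B * \<tau> powr \<kappa>)" "norm (inv_zeta s) \<le> 4 * (exp B * \<tau> powr \<kappa>)"
        using 1 by linarith+
      then show ?thesis by (simp add: \<tau>_def T_def mult.assoc)
    qed
  qed auto
qed

text \<open>What the case |Im s| \<ge> 4 leaves is either in Re s \<ge> 2, where |1/zeta| \<le> 4,
  or in a compact box. The box contains the pole of zeta, at which \<open>inv_zeta\<close> is
  holomorphic.\<close>

theorem inv_zeta_subpower:
  assumes RH: "riemann_hypothesis" and \<delta>: "0 < \<delta>" "\<delta> < 1" and \<kappa>: "0 < \<kappa>"
  obtains C where "C > 0" "\<And>s. 1/2 + \<delta> \<le> Re s \<Longrightarrow> norm (inv_zeta s) \<le> C * (\<bar>Im s\<bar> + 4) powr \<kappa>"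
proof -
  obtain C1 where C1: "C1 > 0" "\<And>s. 1/2 + \<delta> \<le> Re s \<Longrightarrow> \<bar>Im s\<bar> \<ge> 4 \<Longrightarrow> norm (inv_zeta s) \<le> C1 * (\<bar>Im s\<bar> + 4) powr \<kappa>"
    using zeta_subpower_high[OF RH \<delta> \<kappa>] by metis
  define Q where "Q = cbox (Complex (1/2 + \<delta>) (-4)) (Complex 2 4)"
  have mem: "s \<in> Q \<longleftrightarrow> 1/2 + \<delta> \<le> Re s \<and> Re s \<le> 2 \<and> \<bar>Im s\<bar> \<le> 4" for s
    by (auto simp: Q_def in_cbox_complex_iff)
  have "continuous_on Q inv_zeta"
    by (intro holomorphic_on_imp_continuous_on holomorphic_inv_zeta[OF RH]) (use \<delta> in \<open>auto simp: mem\<close>)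
  then have "bounded (inv_zeta ` Q)"
    by (intro compact_imp_bounded compact_continuous_image) (auto simp: Q_def)
  then obtain C2 where C2: "\<And>s. s \<in> Q \<Longrightarrow> norm (inv_zeta s) \<le> C2"
    by (auto simp: bounded_iff)
  define C where "C = C1 + \<bar>C2\<bar> + 4"
  show ?thesis
  proof (rule that[of C])
    show "C > 0" using C1 by (simp add: C_def)
    fix s assume s: "1/2 + \<delta> \<le> Re s"
    have p1: "(\<bar>Im s\<bar> + 4) powr \<kappa> \<ge> 1" using \<kappa> by (intro ge_one_powr_ge_zero) auto
    consider "\<bar>Im s\<bar> \<ge> 4" | "\<bar>Im s\<bar> \<le> 4" "Re s \<le> 2" | "Re s \<ge> 2" by linarith
    then show "norm (inv_zeta s) \<le> C * (\<bar>Im s\<bar> + 4) powr \<kappa>"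
    proof cases
      case 1
      have "C1 * (\<bar>Im s\<bar> + 4) powr \<kappa> \<le> C * (\<bar>Im s\<bar> + 4) powr \<kappa>"
        by (intro mult_right_mono) (auto simp: C_def)
      then show ?thesis using C1(2)[OF s 1] by linarith
    next
      case 2
      have "norm (inv_zeta s) \<le> C * 1" using C2[of s] 2 s C1 by (auto simp: mem C_def)
      also have "\<dots> \<le> C * (\<bar>Im s\<bar> + 4) powr \<kappa>" using p1 C1 by (intro mult_left_mono) (auto simp: C_def)
      finally show ?thesis .
    next
      case 3
      have "norm (inv_zeta s) \<le> 4" by (rule norm_inv_zeta_ge_2[OF 3])
      also have "\<dots> \<le> C * 1" using C1 by (simp add: C_def)
      also have "\<dots> \<le> C * (\<bar>Im s\<bar> + 4) powr \<kappa>" using p1 C1 by (intro mult_left_mono) (auto simp: C_def)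
      finally show ?thesis .
    qed
  qed
qed

(* Under RH every zero is at least as far from 1/2 + e + it as from 1/2 + it. *)
lemma zeta_reg_shift_ratio:
  assumes RH: "riemann_hypothesis"
  obtains A where "A > 0" "\<And>\<epsilon> t. 0 \<le> \<epsilon> \<Longrightarrow> \<epsilon> \<le> 1/20 \<Longrightarrow>
    norm (zeta_reg (Complex (1/2) t)) \<le> (\<bar>t\<bar> + 4) powr (A * \<epsilon>) * norm (zeta_reg (Complex (1/2 + \<epsilon>) t))"
proof -
  obtain K where K: "K \<ge> 1" "\<And>s. Re s \<ge> 1/10 \<Longrightarrow> norm (zeta_reg s) \<le> K * (1 + norm s)\<^sup>2"
    using zeta_reg_bound[of "1/10"] by auto
  obtain C where C: "C > 0" "\<And>s. 1/2 + 1/10 \<le> Re s \<Longrightarrow> norm (inv_zeta s) \<le> C * (\<bar>Im s\<bar> + 4) powr 1"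
    using inv_zeta_subpower[OF RH, of "1/10" 1] by auto
  \<comment> \<open>On the disc |zeta_reg| \<le> K \<tau>^2, while at its centre |zeta_reg| \<ge>
    (2/5) / (C \<tau>), so the ratio is at most (5/2) K C \<tau>^3. Adding 1 makes the logarithm of
    \<open>K'\<close> non-negative.\<close>
  define K' where "K' = 5/2 * K * C + 1"
  have K': "K' \<ge> 1" using K C by (simp add: K'_def)
  \<comment> \<open>Chosen so that n + 1 \<le> log 2 (K' \<tau>^3) + 2 \<le> A' ln \<tau>, by ln
    \<tau> \<ge> 1. The factor 240 below is 120 / R with R = 1/2.\<close>
  define A' where "A' = log 2 K' + 3 / ln 2 + 2"
  have A'0: "A' > 0" using K' by (simp add: A'_def add_nonneg_pos)
  show ?thesis
  proof (rule that[of "240 * A'"])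
    show "240 * A' > 0" using A'0 by simp
    fix \<epsilon> t :: real assume \<epsilon>: "0 \<le> \<epsilon>" "\<epsilon> \<le> 1/20"
    define \<tau> where "\<tau> = \<bar>t\<bar> + 4"
    have \<tau>: "\<tau> \<ge> 4" by (simp add: \<tau>_def)
    have ln\<tau>: "ln \<tau> \<ge> 1"
    proof -
      have "exp 1 \<le> \<tau>" using exp_le \<tau> by linarith
      then show ?thesis using ln_ge_iff \<tau> by auto
    qed
    \<comment> \<open>The disc of radius 1/2 about c stays in Re z \<ge> 1/10, and both s and s' are
      within 1/10, a fifth of the radius. The centre lies strictly to the right of the critical
      line, where 1/zeta is already bounded.\<close>
    define c where "c = Complex (3/5) t"
    define s where "s = Complex (1/2) t"
    define s' where "s' = Complex (1/2 + \<epsilon>) t"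
    define n where "n = nat \<lceil>log 2 (K' * \<tau> ^ 3)\<rceil>"
    have pos: "K' * \<tau> ^ 3 \<ge> 1" using K' \<tau> mult_mono[of 1 K' 1 "\<tau> ^ 3"] by (auto intro: one_le_power)
    have n1: "K' * \<tau> ^ 3 \<le> 2 ^ n"
    proof -
      have "log 2 (K' * \<tau> ^ 3) \<le> real n" using pos by (simp add: n_def real_nat_ceiling_ge)
      then show ?thesis using pos by (simp add: log_le_iff powr_realpow)
    qed
    have n2: "real (n + 1) \<le> A' * ln \<tau>"
    proof -
      have "log 2 (K' * \<tau> ^ 3) \<ge> 0" using pos by simp
      then have "real n \<le> log 2 (K' * \<tau> ^ 3) + 1"
        unfolding n_def by linarith
      also have "log 2 (K' * \<tau> ^ 3) = log 2 K' + 3 / ln 2 * ln \<tau>"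
        using K' \<tau> by (simp add: log_def ln_mult ln_realpow add_divide_distrib)
      finally have "real (n + 1) \<le> (log 2 K' + 2) + 3 / ln 2 * ln \<tau>" by simp
      also have "\<dots> \<le> (log 2 K' + 2) * ln \<tau> + 3 / ln 2 * ln \<tau>"
        using ln\<tau> K' mult_left_mono[of 1 "ln \<tau>" "log 2 K' + 2"] by simp
      finally show ?thesis by (simp add: A'_def algebra_simps)
    qed
    have c1: "Re z \<ge> 1/10" "norm (zeta_reg z) \<le> K * \<tau>\<^sup>2" if z: "z \<in> cball c (1/2)" for z
    proof -
      have "\<bar>Re z - 3/5\<bar> \<le> 1/2"
        using abs_Re_le_cmod[of "z - c"] z by (auto simp: c_def dist_norm norm_minus_commute)
      then show re: "Re z \<ge> 1/10" by linarith
      have "norm z \<le> norm c + 1/2" using norm_triangle_sub[of z c] z by (simp add: dist_norm norm_minus_commute)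
      also have "norm c \<le> 3/5 + \<bar>t\<bar>" using cmod_le[of c] by (simp add: c_def)
      finally have "1 + norm z \<le> \<tau>" by (simp add: \<tau>_def)
      then have "(1 + norm z)\<^sup>2 \<le> \<tau>\<^sup>2" by (intro power_mono) auto
      then show "norm (zeta_reg z) \<le> K * \<tau>\<^sup>2"
        using K(2)[OF re] K(1) mult_left_mono[of "(1 + norm z)\<^sup>2" "\<tau>\<^sup>2" K] by linarith
    qed
    have zc: "zeta_reg c \<noteq> 0" by (intro RH_zeta_reg_nonzero[OF RH]) (simp add: c_def)
    have zc2: "2/5 \<le> C * \<tau> * norm (zeta_reg c)"
    proof -
      have "2/5 \<le> norm (c - 1)" using abs_Re_le_cmod[of "c - 1"] by (simp add: c_def)
      also have "\<dots> = norm (inv_zeta c) * norm (zeta_reg c)" using zc by (simp add: inv_zeta_def norm_divide)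
      also have "\<dots> \<le> C * \<tau> * norm (zeta_reg c)"
        using C(2)[of c] by (intro mult_right_mono) (auto simp: c_def \<tau>_def)
      finally show ?thesis .
    qed
    have "norm (zeta_reg s) \<le> norm (zeta_reg s') * exp (120 * real (n + 1) * norm (s - s') / (1/2))"
    proof (rule norm_ratio_le_exp[where S = "{z. Re z > 0}" and c = c and f = zeta_reg])
      show "open {z. Re z > 0}" by (rule open_halfspace_Re_gt)
      show "cball c (1/2) \<subseteq> {z. Re z > 0}" using c1(1) by force
      have "dist c s = 1/10" by (simp add: c_def s_def dist_norm cmod_def)
      then show "s \<in> cball c (1/2/5)" by simp
      have "dist c s' = \<bar>1/10 - \<epsilon>\<bar>" by (simp add: c_def s'_def dist_norm cmod_def)
      then show "s' \<in> cball c (1/2/5)" using \<epsilon> by auto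
      show "zeta_reg holomorphic_on {z. Re z > 0}" by (rule holomorphic_zeta_reg)
      show "zeta_reg c \<noteq> 0" by (rule zc)
      show "norm (zeta_reg z) \<le> 2 ^ n * norm (zeta_reg c)" if "z \<in> cball c (1/2)" for z
      proof -
        have "norm (zeta_reg z) \<le> K * \<tau>\<^sup>2 * (5/2 * (2/5))" using c1(2)[OF that] by simp
        also have "\<dots> \<le> K * \<tau>\<^sup>2 * (5/2 * (C * \<tau> * norm (zeta_reg c)))"
          using zc2 K by (intro mult_left_mono) auto
        also have "\<dots> = (5/2 * K * C) * \<tau> ^ 3 * norm (zeta_reg c)"
          by (simp add: power3_eq_cube power2_eq_square)
        also have "\<dots> \<le> K' * \<tau> ^ 3 * norm (zeta_reg c)"
          using \<tau> by (intro mult_right_mono) (auto simp: K'_def)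
        also have "\<dots> \<le> 2 ^ n * norm (zeta_reg c)" using n1 by (intro mult_right_mono) auto
        finally show ?thesis .
      qed
      show "norm (s - \<rho>) \<le> norm (s' - \<rho>)" if "zeta_reg \<rho> = 0" for \<rho>
      proof -
        have "Re \<rho> \<le> 1/2" using RH_zeta_reg_nonzero[OF RH, of \<rho>] that by force
        then have "(1/2 - Re \<rho>)\<^sup>2 \<le> (1/2 + \<epsilon> - Re \<rho>)\<^sup>2" using \<epsilon> by (intro power_mono) auto
        then show ?thesis unfolding cmod_def by (simp add: s_def s'_def)
      qed
    qed simp
    also have "norm (s - s') = \<epsilon>" using \<epsilon> by (simp add: s_def s'_def cmod_def)
    also have "norm (zeta_reg s') * exp (120 * real (n + 1) * \<epsilon> / (1/2)) \<le> norm (zeta_reg s') * exp (240 * A' * \<epsilon> * ln \<tau>)"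
      using mult_right_mono[OF n2, of "240 * \<epsilon>"] \<epsilon> by (intro mult_left_mono) (auto simp: algebra_simps)
    also have "exp (240 * A' * \<epsilon> * ln \<tau>) = \<tau> powr (240 * A' * \<epsilon>)" using \<tau> by (simp add: powr_def)
    finally show "norm (zeta_reg (Complex (1/2) t)) \<le> (\<bar>t\<bar> + 4) powr (240 * A' * \<epsilon>) * norm (zeta_reg (Complex (1/2 + \<epsilon>) t))"
      by (simp add: s_def s'_def \<tau>_def mult.commute)
  qed
qed

text \<open>The norm is at least |t| and at least 1/2, and 4 = 8 * (1/2).\<close>

lemma norm_critical_minus_1_ge: "\<bar>t\<bar> + 4 \<le> 9 * norm (Complex (1/2) t - 1)"
  using abs_Re_le_cmod[of "Complex (1/2) t - 1"] abs_Im_le_cmod[of "Complex (1/2) t - 1"] by simp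

text \<open>Littlewood's bound holds to the right of the critical line;
  \<open>zeta_reg_shift_ratio\<close> carries it from 1/2 + \<epsilon> to the line itself at the
  cost of a factor (|t| + 4)^(A \<epsilon>).\<close>

theorem RH_imp_lindelof:
  assumes RH: "riemann_hypothesis" and \<kappa>: "0 < \<kappa>"
  obtains C where "C > 0" "\<And>t. norm (zeta (Complex (1/2) t)) \<le> C * (\<bar>t\<bar> + 4) powr \<kappa>"
proof -
  obtain A where A: "A > 0" "\<And>\<epsilon> t. 0 \<le> \<epsilon> \<Longrightarrow> \<epsilon> \<le> 1/20 \<Longrightarrow>
    norm (zeta_reg (Complex (1/2) t)) \<le> (\<bar>t\<bar> + 4) powr (A * \<epsilon>) * norm (zeta_reg (Complex (1/2 + \<epsilon>) t))"
    using zeta_reg_shift_ratio[OF RH] by metis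
  \<comment> \<open>Half of \<kappa> is spent on the shift and half on Littlewood's bound.\<close>
  define \<epsilon> where "\<epsilon> = min (1/20) (\<kappa> / (2 * A))"
  have \<epsilon>: "0 < \<epsilon>" "\<epsilon> \<le> 1/20" "A * \<epsilon> \<le> \<kappa> / 2" using A \<kappa> by (auto simp: \<epsilon>_def min_def field_simps)
  have \<epsilon>1: "\<epsilon> < 1" using \<epsilon>(2) by simp
  obtain C1 where C1: "C1 > 0" "\<And>s. 1/2 + \<epsilon> \<le> Re s \<Longrightarrow> \<bar>Im s\<bar> \<ge> 4 \<Longrightarrow> norm (zeta s) \<le> C1 * (\<bar>Im s\<bar> + 4) powr (\<kappa>/2)"
    using zeta_subpower_high[OF RH \<epsilon>(1) \<epsilon>1 half_gt_zero[OF \<kappa>]] by metis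
  obtain K where K: "K \<ge> 1" "\<And>s. Re s \<ge> 1/2 \<Longrightarrow> norm (zeta_reg s) \<le> K * (1 + norm s)\<^sup>2"
    using zeta_reg_bound[of "1/2"] by auto
  \<comment> \<open>The term 8 K is for |t| < 4, where the quadratic bound for
    \<open>zeta_reg\<close> is used and one of its factors |t| + 4 is below 8.\<close>
  define C where "C = C1 + 8 * K"
  show ?thesis
  proof (rule that[of "9 * C"])
    show "9 * C > 0" using C1 K by (simp add: C_def)
    fix t :: real
    define \<tau> where "\<tau> = \<bar>t\<bar> + 4"
    have \<tau>: "\<tau> \<ge> 4" by (simp add: \<tau>_def)
    have "norm (zeta_reg (Complex (1/2) t)) \<le> C * \<tau> powr \<kappa> * \<tau>"
    proof (cases "\<bar>t\<bar> \<ge> 4")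
      case True
      define s' where "s' = Complex (1/2 + \<epsilon>) t"
      have s'1: "s' \<noteq> 1" using \<epsilon> by (auto simp: s'_def complex_eq_iff)
      have "norm (s' - 1) \<le> \<tau>" using cmod_le[of "s' - 1"] \<epsilon> by (simp add: s'_def \<tau>_def)
      moreover have "norm (zeta s') \<le> C1 * \<tau> powr (\<kappa>/2)" using C1(2)[of s'] True by (simp add: s'_def \<tau>_def)
      moreover have "norm (zeta_reg s') = norm (zeta s') * norm (s' - 1)" using s'1 by (simp add: zeta_def norm_divide)
      ultimately have *: "norm (zeta_reg s') \<le> C1 * \<tau> powr (\<kappa>/2) * \<tau>"
        using C1 by (simp add: mult_mono)
      have "norm (zeta_reg (Complex (1/2) t)) \<le> \<tau> powr (A * \<epsilon>) * norm (zeta_reg s')"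
        using A(2)[of \<epsilon> t] \<epsilon> by (simp add: s'_def \<tau>_def)
      also have "\<dots> \<le> \<tau> powr (\<kappa>/2) * (C1 * \<tau> powr (\<kappa>/2) * \<tau>)"
        using * \<epsilon> \<tau> by (intro mult_mono powr_mono) auto
      also have "\<dots> = C1 * \<tau> powr \<kappa> * \<tau>"
        by (simp add: mult_ac flip: powr_add)
      also have "\<dots> \<le> C * \<tau> powr \<kappa> * \<tau>" using K \<tau> by (intro mult_right_mono) (auto simp: C_def)
      finally show ?thesis .
    next
      case False
      have "norm (Complex (1/2) t) \<le> 1/2 + \<bar>t\<bar>" using cmod_le[of "Complex (1/2) t"] by simp
      then have "(1 + norm (Complex (1/2) t))\<^sup>2 \<le> \<tau>\<^sup>2" by (intro power_mono) (auto simp: \<tau>_def)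
      then have "norm (zeta_reg (Complex (1/2) t)) \<le> K * \<tau>\<^sup>2"
        using K(1) by (intro order_trans[OF K(2) mult_left_mono]) auto
      also have "\<dots> = (K * \<tau>) * 1 * \<tau>" by (simp add: power2_eq_square)
      also have "\<dots> \<le> C * \<tau> powr \<kappa> * \<tau>"
      proof (intro mult_right_mono mult_mono)
        have "K * \<tau> \<le> K * 8" using False K by (intro mult_left_mono) (auto simp: \<tau>_def)
        then show "K * \<tau> \<le> C" using C1 by (simp add: C_def)
        show "1 \<le> \<tau> powr \<kappa>" using \<tau> \<kappa> by (intro ge_one_powr_ge_zero) auto
      qed (use C1 K \<tau> in \<open>auto simp: C_def\<close>)
      finally show ?thesis .
    qed
    moreover have n1: "norm (Complex (1/2) t - 1) > 0" using norm_critical_minus_1_ge[of t] by linarith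
    ultimately have "norm (zeta (Complex (1/2) t)) \<le> C * \<tau> powr \<kappa> * (\<tau> / norm (Complex (1/2) t - 1))"
      unfolding zeta_def norm_divide by (simp add: divide_right_mono)
    also have "\<dots> \<le> C * \<tau> powr \<kappa> * 9"
    proof (rule mult_left_mono)
      show "\<tau> / norm (Complex (1/2) t - 1) \<le> 9"
        using n1 norm_critical_minus_1_ge[of t] by (simp add: pos_divide_le_eq \<tau>_def)
    qed (use C1 K in \<open>auto simp: C_def\<close>)
    finally show "norm (zeta (Complex (1/2) t)) \<le> 9 * C * (\<bar>t\<bar> + 4) powr \<kappa>" by (simp add: \<tau>_def)
  qed
qed

text \<open>The bound is uniform in \<epsilon>, which makes it the majorant for the passage to
  \<epsilon> = 0. The factor 2 pays for the quotient (s' - 1) / (s - 1) that relates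
  \<open>zeta_reg\<close> to \<open>zeta\<close>.\<close>

theorem zeta_mult_inv_zeta_shift_bound:
  assumes RH: "riemann_hypothesis" and \<kappa>: "0 < \<kappa>"
  obtains \<epsilon>0 where "\<epsilon>0 > 0" "\<And>\<epsilon> t. 0 < \<epsilon> \<Longrightarrow> \<epsilon> \<le> \<epsilon>0 \<Longrightarrow>
    norm (zeta (Complex (1/2) t) * inv_zeta (Complex (1/2 + \<epsilon>) t)) \<le> 2 * (\<bar>t\<bar> + 4) powr \<kappa>"
proof -
  obtain A where A: "A > 0" "\<And>\<epsilon> t. 0 \<le> \<epsilon> \<Longrightarrow> \<epsilon> \<le> 1/20 \<Longrightarrow>
    norm (zeta_reg (Complex (1/2) t)) \<le> (\<bar>t\<bar> + 4) powr (A * \<epsilon>) * norm (zeta_reg (Complex (1/2 + \<epsilon>) t))"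
    using zeta_reg_shift_ratio[OF RH] by metis
  define \<epsilon>0 where "\<epsilon>0 = min (1/20) (\<kappa> / A)"
  show ?thesis
  proof (rule that[of \<epsilon>0])
    show "\<epsilon>0 > 0" using A \<kappa> by (simp add: \<epsilon>0_def)
    fix \<epsilon> t :: real assume \<epsilon>: "0 < \<epsilon>" "\<epsilon> \<le> \<epsilon>0"
    then have \<epsilon>': "\<epsilon> \<le> 1/20" "A * \<epsilon> \<le> \<kappa>" using A by (auto simp: \<epsilon>0_def field_simps)
    define s where "s = Complex (1/2) t"
    define s' where "s' = Complex (1/2 + \<epsilon>) t"
    have nz: "norm (zeta_reg s') > 0" using RH_zeta_reg_nonzero[OF RH, of s'] \<epsilon> by (simp add: s'_def)
    have n1: "norm (s - 1) \<ge> 4/9" using norm_critical_minus_1_ge[of t] by (simp add: s_def)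
    have "norm (s' - 1) \<le> norm (s - 1) + norm (s' - s)" using norm_triangle_ineq[of "s - 1" "s' - s"] by simp
    also have "norm (s' - s) = \<epsilon>" using \<epsilon> by (simp add: s_def s'_def cmod_def)
    finally have n2: "norm (s' - 1) \<le> 2 * norm (s - 1)" using n1 \<epsilon>' by linarith
    have "norm (zeta_reg s) \<le> (\<bar>t\<bar> + 4) powr (A * \<epsilon>) * norm (zeta_reg s')"
      using A(2)[of \<epsilon> t] \<epsilon> \<epsilon>' by (simp add: s_def s'_def)
    also have "\<dots> \<le> (\<bar>t\<bar> + 4) powr \<kappa> * norm (zeta_reg s')"
      using \<epsilon>' by (intro mult_right_mono powr_mono) auto
    finally have r: "norm (zeta_reg s) / norm (zeta_reg s') \<le> (\<bar>t\<bar> + 4) powr \<kappa>"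
      using nz by (simp add: pos_divide_le_eq)
    have "norm (zeta s * inv_zeta s') = (norm (s' - 1) / norm (s - 1)) * (norm (zeta_reg s) / norm (zeta_reg s'))"
      by (simp add: zeta_def inv_zeta_def norm_mult norm_divide)
    also have "\<dots> \<le> 2 * (\<bar>t\<bar> + 4) powr \<kappa>"
    proof (rule mult_mono[OF _ r])
      show "norm (s' - 1) / norm (s - 1) \<le> 2" using n1 n2 by (subst pos_divide_le_eq) linarith+
    qed auto
    finally show "norm (zeta (Complex (1/2) t) * inv_zeta (Complex (1/2 + \<epsilon>) t)) \<le> 2 * (\<bar>t\<bar> + 4) powr \<kappa>"
      by (simp add: s_def s'_def)
  qed
qed

section \<open>Dirichlet polynomials approximating the reciprocal of zeta\<close>

definition dirichlet_poly :: "(complex \<Rightarrow> complex) \<Rightarrow> bool" where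
  "dirichlet_poly D \<longleftrightarrow> (\<exists>N c. \<forall>s. D s = (\<Sum>n\<in>{1..N::nat}. c n * of_nat n powr (-s)))"

lemma dirichlet_polyI: "(\<And>s. D s = (\<Sum>n\<in>{1..N::nat}. c n * of_nat n powr (-s))) \<Longrightarrow> dirichlet_poly D"
  unfolding dirichlet_poly_def by blast

lemma dirichlet_poly_monomial:
  assumes "n \<ge> 1"
  shows "dirichlet_poly (\<lambda>s. a * of_nat n powr (-s))"
proof (rule dirichlet_polyI[where N = n and c = "\<lambda>k. if k = n then a else 0"])
  fix s
  show "a * of_nat n powr (-s) = (\<Sum>k = 1..n. (if k = n then a else 0) * of_nat k powr (-s))"
    using assms by (simp add: if_distrib[of "\<lambda>x. x * _"] sum.delta cong: if_cong)
qed

lemma dirichlet_poly_const: "dirichlet_poly (\<lambda>s. a)"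
  using dirichlet_poly_monomial[of 1 a] by simp

lemma dirichlet_poly_add:
  assumes "dirichlet_poly D" "dirichlet_poly E"
  shows "dirichlet_poly (\<lambda>s. D s + E s)"
proof -
  obtain N c where D: "\<And>s. D s = (\<Sum>n\<in>{1..N::nat}. c n * of_nat n powr (-s))"
    using assms(1) unfolding dirichlet_poly_def by blast
  obtain M d where E: "\<And>s. E s = (\<Sum>n\<in>{1..M::nat}. d n * of_nat n powr (-s))"
    using assms(2) unfolding dirichlet_poly_def by blast
  show ?thesis
  proof (rule dirichlet_polyI[where N = "max N M" and c = "\<lambda>n. (if n \<le> N then c n else 0) + (if n \<le> M then d n else 0)"])
    fix s
    have "D s = (\<Sum>n = 1..max N M. (if n \<le> N then c n else 0) * of_nat n powr (-s))"
      unfolding D by (rule sum.mono_neutral_cong_left) auto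
    moreover have "E s = (\<Sum>n = 1..max N M. (if n \<le> M then d n else 0) * of_nat n powr (-s))"
      unfolding E by (rule sum.mono_neutral_cong_left) auto
    ultimately show "D s + E s = (\<Sum>n = 1..max N M. ((if n \<le> N then c n else 0) + (if n \<le> M then d n else 0)) * of_nat n powr (-s))"
      by (simp add: distrib_right sum.distrib)
  qed
qed

lemma dirichlet_poly_sum:
  "(\<And>i. i \<in> I \<Longrightarrow> dirichlet_poly (D i)) \<Longrightarrow> dirichlet_poly (\<lambda>s. \<Sum>i\<in>I. D i s)"
  by (induction I rule: infinite_finite_induct) (auto intro: dirichlet_poly_const dirichlet_poly_add)

lemma dirichlet_poly_mult:
  assumes "dirichlet_poly D" "dirichlet_poly E"
  shows "dirichlet_poly (\<lambda>s. D s * E s)"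
proof -
  obtain N c where D: "\<And>s. D s = (\<Sum>n\<in>{1..N::nat}. c n * of_nat n powr (-s))"
    using assms(1) unfolding dirichlet_poly_def by blast
  obtain M d where E: "\<And>s. E s = (\<Sum>n\<in>{1..M::nat}. d n * of_nat n powr (-s))"
    using assms(2) unfolding dirichlet_poly_def by blast
  have prod: "of_nat (n * m) powr (-s) = (of_nat n powr (-s) * of_nat m powr (-s) :: complex)" for n m s
    unfolding of_nat_mult by (rule powr_times_real) auto
  have "dirichlet_poly (\<lambda>s. \<Sum>n = 1..N. \<Sum>m = 1..M. (c n * d m) * of_nat (n * m) powr (-s))"
    by (intro dirichlet_poly_sum dirichlet_poly_monomial) auto
  also have "(\<lambda>s. \<Sum>n = 1..N. \<Sum>m = 1..M. (c n * d m) * of_nat (n * m) powr (-s)) = (\<lambda>s. D s * E s)"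
    unfolding D E sum_product prod by (simp add: mult_ac)
  finally show ?thesis .
qed

lemma dirichlet_poly_power: "dirichlet_poly D \<Longrightarrow> dirichlet_poly (\<lambda>s. D s ^ k)"
  by (induction k) (auto intro: dirichlet_poly_const dirichlet_poly_mult)

lemma dirichlet_poly_shift:
  assumes "dirichlet_poly D"
  shows "dirichlet_poly (\<lambda>s. D (s + w))"
proof -
  obtain N c where D: "\<And>s. D s = (\<Sum>n\<in>{1..N::nat}. c n * of_nat n powr (-s))"
    using assms(1) unfolding dirichlet_poly_def by blast
  show ?thesis
  proof (rule dirichlet_polyI[where N = N and c = "\<lambda>n. c n * of_nat n powr (-w)"])
    show "D (s + w) = (\<Sum>n = 1..N. c n * of_nat n powr (-w) * of_nat n powr (-s))" for s
      unfolding D mult.assoc powr_add[symmetric] by (simp add: algebra_simps)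
  qed
qed

lemma dirichlet_poly_holomorphic:
  assumes "dirichlet_poly D"
  shows "D holomorphic_on S"
proof -
  obtain N c where D: "D = (\<lambda>s. \<Sum>n\<in>{1..N::nat}. c n * of_nat n powr (-s))"
    using assms(1) unfolding dirichlet_poly_def fun_eq_iff by blast
  show ?thesis unfolding D by (intro holomorphic_intros) (auto simp: complex_nonpos_Reals_iff)
qed

lemma dirichlet_poly_deriv:
  assumes "dirichlet_poly D"
  shows "dirichlet_poly (deriv D)"
proof -
  obtain N c where D: "D = (\<lambda>s. \<Sum>n\<in>{1..N::nat}. c n * of_nat n powr (-s))"
    using assms(1) unfolding dirichlet_poly_def fun_eq_iff by blast
  show ?thesis
  proof (rule dirichlet_polyI[where N = N and c = "\<lambda>n. - c n * Ln (of_nat n)"])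
    fix s
    have "((\<lambda>s. of_nat n powr (-s)) has_field_derivative - Ln (of_nat n) * of_nat n powr (-s)) (at s)"
      if "n \<in> {1..N}" for n
      using that by (auto simp: powr_def intro!: derivative_eq_intros)
    then have "((\<lambda>s. c n * of_nat n powr (-s)) has_field_derivative - c n * Ln (of_nat n) * of_nat n powr (-s)) (at s)"
      if "n \<in> {1..N}" for n
      using DERIV_cmult[OF that[THEN \<open>\<And>n. n \<in> {1..N} \<Longrightarrow> _\<close>], of "c n"] by (simp add: mult.assoc)
    then have "(D has_field_derivative (\<Sum>n = 1..N. - c n * Ln (of_nat n) * of_nat n powr (-s))) (at s)"
      unfolding D by (intro DERIV_sum) auto
    then show "deriv D s = (\<Sum>n = 1..N. - c n * Ln (of_nat n) * of_nat n powr (-s))"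
      by (rule DERIV_imp_deriv)
  qed
qed

lemma dirichlet_poly_higher_deriv: "dirichlet_poly D \<Longrightarrow> dirichlet_poly ((deriv ^^ n) D)"
  by (induction n) (auto intro: dirichlet_poly_deriv)

text \<open>Expand 1/zeta as a geometric series in zeta - 1, of norm at most 3/4. Replacing zeta - 1
  by a partial sum and cutting off the series leaves a polynomial in a Dirichlet polynomial.\<close>

lemma inv_zeta_approx:
  assumes "e > 0"
  obtains D where "dirichlet_poly D" "\<And>s. Re s \<ge> 2 \<Longrightarrow> norm (inv_zeta s - D s) \<le> e"
proof -
  define u where "u N s = (\<Sum>n<N. of_nat (n + 2) powr (-s) :: complex)" for N s
  have "uniform_limit {s. Re s \<ge> 2} (\<lambda>N s. \<Sum>n<N. of_nat (n + 2) powr (-s) :: complex)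
          (\<lambda>s. \<Sum>n. of_nat (n + 2) powr (-s)) sequentially"
  proof (rule Weierstrass_m_test)
    fix n :: nat and s :: complex assume "s \<in> {s. Re s \<ge> 2}"
    then show "norm (of_nat (n + 2) powr (-s) :: complex) \<le> real (Suc (Suc n)) powr (-2)"
      unfolding norm_nat_powr by (auto intro!: powr_mono simp: add_ac)
  next
    show "summable (\<lambda>n. real (Suc (Suc n)) powr (-2))"
      using summable_Suc_powr[of "-2"] by (subst summable_Suc_iff) auto
  qed
  \<comment> \<open>Both 1 + v and 1 + x below have norm at least 1/4, so this error is multiplied
    by 16 and becomes e / 2; the cut-off contributes 4 (3/4)^K, the other half.\<close>
  then have "\<forall>\<^sub>F N in sequentially. \<forall>s\<in>{s. Re s \<ge> 2}. dist (u N s) (\<Sum>n. of_nat (n + 2) powr (-s)) < e / 32"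
    unfolding u_def using assms by (intro uniform_limitD) auto
  then obtain N where N: "\<And>s. Re s \<ge> 2 \<Longrightarrow> dist (u N s) (\<Sum>n. of_nat (n + 2) powr (-s)) < e / 32"
    by (auto simp: eventually_sequentially)
  have "(\<lambda>K. 4 * (3/4::real) ^ K) \<longlonglongrightarrow> 4 * 0" by (intro tendsto_intros LIMSEQ_power_zero) auto
  then have "\<forall>\<^sub>F K in sequentially. 4 * (3/4::real) ^ K < e / 2"
    using assms by (intro order_tendstoD(2)[of _ "4 * 0"]) auto
  then obtain K where K: "4 * (3/4::real) ^ K < e / 2" by (auto simp: eventually_sequentially)
  show ?thesis
  proof (rule that[of "\<lambda>s. \<Sum>k<K. ((-1) * u N s) ^ k"])
    have "dirichlet_poly (\<lambda>s. of_nat (n + 2) powr (-s))" for n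
      using dirichlet_poly_monomial[of "n + 2" 1] by simp
    then have "dirichlet_poly (u N)" unfolding u_def by (rule dirichlet_poly_sum)
    then show "dirichlet_poly (\<lambda>s. \<Sum>k<K. ((-1) * u N s) ^ k)"
      by (intro dirichlet_poly_sum dirichlet_poly_power dirichlet_poly_mult dirichlet_poly_const)
    fix s :: complex assume s: "Re s \<ge> 2"
    define v where "v = zeta s - 1"
    define x where "x = u N s"
    have vx: "norm (x - v) \<le> e / 32"
      using N[OF s] zeta_minus_1_sums[of s] s by (simp add: x_def v_def sums_iff dist_norm)
    have x: "norm x \<le> 3/4" unfolding x_def u_def by (rule zeta_partial_tail_bound[OF s])
    have v: "norm v \<le> 3/4" unfolding v_def by (rule zeta_tail_bound[OF s])
    have x1: "norm (1 + x) \<ge> 1/4" using norm_triangle_ineq2[of 1 "-x"] x by simp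
    have v1: "norm (1 + v) \<ge> 1/4" using norm_triangle_ineq2[of 1 "-v"] v by simp
    have nz: "1 + x \<noteq> 0" "1 + v \<noteq> 0" using x1 v1 by auto
    have inv: "inv_zeta s = 1 / (1 + v)" by (simp add: v_def inv_zeta_def zeta_def)
    have "(\<Sum>k<K. (- x) ^ k) = (1 - (- x) ^ K) / (1 - (- x))"
      using nz by (subst sum_gp_strict) (metis add.left_inverse minus_minus)
    then have "(\<Sum>k<K. (- x) ^ k) = 1 / (1 + x) - (- x) ^ K / (1 + x)" by (simp add: diff_divide_distrib)
    moreover have "1 / (1 + v) - 1 / (1 + x) = (x - v) / ((1 + v) * (1 + x))"
      using nz by (simp add: diff_frac_eq)
    ultimately have "inv_zeta s - (\<Sum>k<K. (- x) ^ k) = (x - v) / ((1 + v) * (1 + x)) + (- x) ^ K / (1 + x)"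
      unfolding inv by (simp add: algebra_simps)
    also have "norm \<dots> \<le> norm ((x - v) / ((1 + v) * (1 + x))) + norm ((- x) ^ K / (1 + x))"
      by (rule norm_triangle_ineq)
    also have "norm ((x - v) / ((1 + v) * (1 + x))) \<le> (e / 32) / ((1/4) * (1/4))"
      unfolding norm_divide norm_mult using vx x1 v1 assms by (intro frac_le mult_mono) auto
    also have "norm ((- x) ^ K / (1 + x)) \<le> (3/4) ^ K / (1/4)"
      unfolding norm_divide norm_power norm_minus_cancel using x x1 by (intro frac_le power_mono) auto
    also have "(e / 32) / ((1/4) * (1/4)) + (3/4) ^ K / (1/4) \<le> e" using K by simp
    finally show "norm (inv_zeta s - (\<Sum>k<K. ((-1) * u N s) ^ k)) \<le> e" by (simp add: x_def)
  qed
qed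

text \<open>Cauchy's inequality on unit circles, which stay in Re z \<ge> 2; hence a single D serves
  the derivatives of all orders.\<close>

lemma higher_deriv_inv_zeta_approx:
  assumes RH: "riemann_hypothesis" and "e > 0"
  obtains D where "dirichlet_poly D" "\<And>s n. Re s \<ge> 3 \<Longrightarrow> norm ((deriv ^^ n) inv_zeta s - (deriv ^^ n) D s) \<le> fact n * e"
proof -
  obtain D where D: "dirichlet_poly D" "\<And>s. Re s \<ge> 2 \<Longrightarrow> norm (inv_zeta s - D s) \<le> e"
    using inv_zeta_approx[OF assms(2)] by metis
  show ?thesis
  proof (rule that[OF D(1)])
    fix s :: complex and n assume s: "Re s \<ge> 3"
    have re: "Re z \<ge> 2" if "norm (s - z) \<le> 1" for z
      using that abs_Re_le_cmod[of "s - z"] s by simp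
    have sub: "cball s 1 \<subseteq> {z. Re z > 1/2}" using re by (force simp: dist_norm)
    have h1: "inv_zeta holomorphic_on cball s 1" by (rule holomorphic_inv_zeta[OF RH sub])
    have h2: "D holomorphic_on cball s 1" by (rule dirichlet_poly_holomorphic[OF D(1)])
    have "(deriv ^^ n) inv_zeta s - (deriv ^^ n) D s = (deriv ^^ n) (\<lambda>z. inv_zeta z - D z) s"
    proof (rule higher_deriv_diff[symmetric])
      show "inv_zeta holomorphic_on ball s 1" "D holomorphic_on ball s 1"
        using h1 h2 ball_subset_cball holomorphic_on_subset by blast+
    qed auto
    also have "norm \<dots> \<le> fact n * e / 1 ^ n"
    proof (rule Cauchy_inequality)
      show "(\<lambda>z. inv_zeta z - D z) holomorphic_on ball s 1"
        using h1 h2 ball_subset_cball by (intro holomorphic_intros) (blast intro: holomorphic_on_subset)+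
      show "continuous_on (cball s 1) (\<lambda>z. inv_zeta z - D z)"
        using h1 h2 by (intro continuous_intros holomorphic_on_imp_continuous_on)
      show "norm (inv_zeta z - D z) \<le> e" if "norm (s - z) = 1" for z using D(2) re that by simp
    qed simp
    finally show "norm ((deriv ^^ n) inv_zeta s - (deriv ^^ n) D s) \<le> fact n * e" by simp
  qed
qed

(* Taylor expansion of 1/zeta at 1/2 + it + 4, where it is a uniform limit of Dirichlet polynomials together
   with its derivatives; the disc of convergence reaches every point to the right of the critical line. *)
lemma zeta_mult_inv_zeta_shift_approx:
  assumes RH: "riemann_hypothesis" and \<epsilon>: "0 < \<epsilon>" "\<epsilon> < 1" and \<eta>: "\<eta> > 0"
  obtains D where "dirichlet_poly D"
    "\<And>t. norm (zeta (Complex (1/2) t) * (inv_zeta (Complex (1/2 + \<epsilon>) t) - D (Complex (1/2) t))) \<le> \<eta> * (\<bar>t\<bar> + 4) powr (1/4)"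
proof -
  \<comment> \<open>One exponent 1/8 is for zeta and one for 1/zeta; together they make the 1/4 of
    the conclusion.\<close>
  obtain C1 where C1: "C1 > 0" "\<And>t. norm (zeta (Complex (1/2) t)) \<le> C1 * (\<bar>t\<bar> + 4) powr (1/8)"
    using RH_imp_lindelof[OF RH, of "1/8"] by auto
  obtain C2 where C2: "C2 > 0" "\<And>s. 1/2 + \<epsilon>/2 \<le> Re s \<Longrightarrow> norm (inv_zeta s) \<le> C2 * (\<bar>Im s\<bar> + 4) powr (1/8)"
    using inv_zeta_subpower[OF RH, of "\<epsilon>/2" "1/8"] \<epsilon> by auto
  \<comment> \<open>The disc of radius R about s + 4 reaches abscissa 1/2 + \<epsilon>/2, still to
    the right of the critical line, while the target s + \<epsilon> is at the smaller distance 4 -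
    \<epsilon> from its centre.\<close>
  define R where "R = 4 - \<epsilon>/2"
  define \<theta> where "\<theta> = (4 - \<epsilon>) / R"
  have R: "R > 0" "R > 4 - \<epsilon>" using \<epsilon> by (auto simp: R_def)
  have \<theta>: "0 < \<theta>" "\<theta> < 1" using \<epsilon> R by (auto simp: \<theta>_def)
  have "(\<lambda>N. C1 * (2 * C2 * (\<theta> ^ N / (1 - \<theta>)))) \<longlonglongrightarrow> C1 * (2 * C2 * (0 / (1 - \<theta>)))"
    using \<theta> by (intro tendsto_intros LIMSEQ_power_zero) auto
  then have "\<forall>\<^sub>F N in sequentially. C1 * (2 * C2 * (\<theta> ^ N / (1 - \<theta>))) < \<eta> / 2"
    using \<eta> by (intro order_tendstoD) auto
  then obtain N where N: "C1 * (2 * C2 * (\<theta> ^ N / (1 - \<theta>))) < \<eta> / 2" by (auto simp: eventually_sequentially)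
  \<comment> \<open>The n-th Taylor term is off by at most |w|^n e \<le> 4^n e when
    \<open>inv_zeta\<close> is replaced by \<open>D0\<close>, so S e bounds the error of the
    truncated series. Adding 1 keeps S positive when N = 0.\<close>
  define S where "S = (\<Sum>n<N. (4::real) ^ n) + 1"
  have S: "S > 0" unfolding S_def by (intro add_nonneg_pos sum_nonneg) auto
  define e where "e = \<eta> / (2 * C1 * S)"
  have e: "e > 0" using \<eta> C1 S by (simp add: e_def)
  obtain D0 where D0: "dirichlet_poly D0" "\<And>s n. Re s \<ge> 3 \<Longrightarrow> norm ((deriv ^^ n) inv_zeta s - (deriv ^^ n) D0 s) \<le> fact n * e"
    using higher_deriv_inv_zeta_approx[OF RH e] by metis
  define w where "w = complex_of_real (\<epsilon> - 4)"
  have wn: "norm w = 4 - \<epsilon>" using \<epsilon> unfolding w_def norm_of_real by simp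
  define D where "D s = (\<Sum>n<N. (w ^ n / fact n) * (deriv ^^ n) D0 (s + 4))" for s
  show ?thesis
  proof (rule that[of D])
    show "dirichlet_poly D"
      unfolding D_def by (intro dirichlet_poly_sum dirichlet_poly_mult dirichlet_poly_const dirichlet_poly_shift[of "(deriv ^^ _) D0"] dirichlet_poly_higher_deriv D0)
    fix t :: real
    define s where "s = Complex (1/2) t"
    define \<tau> where "\<tau> = \<bar>t\<bar> + 4"
    have \<tau>: "\<tau> \<ge> 4" by (simp add: \<tau>_def)
    have target: "Complex (1/2 + \<epsilon>) t = s + 4 + w" by (simp add: s_def w_def complex_eq_iff)
    have geo: "1/2 + \<epsilon>/2 \<le> Re z" "\<bar>Im z\<bar> + 4 \<le> 2 * \<tau>" if "z \<in> cball (s + 4) R" for z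
    proof -
      have "\<bar>Re (s + 4 - z)\<bar> \<le> R" "\<bar>Im (s + 4 - z)\<bar> \<le> R"
        using that abs_Re_le_cmod[of "s + 4 - z"] abs_Im_le_cmod[of "s + 4 - z"] by (auto simp: dist_norm)
      then show "1/2 + \<epsilon>/2 \<le> Re z" "\<bar>Im z\<bar> + 4 \<le> 2 * \<tau>" using \<epsilon> by (auto simp: s_def R_def \<tau>_def)
    qed
    have hol: "inv_zeta holomorphic_on cball (s + 4) R"
      using geo(1) \<epsilon> by (intro holomorphic_inv_zeta[OF RH]) force
    have bd: "norm (inv_zeta z) \<le> 2 * C2 * \<tau> powr (1/8)" if z: "z \<in> cball (s + 4) R" for z
    proof -
      have "norm (inv_zeta z) \<le> C2 * (\<bar>Im z\<bar> + 4) powr (1/8)" by (rule C2(2)[OF geo(1)[OF z]])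
      also have "(\<bar>Im z\<bar> + 4) powr (1/8) \<le> (2 * \<tau>) powr (1/8)" using geo(2)[OF z] by (intro powr_mono2) auto
      also have "\<dots> = 2 powr (1/8) * \<tau> powr (1/8)" using \<tau> by (simp add: powr_mult)
      also have "2 powr (1/8) \<le> 2 powr (1::real)" by (intro powr_mono) auto
      finally show ?thesis using C2(1) by (simp add: mult_right_mono mult.commute mult.left_commute)
    qed
    define a where "a n = (deriv ^^ n) inv_zeta (s + 4) / fact n" for n
    have coeff: "norm (a n * w ^ n) \<le> 2 * C2 * \<tau> powr (1/8) * \<theta> ^ n" for n
    proof -
      have "norm ((deriv ^^ n) inv_zeta (s + 4)) \<le> fact n * (2 * C2 * \<tau> powr (1/8)) / R ^ n"
      proof (rule Cauchy_inequality[OF _ _ R(1)])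
        show "inv_zeta holomorphic_on ball (s + 4) R" using hol ball_subset_cball holomorphic_on_subset by blast
        show "continuous_on (cball (s + 4) R) inv_zeta" using hol by (rule holomorphic_on_imp_continuous_on)
        show "norm (inv_zeta z) \<le> 2 * C2 * \<tau> powr (1/8)" if "norm (s + 4 - z) = R" for z
          using that by (intro bd) (auto simp: dist_norm)
      qed
      then have "norm (a n) \<le> 2 * C2 * \<tau> powr (1/8) / R ^ n" by (simp add: a_def norm_divide field_simps)
      then have "norm (a n) * (4 - \<epsilon>) ^ n \<le> 2 * C2 * \<tau> powr (1/8) / R ^ n * (4 - \<epsilon>) ^ n"
        using \<epsilon> by (intro mult_right_mono) auto
      then show ?thesis by (simp add: norm_mult norm_power wn \<theta>_def power_divide)
    qed
    have "(\<lambda>n. a n * (s + 4 + w - (s + 4)) ^ n) sums inv_zeta (s + 4 + w)"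
      unfolding a_def
    proof (rule holomorphic_power_series)
      show "inv_zeta holomorphic_on ball (s + 4) R" using hol ball_subset_cball holomorphic_on_subset by blast
      show "s + 4 + w \<in> ball (s + 4) R" using R wn by (simp add: dist_norm)
    qed
    then have sums: "(\<lambda>n. a n * w ^ n) sums inv_zeta (s + 4 + w)" by simp
    have geo_sums: "(\<lambda>n. 2 * C2 * \<tau> powr (1/8) * \<theta> ^ (n + N)) sums (2 * C2 * \<tau> powr (1/8) * (\<theta> ^ N / (1 - \<theta>)))"
      using sums_mult[OF geometric_sums[of \<theta>], of "2 * C2 * \<tau> powr (1/8) * \<theta> ^ N"] \<theta> by (simp add: power_add algebra_simps)
    have "inv_zeta (s + 4 + w) - (\<Sum>n<N. a n * w ^ n) = (\<Sum>n. a (n + N) * w ^ (n + N))"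
      unfolding sums_unique[OF sums] suminf_split_initial_segment[OF sums_summable[OF sums], of N] by simp
    also have "norm \<dots> \<le> (\<Sum>n. 2 * C2 * \<tau> powr (1/8) * \<theta> ^ (n + N))"
      by (rule norm_suminf_le[OF coeff sums_summable[OF geo_sums]])
    also have "\<dots> = 2 * C2 * \<tau> powr (1/8) * (\<theta> ^ N / (1 - \<theta>))" using geo_sums by (simp add: sums_iff)
    finally have 1: "norm (inv_zeta (s + 4 + w) - (\<Sum>n<N. a n * w ^ n)) \<le> 2 * C2 * \<tau> powr (1/8) * (\<theta> ^ N / (1 - \<theta>))" .
    have "(\<Sum>n<N. a n * w ^ n) - D s = (\<Sum>n<N. (w ^ n / fact n) * ((deriv ^^ n) inv_zeta (s + 4) - (deriv ^^ n) D0 (s + 4)))"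
      unfolding D_def a_def by (simp add: sum_subtractf[symmetric] right_diff_distrib mult.commute)
    also have "norm \<dots> \<le> (\<Sum>n<N. 4 ^ n * e)"
    proof (rule sum_norm_le)
      fix n
      have "norm ((w ^ n / fact n) * ((deriv ^^ n) inv_zeta (s + 4) - (deriv ^^ n) D0 (s + 4))) \<le> ((4 - \<epsilon>) ^ n / fact n) * (fact n * e)"
        unfolding norm_mult norm_divide norm_power wn using D0(2)[of "s + 4" n] \<epsilon>
        by (intro mult_mono) (auto simp: s_def)
      also have "\<dots> = (4 - \<epsilon>) ^ n * e" by simp
      also have "\<dots> \<le> 4 ^ n * e" using \<epsilon> e by (intro mult_right_mono power_mono) auto
      finally show "norm ((w ^ n / fact n) * ((deriv ^^ n) inv_zeta (s + 4) - (deriv ^^ n) D0 (s + 4))) \<le> 4 ^ n * e" .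
    qed
    also have "\<dots> \<le> S * e" using e by (simp add: S_def sum_distrib_right[symmetric] mult_right_mono)
    finally have 2: "norm ((\<Sum>n<N. a n * w ^ n) - D s) \<le> S * e" .
    have p: "1 \<le> \<tau> powr (1/8)" using \<tau> by (intro ge_one_powr_ge_zero) auto
    have "norm (inv_zeta (s + 4 + w) - D s) \<le> 2 * C2 * \<tau> powr (1/8) * (\<theta> ^ N / (1 - \<theta>)) + S * e"
      using norm_triangle_ineq[of "inv_zeta (s + 4 + w) - (\<Sum>n<N. a n * w ^ n)" "(\<Sum>n<N. a n * w ^ n) - D s"] 1 2 by simp
    also have "\<dots> \<le> 2 * C2 * \<tau> powr (1/8) * (\<theta> ^ N / (1 - \<theta>)) + S * e * \<tau> powr (1/8)"
      using mult_left_mono[OF p, of "S * e"] S e by simp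
    also have "\<dots> = (2 * C2 * (\<theta> ^ N / (1 - \<theta>)) + S * e) * \<tau> powr (1/8)" by (simp add: algebra_simps)
    finally have 3: "norm (inv_zeta (s + 4 + w) - D s) \<le> (2 * C2 * (\<theta> ^ N / (1 - \<theta>)) + S * e) * \<tau> powr (1/8)" .
    have "norm (zeta s * (inv_zeta (s + 4 + w) - D s)) \<le> (C1 * \<tau> powr (1/8)) * ((2 * C2 * (\<theta> ^ N / (1 - \<theta>)) + S * e) * \<tau> powr (1/8))"
      unfolding norm_mult using C1 3 by (intro mult_mono) (auto simp: s_def \<tau>_def)
    also have "\<dots> = (C1 * (2 * C2 * (\<theta> ^ N / (1 - \<theta>))) + C1 * S * e) * (\<tau> powr (1/8) * \<tau> powr (1/8))"
      by (simp add: algebra_simps)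
    also have "\<tau> powr (1/8) * \<tau> powr (1/8) = \<tau> powr (1/4)" by (simp flip: powr_add)
    also have "C1 * S * e = \<eta> / 2" using C1 S by (simp add: e_def)
    also have "(C1 * (2 * C2 * (\<theta> ^ N / (1 - \<theta>))) + \<eta> / 2) * \<tau> powr (1/4) \<le> \<eta> * \<tau> powr (1/4)"
      using N by (intro mult_right_mono) auto
    finally show "norm (zeta (Complex (1/2) t) * (inv_zeta (Complex (1/2 + \<epsilon>) t) - D (Complex (1/2) t))) \<le> \<eta> * (\<bar>t\<bar> + 4) powr (1/4)"
      unfolding target by (simp add: s_def \<tau>_def)
  qed
qed

section \<open>Mean squares along the critical line\<close>

lemma nn_integral_abs_le:
  assumes [measurable]: "f \<in> borel_measurable borel"
  shows "(\<integral>\<^sup>+ t. f \<bar>t\<bar> \<partial>lborel) \<le> 2 * (\<integral>\<^sup>+ t. f t * indicator {0..} (t :: real) \<partial>lborel)"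
proof -
  have "(\<integral>\<^sup>+ t. f \<bar>t\<bar> \<partial>lborel) \<le> (\<integral>\<^sup>+ t. f t * indicator {0..} t + f (- t) * indicator {0..} (- t) \<partial>lborel)"
    by (intro nn_integral_mono) (auto split: split_indicator)
  also have "\<dots> = (\<integral>\<^sup>+ t. f t * indicator {0..} t \<partial>lborel) + (\<integral>\<^sup>+ t. f (- t) * indicator {0..} (- t) \<partial>lborel)"
    by (intro nn_integral_add) auto
  also have "(\<integral>\<^sup>+ t. f (- t) * indicator {0..} (- t) \<partial>lborel) = (\<integral>\<^sup>+ t. f t * indicator {0..} t \<partial>lborel)"
    by (subst nn_integral_real_affine[of "\<lambda>t. f t * indicator {0..} t" "-1" 0]) auto
  finally show ?thesis by (simp add: mult_2)
qed

text \<open>The exponent is 2 * (1/4) - 2: the growth 1/4, squared, against the weight (|t| +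
  4)^(-2).\<close>

lemma nn_integral_powr_tail: "(\<integral>\<^sup>+ t. ennreal ((\<bar>t\<bar> + 4) powr (-3/2)) \<partial>lborel) < \<infinity>"
proof -
  have half: "(\<integral>\<^sup>+ t. ennreal ((t + 4) powr (-3/2)) * indicator {0..} t \<partial>lborel) = ennreal (0 - (- 2 * (0 + 4) powr (-1/2)))"
  proof (rule nn_integral_FTC_atLeast)
    show "(\<lambda>t::real. (t + 4) powr (-3/2)) \<in> borel_measurable borel" by measurable
    fix x :: real assume x: "0 \<le> x"
    show "((\<lambda>t. - 2 * (t + 4) powr (-1/2)) has_real_derivative (x + 4) powr (-3/2)) (at x)"
      using x by (auto intro!: derivative_eq_intros)
    show "0 \<le> (x + 4) powr (-3/2)" by simp
  next
    have "((\<lambda>x::real. (x + 4) powr (-1/2)) \<longlongrightarrow> 0) at_top"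
      by (rule tendsto_neg_powr)
         (use filterlim_tendsto_add_at_top[OF tendsto_const[of "4::real"] filterlim_ident] in \<open>auto simp: add.commute\<close>)
    from tendsto_mult[OF tendsto_const this, of "-2"]
    show "((\<lambda>t::real. - 2 * (t + 4) powr (-1/2)) \<longlongrightarrow> 0) at_top" by simp
  qed
  have "(\<integral>\<^sup>+ t. ennreal ((\<bar>t\<bar> + 4) powr (-3/2)) \<partial>lborel) \<le> 2 * (\<integral>\<^sup>+ t. ennreal ((t + 4) powr (-3/2)) * indicator {0..} t \<partial>lborel)"
    by (rule nn_integral_abs_le) measurable
  also have "\<dots> < \<infinity>" unfolding half by (simp add: ennreal_mult_less_top)
  finally show ?thesis .
qed

lemma borel_measurable_vertical_line:
  assumes "continuous_on {s. Re s = \<sigma>} g"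
  shows "(\<lambda>t. g (Complex \<sigma> t)) \<in> borel_measurable borel"
proof -
  have "continuous_on UNIV (\<lambda>t. g (Complex \<sigma> t))"
    by (rule continuous_on_compose2[OF assms]) (auto simp: Complex_eq intro!: continuous_intros)
  then show ?thesis by (rule borel_measurable_continuous_onI)
qed

lemma zeta_measurable_critical [measurable]: "(\<lambda>t. zeta (Complex (1/2) t)) \<in> borel_measurable borel"
  by (intro borel_measurable_vertical_line holomorphic_on_imp_continuous_on holomorphic_zeta) auto

lemma dirichlet_poly_measurable:
  "dirichlet_poly D \<Longrightarrow> (\<lambda>t. D (Complex \<sigma> t)) \<in> borel_measurable borel"
  by (intro borel_measurable_vertical_line holomorphic_on_imp_continuous_on dirichlet_poly_holomorphic)

text \<open>Its value at 1 is 1, so a constant \<open>zeta_reg\<close> would give zeta(11) = 1/10,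
  below the lower bound 1/4.\<close>

lemma not_constant_zeta_reg: "\<not> zeta_reg constant_on {z. Re z > 0}"
proof
  assume "zeta_reg constant_on {z. Re z > 0}"
  then obtain y where y: "\<And>z. Re z > 0 \<Longrightarrow> zeta_reg z = y" by (auto simp: constant_on_def)
  have "zeta_reg 11 = 1" using y[of 1] y[of 11] by simp
  then have "norm (zeta 11) = 1/10" by (simp add: zeta_def norm_divide)
  then show False using zeta_bounds_ge_2(1)[of 11] by simp
qed

text \<open>The hypothesis leaves room for zeros exactly here, but a non-constant holomorphic
  function has finitely many on each compact segment, so they are countable.\<close>

lemma AE_critical_zeta_nonzero: "AE t in lborel. zeta_reg (Complex (1/2) t) \<noteq> 0"
proof -
  define Q where "Q n = cbox (Complex (1/2) (- real n)) (Complex (1/2) (real n))" for n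
  have "finite {z \<in> Q n. zeta_reg z = 0}" for n
    by (rule holomorphic_compact_finite_zeros[OF holomorphic_zeta_reg open_halfspace_Re_gt _ _ _ not_constant_zeta_reg])
       (auto simp: Q_def in_cbox_complex_iff intro!: convex_connected convex_halfspace_Re_gt)
  then have "countable (Im ` (\<Union>n. {z \<in> Q n. zeta_reg z = 0}))"
    by (intro countable_image countable_UN) (auto intro: countable_finite)
  moreover have "{t. zeta_reg (Complex (1/2) t) = 0} \<subseteq> Im ` (\<Union>n. {z \<in> Q n. zeta_reg z = 0})"
  proof safe
    fix t assume t: "zeta_reg (Complex (1/2) t) = 0"
    obtain n :: nat where "\<bar>t\<bar> \<le> real n" using real_arch_simple by blast
    then have "Complex (1/2) t \<in> Q n" by (auto simp: Q_def in_cbox_complex_iff)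
    with t show "t \<in> Im ` (\<Union>n. {z \<in> Q n. zeta_reg z = 0})"
      by (intro image_eqI[of _ _ "Complex (1/2) t"]) auto
  qed
  ultimately have "countable {t. zeta_reg (Complex (1/2) t) = 0}" by (rule countable_subset[rotated])
  then have "{t. zeta_reg (Complex (1/2) t) = 0} \<in> null_sets lborel" by (rule countable_imp_null_set_lborel)
  from AE_not_in[OF this] show ?thesis by simp
qed

lemma zeta_shift_tendsto:
  assumes nz: "zeta_reg (Complex (1/2) t) \<noteq> 0" and \<epsilon>: "\<epsilon> \<longlonglongrightarrow> 0"
  shows "(\<lambda>k. zeta (Complex (1/2) t) * inv_zeta (Complex (1/2 + \<epsilon> k) t)) \<longlonglongrightarrow> 1"
proof -
  define s where "s = Complex (1/2) t"
  have lim: "(\<lambda>k. s + of_real (\<epsilon> k)) \<longlonglongrightarrow> s + of_real 0" by (intro tendsto_intros \<epsilon>)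
  have "isCont zeta_reg s"
    using holomorphic_on_imp_continuous_on[OF holomorphic_zeta_reg] open_halfspace_Re_gt
    by (simp add: continuous_on_eq_continuous_at s_def)
  then have "(\<lambda>k. zeta_reg (s + of_real (\<epsilon> k))) \<longlonglongrightarrow> zeta_reg s"
    using lim by (intro isCont_tendsto_compose[of s zeta_reg]) auto
  then have "(\<lambda>k. zeta s * ((s + of_real (\<epsilon> k) - 1) / zeta_reg (s + of_real (\<epsilon> k)))) \<longlonglongrightarrow> zeta s * ((s + of_real 0 - 1) / zeta_reg s)"
    using nz lim \<epsilon> by (intro tendsto_intros) (auto simp: s_def)
  also have "zeta s * ((s + of_real 0 - 1) / zeta_reg s) = 1"
    using nz by (simp add: zeta_def s_def complex_eq_iff)
  finally have "(\<lambda>k. zeta s * inv_zeta (s + of_real (\<epsilon> k))) \<longlonglongrightarrow> 1" by (simp add: inv_zeta_def)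
  moreover have "s + of_real x = Complex (1/2 + x) t" for x by (simp add: s_def complex_eq_iff)
  ultimately show ?thesis by (simp add: s_def)
qed

lemma norm_sum_sq_le: "(norm (x + y :: complex))\<^sup>2 \<le> 2 * (norm x)\<^sup>2 + 2 * (norm y)\<^sup>2"
proof -
  have "(norm (x + y))\<^sup>2 \<le> (norm x + norm y)\<^sup>2" by (intro power_mono norm_triangle_ineq) auto
  also have "\<dots> \<le> 2 * (norm x)\<^sup>2 + 2 * (norm y)\<^sup>2"
    using zero_le_power2[of "norm x - norm y"] by (simp add: power2_eq_square algebra_simps)
  finally show ?thesis .
qed

lemma powr_sq_weight:
  assumes "\<tau> > (0::real)"
  shows "(c * \<tau> powr (1/4))\<^sup>2 / \<tau>\<^sup>2 = c\<^sup>2 * \<tau> powr (-3/2)"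
proof -
  have "(\<tau> powr (1/4))\<^sup>2 = \<tau> powr (1/2)" by (simp add: power2_eq_square flip: powr_add)
  moreover have "\<tau> powr (1/2) / \<tau>\<^sup>2 = \<tau> powr (1/2 - 2)" unfolding powr_diff using assms by simp
  ultimately show ?thesis by (simp add: power_mult_distrib flip: times_divide_eq_right)
qed

theorem RH_critical_line_approx:
  assumes RH: "riemann_hypothesis" and e: "e > 0"
  obtains D where "dirichlet_poly D"
    "(\<integral>\<^sup>+ t. ennreal ((norm (1 - zeta (Complex (1/2) t) * D (Complex (1/2) t)))\<^sup>2 / (\<bar>t\<bar> + 4)\<^sup>2) \<partial>lborel) < ennreal e"
proof -
  obtain \<epsilon>0 where \<epsilon>0: "\<epsilon>0 > 0" "\<And>\<epsilon> t. 0 < \<epsilon> \<Longrightarrow> \<epsilon> \<le> \<epsilon>0 \<Longrightarrow>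
    norm (zeta (Complex (1/2) t) * inv_zeta (Complex (1/2 + \<epsilon>) t)) \<le> 2 * (\<bar>t\<bar> + 4) powr (1/4)"
    using zeta_mult_inv_zeta_shift_bound[OF RH, of "1/4"] by auto
  define \<epsilon> where "\<epsilon> k = min \<epsilon>0 (1/2) / real (Suc k)" for k
  have \<epsilon>: "0 < \<epsilon> k" "\<epsilon> k \<le> \<epsilon>0" "\<epsilon> k < 1" for k
  proof -
    have "\<epsilon> k \<le> min \<epsilon>0 (1/2) / 1" unfolding \<epsilon>_def using \<epsilon>0(1) by (intro divide_left_mono) auto
    then show "0 < \<epsilon> k" "\<epsilon> k \<le> \<epsilon>0" "\<epsilon> k < 1" using \<epsilon>0(1) by (auto simp: \<epsilon>_def)
  qed
  have \<epsilon>_lim: "\<epsilon> \<longlonglongrightarrow> 0" unfolding \<epsilon>_def by (rule LIMSEQ_Suc[OF lim_const_over_n])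
  define I where "I = (\<integral>\<^sup>+ t. ennreal ((\<bar>t\<bar> + 4) powr (-3/2)) \<partial>lborel)"
  have I: "I < \<infinity>" unfolding I_def by (rule nn_integral_powr_tail)
  define z where "z t = zeta (Complex (1/2) t)" for t
  define v where "v k t = inv_zeta (Complex (1/2 + \<epsilon> k) t)" for k t
  have z_meas [measurable]: "z \<in> borel_measurable borel" unfolding z_def by measurable
  have v_meas [measurable]: "v k \<in> borel_measurable borel" for k
    unfolding v_def using \<epsilon>(1)[of k]
    by (intro borel_measurable_vertical_line holomorphic_on_imp_continuous_on holomorphic_inv_zeta[OF RH]) auto
  have "(\<lambda>k. \<integral>\<^sup>+ t. ennreal ((norm (1 - z t * v k t))\<^sup>2 / (\<bar>t\<bar> + 4)\<^sup>2) \<partial>lborel) \<longlonglongrightarrow> (\<integral>\<^sup>+ t. 0 \<partial>(lborel :: real measure))"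
  \<comment> \<open>|1 - z v| \<le> 1 + 2 \<tau>^(1/4) \<le> 3 \<tau>^(1/4) with \<tau> = |t| + 4;
    the 9 is the square of 3.\<close>
  proof (rule nn_integral_dominated_convergence[where w = "\<lambda>t. ennreal (9 * (\<bar>t\<bar> + 4) powr (-3/2))"])
    show "AE t in lborel. ennreal ((norm (1 - z t * v k t))\<^sup>2 / (\<bar>t\<bar> + 4)\<^sup>2) \<le> ennreal (9 * (\<bar>t\<bar> + 4) powr (-3/2))" for k
    proof (intro AE_I2 ennreal_leI)
      fix t :: real
      have p: "1 \<le> (\<bar>t\<bar> + 4) powr (1/4)" by (intro ge_one_powr_ge_zero) auto
      have "norm (1 - z t * v k t) \<le> 1 + 2 * (\<bar>t\<bar> + 4) powr (1/4)"
        using norm_triangle_ineq4[of 1 "z t * v k t"] \<epsilon>0(2)[OF \<epsilon>(1,2), of t k] by (simp add: z_def v_def)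
      also have "\<dots> \<le> 3 * (\<bar>t\<bar> + 4) powr (1/4)" using p by simp
      finally have "(norm (1 - z t * v k t))\<^sup>2 / (\<bar>t\<bar> + 4)\<^sup>2 \<le> (3 * (\<bar>t\<bar> + 4) powr (1/4))\<^sup>2 / (\<bar>t\<bar> + 4)\<^sup>2"
        by (intro divide_right_mono power_mono) auto
      then show "(norm (1 - z t * v k t))\<^sup>2 / (\<bar>t\<bar> + 4)\<^sup>2 \<le> 9 * (\<bar>t\<bar> + 4) powr (-3/2)"
        by (subst (asm) powr_sq_weight) auto
    qed
    show "(\<integral>\<^sup>+ t. ennreal (9 * (\<bar>t\<bar> + 4) powr (-3/2)) \<partial>lborel) < \<infinity>"
      using I by (simp add: ennreal_mult nn_integral_cmult I_def ennreal_mult_less_top)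
    show "AE t in lborel. (\<lambda>k. ennreal ((norm (1 - z t * v k t))\<^sup>2 / (\<bar>t\<bar> + 4)\<^sup>2)) \<longlonglongrightarrow> 0"
      using AE_critical_zeta_nonzero
    proof eventually_elim
      case (elim t)
      have "(\<lambda>k. z t * v k t) \<longlonglongrightarrow> 1" unfolding z_def v_def by (rule zeta_shift_tendsto[OF elim \<epsilon>_lim])
      then have "(\<lambda>k. ennreal ((norm (1 - z t * v k t))\<^sup>2 / (\<bar>t\<bar> + 4)\<^sup>2)) \<longlonglongrightarrow> ennreal ((norm (1 - 1 :: complex))\<^sup>2 / (\<bar>t\<bar> + 4)\<^sup>2)"
        by (intro tendsto_intros tendsto_ennrealI) auto
      then show ?case by simp
    qed
  qed (measurable)
  then have "\<forall>\<^sub>F k in sequentially. (\<integral>\<^sup>+ t. ennreal ((norm (1 - z t * v k t))\<^sup>2 / (\<bar>t\<bar> + 4)\<^sup>2) \<partial>lborel) < ennreal (e/4)"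
    using e by (intro order_tendstoD(2)[of _ 0]) auto
  then obtain k where k: "(\<integral>\<^sup>+ t. ennreal ((norm (1 - z t * v k t))\<^sup>2 / (\<bar>t\<bar> + 4)\<^sup>2) \<partial>lborel) < ennreal (e/4)"
    by (auto simp: eventually_sequentially)
  define J where "J = enn2real I"
  have J: "I = ennreal J" "J \<ge> 0" using I by (auto simp: J_def)
  \<comment> \<open>This makes 2 \<eta>^2 J \<le> e / 4, which together with twice the e / 4 from
    above stays below e. The denominator has J + 1 because only J \<ge> 0 is recorded.\<close>
  define \<eta> where "\<eta> = sqrt (e / (8 * (J + 1)))"
  have \<eta>: "\<eta> > 0" "\<eta>\<^sup>2 = e / (8 * (J + 1))" using e J by (auto simp: \<eta>_def)
  obtain D where D: "dirichlet_poly D"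
    "\<And>t. norm (zeta (Complex (1/2) t) * (inv_zeta (Complex (1/2 + \<epsilon> k) t) - D (Complex (1/2) t))) \<le> \<eta> * (\<bar>t\<bar> + 4) powr (1/4)"
    using zeta_mult_inv_zeta_shift_approx[OF RH \<epsilon>(1) \<epsilon>(3) \<eta>(1)] by metis
  define d where "d t = D (Complex (1/2) t)" for t
  have d_meas [measurable]: "d \<in> borel_measurable borel" unfolding d_def by (rule dirichlet_poly_measurable[OF D(1)])
  have pointwise: "(norm (1 - z t * d t))\<^sup>2 / (\<bar>t\<bar> + 4)\<^sup>2 \<le> 2 * ((norm (1 - z t * v k t))\<^sup>2 / (\<bar>t\<bar> + 4)\<^sup>2) + 2 * \<eta>\<^sup>2 * (\<bar>t\<bar> + 4) powr (-3/2)" for t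
  proof -
    have "1 - z t * d t = (1 - z t * v k t) + z t * (v k t - d t)" by (simp add: algebra_simps)
    then have "(norm (1 - z t * d t))\<^sup>2 \<le> 2 * (norm (1 - z t * v k t))\<^sup>2 + 2 * (norm (z t * (v k t - d t)))\<^sup>2"
      using norm_sum_sq_le by metis
    also have "\<dots> \<le> 2 * (norm (1 - z t * v k t))\<^sup>2 + 2 * (\<eta> * (\<bar>t\<bar> + 4) powr (1/4))\<^sup>2"
      using D(2)[of t] by (intro add_left_mono mult_left_mono power_mono) (auto simp: z_def v_def d_def)
    finally have "(norm (1 - z t * d t))\<^sup>2 / (\<bar>t\<bar> + 4)\<^sup>2 \<le> (2 * (norm (1 - z t * v k t))\<^sup>2 + 2 * (\<eta> * (\<bar>t\<bar> + 4) powr (1/4))\<^sup>2) / (\<bar>t\<bar> + 4)\<^sup>2"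
      by (intro divide_right_mono) auto
    also have "\<dots> = 2 * ((norm (1 - z t * v k t))\<^sup>2 / (\<bar>t\<bar> + 4)\<^sup>2) + 2 * ((\<eta> * (\<bar>t\<bar> + 4) powr (1/4))\<^sup>2 / (\<bar>t\<bar> + 4)\<^sup>2)"
      by (simp add: add_divide_distrib)
    also have "(\<eta> * (\<bar>t\<bar> + 4) powr (1/4))\<^sup>2 / (\<bar>t\<bar> + 4)\<^sup>2 = \<eta>\<^sup>2 * (\<bar>t\<bar> + 4) powr (-3/2)"
      by (rule powr_sq_weight) auto
    finally show ?thesis by simp
  qed
  have "(\<integral>\<^sup>+ t. ennreal ((norm (1 - z t * d t))\<^sup>2 / (\<bar>t\<bar> + 4)\<^sup>2) \<partial>lborel) \<le>
     (\<integral>\<^sup>+ t. ennreal 2 * ennreal ((norm (1 - z t * v k t))\<^sup>2 / (\<bar>t\<bar> + 4)\<^sup>2) + ennreal (2 * \<eta>\<^sup>2) * ennreal ((\<bar>t\<bar> + 4) powr (-3/2)) \<partial>lborel)"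
    by (intro nn_integral_mono, subst ennreal_mult'[symmetric], simp, subst ennreal_mult'[symmetric], simp,
        subst ennreal_plus[symmetric], simp, simp, rule ennreal_leI, rule pointwise)
  also have "\<dots> = ennreal 2 * (\<integral>\<^sup>+ t. ennreal ((norm (1 - z t * v k t))\<^sup>2 / (\<bar>t\<bar> + 4)\<^sup>2) \<partial>lborel) + ennreal (2 * \<eta>\<^sup>2) * I"
    unfolding I_def by (subst nn_integral_add, measurable, subst nn_integral_cmult, measurable, subst nn_integral_cmult, measurable)
  also have "\<dots> \<le> ennreal 2 * ennreal (e/4) + ennreal (2 * \<eta>\<^sup>2) * ennreal J"
    unfolding J(1) using k by (intro add_mono mult_left_mono) (auto intro: less_imp_le)
  also have "\<dots> = ennreal (2 * (e/4) + 2 * \<eta>\<^sup>2 * J)"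
    using e J by (subst (1 2) ennreal_mult'[symmetric]) (auto simp flip: ennreal_plus)
  also have "\<dots> < ennreal e"
  proof (rule ennreal_lessI)
    have "J / (J + 1) \<le> 1" using J by simp
    then have "e / 4 * (J / (J + 1)) \<le> e / 4 * 1" using e by (intro mult_left_mono) auto
    then have "2 * \<eta>\<^sup>2 * J \<le> e / 4" unfolding \<eta>(2) using J by (simp add: field_simps)
    then show "2 * (e/4) + 2 * \<eta>\<^sup>2 * J < e" using e by linarith
  qed (use e in auto)
  finally show ?thesis using that[OF D(1)] by (simp add: z_def d_def)
qed

section \<open>A Plancherel inequality\<close>

lemma integrable_lborel_prod:
  fixes g h :: "real \<Rightarrow> complex"
  assumes g: "integrable lborel g" and h: "integrable lborel h"
  shows "integrable (lborel \<Otimes>\<^sub>M lborel) (\<lambda>(x, y). g x * h y)"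
proof (rule lborel_pair.Fubini_integrable)
  have [measurable]: "g \<in> borel_measurable borel" "h \<in> borel_measurable borel" using g h by auto
  show "(\<lambda>(x, y). g x * h y) \<in> borel_measurable (lborel \<Otimes>\<^sub>M lborel)" by measurable
  show "integrable lborel (\<lambda>x. \<integral>y. norm (case (x, y) of (x, y) \<Rightarrow> g x * h y) \<partial>lborel)"
    using g h by (simp add: norm_mult)
  show "AE x in lborel. integrable lborel (\<lambda>y. case (x, y) of (x, y) \<Rightarrow> g x * h y)"
    using h by simp
qed

lemma gaussian_integrable: "\<eta> > 0 \<Longrightarrow> integrable lborel (\<lambda>t. exp (- (\<eta> * t)\<^sup>2 / 2) :: real)"
proof -
  assume "\<eta> > 0"
  have "integrable lborel (\<lambda>t. sqrt (2 * pi) * std_normal_density (0 + \<eta> * t))"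
    using \<open>\<eta> > 0\<close> by (intro integrable_mult_right lborel_integrable_real_affine) auto
  then show ?thesis by (simp add: std_normal_density_def)
qed

text \<open>The characteristic function of the standard normal distribution, rescaled by
  \<eta>.\<close>

lemma gaussian_fourier:
  assumes "\<eta> > 0"
  shows "(\<integral>t. of_real (exp (- (\<eta> * t)\<^sup>2 / 2)) * cis (t * u) \<partial>lborel) = of_real (sqrt (2 * pi) / \<eta> * exp (- (u / \<eta>)\<^sup>2 / 2))"
proof -
  have "complex_of_real (exp (- (u / \<eta>)\<^sup>2 / 2)) = (CLINT x|std_normal_distribution. iexp (u / \<eta> * x))"
    using fun_cong[OF char_std_normal_distribution, of "u / \<eta>"] by (simp add: char_def)
  also have "\<dots> = (\<integral>x. std_normal_density x *\<^sub>R iexp (u / \<eta> * x) \<partial>lborel)"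
    by (subst integral_density) auto
  also have "\<dots> = \<bar>\<eta>\<bar> *\<^sub>R (\<integral>t. std_normal_density (0 + \<eta> * t) *\<^sub>R iexp (u / \<eta> * (0 + \<eta> * t)) \<partial>lborel)"
    using assms by (intro lborel_integral_real_affine) auto
  also have "(\<lambda>t. std_normal_density (0 + \<eta> * t) *\<^sub>R iexp (u / \<eta> * (0 + \<eta> * t))) =
      (\<lambda>t. of_real (1 / sqrt (2 * pi)) * (of_real (exp (- (\<eta> * t)\<^sup>2 / 2)) * cis (t * u)))"
    using assms by (auto simp: std_normal_density_def scaleR_conv_of_real cis_conv_exp mult_ac)
  finally have "complex_of_real (exp (- (u / \<eta>)\<^sup>2 / 2)) =
      of_real (\<eta> / sqrt (2 * pi)) * (\<integral>t. of_real (exp (- (\<eta> * t)\<^sup>2 / 2)) * cis (t * u) \<partial>lborel)"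
    using assms by (simp add: scaleR_conv_of_real)
  then have "of_real (sqrt (2 * pi) / \<eta>) * complex_of_real (exp (- (u / \<eta>)\<^sup>2 / 2)) =
      of_real (sqrt (2 * pi) / \<eta> * (\<eta> / sqrt (2 * pi))) * (\<integral>t. of_real (exp (- (\<eta> * t)\<^sup>2 / 2)) * cis (t * u) \<partial>lborel)"
    by (simp only: of_real_mult mult.assoc)
  then show ?thesis using assms by simp
qed

text \<open>With y = ln x the kernel is x^(it), whence the positive sign. No normalising factor is
  included, so 2 pi appears in Plancherel.\<close>

definition fourier :: "(real \<Rightarrow> complex) \<Rightarrow> real \<Rightarrow> complex" where
  "fourier D t = (\<integral>y. D y * cis (t * y) \<partial>lborel)"

lemma cis_measurable [measurable]: "cis \<in> borel_measurable borel"
  by (intro borel_measurable_continuous_onI continuous_intros)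

lemma cnj_measurable [measurable]: "cnj \<in> borel_measurable borel"
  by (intro borel_measurable_continuous_onI continuous_intros)

lemma integrable_mult_cis:
  assumes "integrable lborel D"
  shows "integrable lborel (\<lambda>y. D y * cis (t * y))"
proof (rule Bochner_Integration.integrable_bound[OF assms])
  have [measurable]: "D \<in> borel_measurable borel" using assms by auto
  show "(\<lambda>y. D y * cis (t * y)) \<in> borel_measurable lborel" by measurable
qed (simp add: norm_mult)

lemma norm_fourier_le:
  assumes "integrable lborel D"
  shows "norm (fourier D t) \<le> (\<integral>y. norm (D y) \<partial>lborel)"
proof -
  have "norm (fourier D t) \<le> (\<integral>y. norm (D y * cis (t * y)) \<partial>lborel)" unfolding fourier_def by (rule integral_norm_bound)
  then show ?thesis by (simp add: norm_mult)
qed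

lemma fourier_measurable:
  assumes "integrable lborel D"
  shows "fourier D \<in> borel_measurable borel"
proof -
  have [measurable]: "D \<in> borel_measurable borel" using assms by auto
  have "(\<lambda>t. \<integral>y. D y * cis (t * y) \<partial>lborel) \<in> borel_measurable borel"
    by (rule lborel.borel_measurable_lebesgue_integral) measurable
  then show ?thesis by (simp add: fourier_def[abs_def])
qed

text \<open>The Gaussian weight makes Fubini legitimate, although \<open>fourier D\<close> is only
  known to be bounded. Integrating over t first produces a Gaussian of width \<eta>, that is, an
  average of D at scale \<eta>.\<close>

lemma gaussian_weighted_fourier:
  fixes D :: "real \<Rightarrow> complex"
  assumes D: "integrable lborel D" and \<eta>: "\<eta> > 0"
  shows "(\<integral>t. of_real (exp (- (\<eta> * t)\<^sup>2 / 2) * (norm (fourier D t))\<^sup>2) \<partial>lborel) =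
     2 * pi * (\<integral>y. D y * (\<integral>z. of_real (std_normal_density z) * cnj (D (y + \<eta> * z)) \<partial>lborel) \<partial>lborel)"
proof -
  have Dm [measurable]: "D \<in> borel_measurable borel" using D by auto
  have Fm [measurable]: "fourier D \<in> borel_measurable borel" by (rule fourier_measurable[OF D])
  define G where "G t = exp (- (\<eta> * t)\<^sup>2 / 2)" for t
  have Gm [measurable]: "G \<in> borel_measurable borel" unfolding G_def by measurable
  have Gi: "integrable lborel G" unfolding G_def by (rule gaussian_integrable[OF \<eta>])
  then have Gi': "integrable lborel (\<lambda>t. complex_of_real (G t))" by simp
  define B where "B = (\<integral>y. norm (D y) \<partial>lborel)"
  have FB: "norm (fourier D t) \<le> B" for t unfolding B_def by (rule norm_fourier_le[OF D])
  have B0: "B \<ge> 0" using FB[of 0] norm_ge_zero order_trans by blast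
  have sq: "of_real (G t * (norm (fourier D t))\<^sup>2) = (\<integral>y. D y * (of_real (G t) * cis (t * y) * cnj (fourier D t)) \<partial>lborel)" for t
  proof -
    have "of_real (G t * (norm (fourier D t))\<^sup>2) = fourier D t * (of_real (G t) * cnj (fourier D t))"
      by (simp only: of_real_mult complex_norm_square mult_ac)
    also have "fourier D t * X = (\<integral>y. D y * cis (t * y) * X \<partial>lborel)" for X
      unfolding fourier_def by simp
    finally show ?thesis by (simp add: mult_ac)
  qed
  have int1: "integrable (lborel \<Otimes>\<^sub>M lborel) (\<lambda>(y, t). D y * (of_real (G t) * cis (t * y) * cnj (fourier D t)))"
  proof (rule Bochner_Integration.integrable_bound[OF integrable_lborel_prod[OF D, of "\<lambda>t. of_real (G t * B)"]])
    show "integrable lborel (\<lambda>t. complex_of_real (G t * B))" using Gi by simp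
    show "(\<lambda>(y, t). D y * (of_real (G t) * cis (t * y) * cnj (fourier D t))) \<in> borel_measurable (lborel \<Otimes>\<^sub>M lborel)"
      by measurable
    show "AE x in lborel \<Otimes>\<^sub>M lborel. norm (case x of (y, t) \<Rightarrow> D y * (of_real (G t) * cis (t * y) * cnj (fourier D t)))
        \<le> norm (case x of (x, y) \<Rightarrow> D x * complex_of_real (G y * B))"
      by (rule AE_I2) (use FB B0 in \<open>auto simp: norm_mult G_def split_beta intro!: mult_left_mono\<close>)
  qed
  have "(\<integral>t. of_real (G t * (norm (fourier D t))\<^sup>2) \<partial>lborel) =
      (\<integral>t. (\<integral>y. D y * (of_real (G t) * cis (t * y) * cnj (fourier D t)) \<partial>lborel) \<partial>lborel)"
    by (simp only: sq)
  also have "\<dots> = (\<integral>y. (\<integral>t. D y * (of_real (G t) * cis (t * y) * cnj (fourier D t)) \<partial>lborel) \<partial>lborel)"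
    by (rule lborel_pair.Fubini_integral[OF int1])
  also have "\<dots> = (\<integral>y. D y * (2 * pi * (\<integral>z. of_real (std_normal_density z) * cnj (D (y + \<eta> * z)) \<partial>lborel)) \<partial>lborel)"
  proof (rule Bochner_Integration.integral_cong[OF refl])
    fix y :: real
    have Di: "integrable lborel (\<lambda>x. cnj (D x))" using D by simp
    have int2: "integrable (lborel \<Otimes>\<^sub>M lborel) (\<lambda>(x, t). cnj (D x) * (of_real (G t) * cis (t * (y - x))))"
    proof (rule Bochner_Integration.integrable_bound[OF integrable_lborel_prod[OF Di Gi']])
      show "(\<lambda>(x, t). cnj (D x) * (of_real (G t) * cis (t * (y - x)))) \<in> borel_measurable (lborel \<Otimes>\<^sub>M lborel)"
        by measurable
    qed (auto simp: norm_mult)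
    have "(\<integral>t. of_real (G t) * cis (t * y) * cnj (fourier D t) \<partial>lborel) =
        (\<integral>t. (\<integral>x. cnj (D x) * (of_real (G t) * cis (t * (y - x))) \<partial>lborel) \<partial>lborel)"
    proof (rule Bochner_Integration.integral_cong[OF refl])
      fix t :: real
      have "cnj (fourier D t) = (\<integral>x. cnj (D x * cis (t * x)) \<partial>lborel)"
        unfolding fourier_def
        by (rule integral_bounded_linear[OF bounded_linear_cnj integrable_mult_cis[OF D], symmetric])
      then have "of_real (G t) * cis (t * y) * cnj (fourier D t) = (\<integral>x. of_real (G t) * cis (t * y) * cnj (D x * cis (t * x)) \<partial>lborel)"
        using integrable_mult_cis[OF D, of t] by simp
      also have "\<dots> = (\<integral>x. cnj (D x) * (of_real (G t) * cis (t * (y - x))) \<partial>lborel)"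
        by (intro Bochner_Integration.integral_cong refl) (simp add: right_diff_distrib cis_divide[symmetric] cis_cnj divide_inverse cis_inverse mult_ac)
      finally show "of_real (G t) * cis (t * y) * cnj (fourier D t) = (\<integral>x. cnj (D x) * (of_real (G t) * cis (t * (y - x))) \<partial>lborel)" .
    qed
    also have "\<dots> = (\<integral>x. (\<integral>t. cnj (D x) * (of_real (G t) * cis (t * (y - x))) \<partial>lborel) \<partial>lborel)"
      by (rule lborel_pair.Fubini_integral[OF int2])
    also have "\<dots> = (\<integral>x. cnj (D x) * of_real (sqrt (2 * pi) / \<eta> * exp (- ((y - x) / \<eta>)\<^sup>2 / 2)) \<partial>lborel)"
    proof (rule Bochner_Integration.integral_cong[OF refl])
      fix x :: real
      have "(\<integral>t. of_real (G t) * cis (t * (y - x)) \<partial>lborel) = of_real (sqrt (2 * pi) / \<eta> * exp (- ((y - x) / \<eta>)\<^sup>2 / 2))"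
        unfolding G_def by (rule gaussian_fourier[OF \<eta>])
      then show "(\<integral>t. cnj (D x) * (of_real (G t) * cis (t * (y - x))) \<partial>lborel) = cnj (D x) * of_real (sqrt (2 * pi) / \<eta> * exp (- ((y - x) / \<eta>)\<^sup>2 / 2))"
        by (simp only: integral_mult_right_zero)
    qed
    \<comment> \<open>The substitution x = y + \<eta> z turns the Gaussian of width \<eta> into the
      standard normal density.\<close>
    also have "\<dots> = \<bar>\<eta>\<bar> *\<^sub>R (\<integral>z. cnj (D (y + \<eta> * z)) * of_real (sqrt (2 * pi) / \<eta> * exp (- ((y - (y + \<eta> * z)) / \<eta>)\<^sup>2 / 2)) \<partial>lborel)"
      using \<eta> by (intro lborel_integral_real_affine) auto
    also have "\<dots> = (\<integral>z. of_real \<eta> * (cnj (D (y + \<eta> * z)) * of_real (sqrt (2 * pi) / \<eta> * exp (- ((y - (y + \<eta> * z)) / \<eta>)\<^sup>2 / 2))) \<partial>lborel)"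
      using \<eta> by (simp add: scaleR_conv_of_real)
    also have "\<dots> = (\<integral>z. 2 * pi * (of_real (std_normal_density z) * cnj (D (y + \<eta> * z))) \<partial>lborel)"
    proof (intro Bochner_Integration.integral_cong refl)
      fix z :: real
      have "\<eta> * (sqrt (2 * pi) / \<eta> * exp (- ((y - (y + \<eta> * z)) / \<eta>)\<^sup>2 / 2)) = 2 * pi * std_normal_density z"
        using \<eta> real_sqrt_mult_self[of "2 * pi"] by (simp add: std_normal_density_def field_simps)
      then have e: "of_real \<eta> * of_real (sqrt (2 * pi) / \<eta> * exp (- ((y - (y + \<eta> * z)) / \<eta>)\<^sup>2 / 2)) =
          complex_of_real (2 * pi) * of_real (std_normal_density z)"
        by (simp only: of_real_mult[symmetric])
      show "of_real \<eta> * (cnj (D (y + \<eta> * z)) * of_real (sqrt (2 * pi) / \<eta> * exp (- ((y - (y + \<eta> * z)) / \<eta>)\<^sup>2 / 2))) =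
          2 * pi * (of_real (std_normal_density z) * cnj (D (y + \<eta> * z)))"
        by (subst mult.left_commute, subst e) (simp only: mult_ac)
    qed
    also have "\<dots> = 2 * pi * (\<integral>z. of_real (std_normal_density z) * cnj (D (y + \<eta> * z)) \<partial>lborel)"
      by (rule integral_mult_right_zero)
    finally show "(\<integral>t. D y * (of_real (G t) * cis (t * y) * cnj (fourier D t)) \<partial>lborel) =
        D y * (2 * pi * (\<integral>z. of_real (std_normal_density z) * cnj (D (y + \<eta> * z)) \<partial>lborel))"
      by (simp only: integral_mult_right_zero)
  qed
  also have "\<dots> = (\<integral>y. 2 * pi * (D y * (\<integral>z. of_real (std_normal_density z) * cnj (D (y + \<eta> * z)) \<partial>lborel)) \<partial>lborel)"
    by (simp add: mult_ac)
  also have "\<dots> = 2 * pi * (\<integral>y. D y * (\<integral>z. of_real (std_normal_density z) * cnj (D (y + \<eta> * z)) \<partial>lborel) \<partial>lborel)"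
    by (rule integral_mult_right_zero)
  finally show ?thesis by (simp only: G_def)
qed

text \<open>Let \<eta> tend to 0 in \<open>gaussian_weighted_fourier\<close>. The averages of D
  converge to D by continuity, with majorant from the bound C, while the Gaussian weights are at
  most 1. The norm of a function is thus bounded by that of its transform, the direction used to
  estimate a distance in L2.\<close>

theorem plancherel_le:
  fixes D :: "real \<Rightarrow> complex"
  assumes cont: "continuous_on UNIV D" and D: "integrable lborel D" and bound: "\<And>y. norm (D y) \<le> C"
  shows "ennreal (2 * pi) * (\<integral>\<^sup>+ y. ennreal ((norm (D y))\<^sup>2) \<partial>lborel) \<le> (\<integral>\<^sup>+ t. ennreal ((norm (fourier D t))\<^sup>2) \<partial>lborel)"
proof -
  have Dm [measurable]: "D \<in> borel_measurable borel" using D by auto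
  have Fm [measurable]: "fourier D \<in> borel_measurable borel" by (rule fourier_measurable[OF D])
  have C0: "C \<ge> 0" using bound[of 0] norm_ge_zero order_trans by blast
  define \<eta> where "\<eta> k = inverse (real (Suc k))" for k
  have \<eta>: "\<eta> k > 0" for k by (simp add: \<eta>_def)
  have \<eta>0: "\<eta> \<longlonglongrightarrow> 0" unfolding \<eta>_def by (rule LIMSEQ_inverse_real_of_nat)
  define K where "K k y = (\<integral>z. of_real (std_normal_density z) * cnj (D (y + \<eta> k * z)) \<partial>lborel)" for k y
  have Km [measurable]: "K k \<in> borel_measurable borel" for k
  proof -
    have "(\<lambda>y. \<integral>z. of_real (std_normal_density z) * cnj (D (y + \<eta> k * z)) \<partial>lborel) \<in> borel_measurable borel"
      by (rule lborel.borel_measurable_lebesgue_integral) measurable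
    then show ?thesis by (simp add: K_def[abs_def])
  qed
  have Nint: "integrable lborel std_normal_density" "(\<integral>z. std_normal_density z \<partial>lborel) = 1" by simp_all
  have Kb: "norm (K k y) \<le> C" for k y
  proof -
    have "norm (K k y) \<le> (\<integral>z. norm (of_real (std_normal_density z) * cnj (D (y + \<eta> k * z))) \<partial>lborel)"
      unfolding K_def by (rule integral_norm_bound)
    also have "\<dots> \<le> (\<integral>z. std_normal_density z * C \<partial>lborel)"
      by (rule integral_mono') (use bound C0 in \<open>auto simp: norm_mult intro!: mult_left_mono\<close>)
    finally have "norm (K k y) \<le> (\<integral>z. std_normal_density z * C \<partial>lborel)" .
    then show ?thesis using Nint by simp
  qed
  have Klim: "(\<lambda>k. K k y) \<longlonglongrightarrow> cnj (D y)" for y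
  proof -
    have "(\<lambda>k. K k y) \<longlonglongrightarrow> (\<integral>z. of_real (std_normal_density z) * cnj (D y) \<partial>lborel)"
      unfolding K_def
    proof (rule integral_dominated_convergence[where w = "\<lambda>z. std_normal_density z * C"])
      show "AE z in lborel. (\<lambda>k. of_real (std_normal_density z) * cnj (D (y + \<eta> k * z))) \<longlonglongrightarrow> of_real (std_normal_density z) * cnj (D y)"
      proof (rule AE_I2)
        fix z :: real
        have "(\<lambda>k. y + \<eta> k * z) \<longlonglongrightarrow> y + 0 * z" by (intro tendsto_intros \<eta>0)
        moreover have "isCont D y" using cont by (simp add: continuous_on_eq_continuous_at)
        ultimately have "(\<lambda>k. D (y + \<eta> k * z)) \<longlonglongrightarrow> D y" by (intro isCont_tendsto_compose[of y D]) auto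
        then show "(\<lambda>k. of_real (std_normal_density z) * cnj (D (y + \<eta> k * z))) \<longlonglongrightarrow> of_real (std_normal_density z) * cnj (D y)"
          by (intro tendsto_intros)
      qed
    qed (use bound in \<open>auto simp: norm_mult intro!: mult_left_mono\<close>)
    also have "(\<integral>z. of_real (std_normal_density z) * cnj (D y) \<partial>lborel) = cnj (D y)"
      using Nint by (simp add: integral_complex_of_real)
    finally show ?thesis .
  qed
  have sq_int: "integrable lborel (\<lambda>y. (norm (D y))\<^sup>2)"
  proof (rule Bochner_Integration.integrable_bound[of lborel "\<lambda>y. C * norm (D y)"])
    show "AE y in lborel. norm ((norm (D y))\<^sup>2) \<le> norm (C * norm (D y))"
      using bound C0 by (auto simp: power2_eq_square intro!: mult_right_mono)
  qed (use D in auto)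
  have "(\<lambda>k. \<integral>y. D y * K k y \<partial>lborel) \<longlonglongrightarrow> (\<integral>y. D y * cnj (D y) \<partial>lborel)"
  proof (rule integral_dominated_convergence[where w = "\<lambda>y. norm (D y) * C"])
    show "AE y in lborel. (\<lambda>k. D y * K k y) \<longlonglongrightarrow> D y * cnj (D y)"
      by (intro AE_I2 tendsto_intros Klim)
  qed (use Kb D in \<open>auto simp: norm_mult intro!: mult_left_mono\<close>)
  also have "(\<integral>y. D y * cnj (D y) \<partial>lborel) = of_real (\<integral>y. (norm (D y))\<^sup>2 \<partial>lborel)"
    by (simp only: complex_norm_square[symmetric] integral_complex_of_real)
  finally have lim: "(\<lambda>k. 2 * pi * (\<integral>y. D y * K k y \<partial>lborel)) \<longlonglongrightarrow> complex_of_real (2 * pi) * of_real (\<integral>y. (norm (D y))\<^sup>2 \<partial>lborel)"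
    by (rule tendsto_mult_left)
  define A where "A k = (\<integral>t. exp (- (\<eta> k * t)\<^sup>2 / 2) * (norm (fourier D t))\<^sup>2 \<partial>lborel)" for k
  have Aeq: "2 * pi * (\<integral>y. D y * K k y \<partial>lborel) = of_real (A k)" for k
    using gaussian_weighted_fourier[OF D \<eta>[of k]] unfolding K_def A_def integral_complex_of_real by simp
  have "(\<lambda>k. complex_of_real (A k)) \<longlonglongrightarrow> of_real (2 * pi * (\<integral>y. (norm (D y))\<^sup>2 \<partial>lborel))"
    using lim unfolding Aeq by simp
  then have Alim: "A \<longlonglongrightarrow> 2 * pi * (\<integral>y. (norm (D y))\<^sup>2 \<partial>lborel)"
    by (simp only: tendsto_of_real_iff)
  have Ale: "ennreal (A k) \<le> (\<integral>\<^sup>+ t. ennreal ((norm (fourier D t))\<^sup>2) \<partial>lborel)" for k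
  proof -
    \<comment> \<open>If the integrand were not integrable, the Bochner integral would be 0 by
      convention, so the inequality holds in both cases.\<close>
    have "ennreal (A k) \<le> (\<integral>\<^sup>+ t. ennreal (exp (- (\<eta> k * t)\<^sup>2 / 2) * (norm (fourier D t))\<^sup>2) \<partial>lborel)"
      unfolding A_def
      by (cases "integrable lborel (\<lambda>t. exp (- (\<eta> k * t)\<^sup>2 / 2) * (norm (fourier D t))\<^sup>2)")
         (simp_all add: nn_integral_eq_integral not_integrable_integral_eq)
    also have "\<dots> \<le> (\<integral>\<^sup>+ t. ennreal ((norm (fourier D t))\<^sup>2) \<partial>lborel)"
      by (intro nn_integral_mono ennreal_leI) (simp add: mult_left_le_one_le)
    finally show ?thesis .
  qed
  have "ennreal (2 * pi * (\<integral>y. (norm (D y))\<^sup>2 \<partial>lborel)) \<le> (\<integral>\<^sup>+ t. ennreal ((norm (fourier D t))\<^sup>2) \<partial>lborel)"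
    by (rule LIMSEQ_le_const2[OF tendsto_ennrealI[OF Alim]]) (use Ale in auto)
  moreover have "ennreal (2 * pi * (\<integral>y. (norm (D y))\<^sup>2 \<partial>lborel)) = ennreal (2 * pi) * (\<integral>\<^sup>+ y. ennreal ((norm (D y))\<^sup>2) \<partial>lborel)"
    using sq_int by (simp add: ennreal_mult' nn_integral_eq_integral)
  ultimately show ?thesis by simp
qed

section \<open>Mellin transforms on the critical line\<close>

text \<open>The substitution is made on [-n, n]; both sides then increase to the integrals over the
  full ranges.\<close>

lemma nn_integral_exp_substitution:
  fixes f :: "real \<Rightarrow> real"
  assumes [measurable]: "f \<in> borel_measurable borel" and nonneg: "\<And>x. f x \<ge> 0"
  shows "(\<integral>\<^sup>+ x. ennreal (f x) * indicator {0<..} x \<partial>lborel) = (\<integral>\<^sup>+ y. ennreal (f (exp y) * exp y) \<partial>lborel)"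
proof -
  have step: "(\<integral>\<^sup>+ x. ennreal (f x) * indicator {exp (- real n)..exp (real n)} x \<partial>lborel) =
      (\<integral>\<^sup>+ y. ennreal (f (exp y) * exp y) * indicator {- real n..real n} y \<partial>lborel)" for n
    using nn_integral_substitution[of exp "- real n" "real n" f exp]
    by (simp add: set_borel_measurable_def continuous_intros nn_integral_set_ennreal)
  have 1: "(\<lambda>n. \<integral>\<^sup>+ x. ennreal (f x) * indicator {exp (- real n)..exp (real n)} x \<partial>lborel) \<longlonglongrightarrow>
      (\<integral>\<^sup>+ x. ennreal (f x) * indicator {0<..} x \<partial>lborel)"
  proof (rule nn_integral_LIMSEQ)
    show "incseq (\<lambda>n x. ennreal (f x) * indicator {exp (- real n)..exp (real n)} x)"
      by (intro monoI le_funI mult_left_mono) (auto split: split_indicator intro: order_trans,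
          meson exp_le_cancel_iff neg_le_iff_le of_nat_le_iff order_trans)
    fix x :: real
    show "(\<lambda>n. ennreal (f x) * indicator {exp (- real n)..exp (real n)} x) \<longlonglongrightarrow> ennreal (f x) * indicator {0<..} x"
    proof (rule tendsto_eventually, cases "x > 0")
      case True
      obtain m :: nat where m: "\<bar>ln x\<bar> \<le> real m" using real_arch_simple by blast
      show "\<forall>\<^sub>F n in sequentially. ennreal (f x) * indicator {exp (- real n)..exp (real n)} x = ennreal (f x) * indicator {0<..} x"
        using eventually_ge_at_top[of m]
      proof eventually_elim
        case (elim n)
        then have "- real n \<le> ln x" "ln x \<le> real n" using m by auto
        then have "exp (- real n) \<le> x" "x \<le> exp (real n)" using True by (metis exp_le_cancel_iff exp_ln)+
        then show ?case using True by simp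
      qed
    next
      case False
      have "\<not> exp (- real n) \<le> x" for n using False exp_gt_zero[of "- real n"] by linarith
      then show "\<forall>\<^sub>F n in sequentially. ennreal (f x) * indicator {exp (- real n)..exp (real n)} x = ennreal (f x) * indicator {0<..} x"
        using False by simp
    qed
  qed measurable
  have 2: "(\<lambda>n. \<integral>\<^sup>+ y. ennreal (f (exp y) * exp y) * indicator {- real n..real n} y \<partial>lborel) \<longlonglongrightarrow>
      (\<integral>\<^sup>+ y. ennreal (f (exp y) * exp y) \<partial>lborel)"
  proof (rule nn_integral_LIMSEQ)
    show "incseq (\<lambda>n y. ennreal (f (exp y) * exp y) * indicator {- real n..real n} y)"
      by (intro monoI le_funI mult_left_mono) (auto split: split_indicator)
    fix y :: real
    obtain m :: nat where m: "\<bar>y\<bar> \<le> real m" using real_arch_simple by blast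
    show "(\<lambda>n. ennreal (f (exp y) * exp y) * indicator {- real n..real n} y) \<longlonglongrightarrow> ennreal (f (exp y) * exp y)"
    proof (rule tendsto_eventually, use eventually_ge_at_top[of m] in eventually_elim)
      case (elim n)
      then have "- real n \<le> y" "y \<le> real n" using m by auto
      then show ?case by simp
    qed
  qed measurable
  show ?thesis by (rule LIMSEQ_unique[OF 1 2[folded step]])
qed

lemma exp_substitution_integrable:
  fixes h :: "real \<Rightarrow> complex"
  assumes "set_integrable lborel {0<..} h"
  shows "integrable lborel (\<lambda>y. of_real (exp y) * h (exp y))"
proof -
  define k where "k x = indicator {0<..} x *\<^sub>R h x" for x
  have k: "integrable lborel k" using assms by (simp add: set_integrable_def k_def[abs_def])
  then have [measurable]: "k \<in> borel_measurable borel" by auto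
  have eq: "of_real (exp y) * h (exp y) = of_real (exp y) * k (exp y)" for y by (simp add: k_def)
  have "(\<integral>\<^sup>+ y. ennreal (norm (of_real (exp y) * k (exp y))) \<partial>lborel) = (\<integral>\<^sup>+ x. ennreal (norm (k x)) * indicator {0<..} x \<partial>lborel)"
    using nn_integral_exp_substitution[of "\<lambda>x. norm (k x)"] by (simp add: norm_mult mult.commute)
  also have "\<dots> \<le> (\<integral>\<^sup>+ x. ennreal (norm (k x)) \<partial>lborel)" by (intro nn_integral_mono) (auto split: split_indicator)
  also have "\<dots> < \<infinity>" using k by (simp add: integrable_iff_bounded)
  finally show ?thesis unfolding eq by (intro integrableI_bounded) auto
qed

text \<open>The growth condition is g(x) = O(min(1, 1/x)). It makes x^(1/2) g(x) decay exponentially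
  in ln x in both directions, so the Mellin integral converges absolutely on Re s = 1/2.\<close>

definition tame :: "(real \<Rightarrow> complex) \<Rightarrow> bool" where
  "tame g \<longleftrightarrow> continuous_on {0<..} g \<and> (\<exists>C. \<forall>x>0. norm (g x) \<le> C \<and> x * norm (g x) \<le> C)"

lemma tameI:
  assumes "continuous_on {0<..} g" "\<And>x. x > 0 \<Longrightarrow> norm (g x) \<le> A" "\<And>x. x > 0 \<Longrightarrow> x * norm (g x) \<le> B"
  shows "tame g"
  unfolding tame_def using assms by (auto intro!: exI[of _ "max A B"] simp: le_max_iff_disj)

lemma tame_0: "tame (\<lambda>x. 0)"
  by (rule tameI[of _ 0 0]) auto

lemma tame_add:
  assumes "tame g" "tame h"
  shows "tame (\<lambda>x. g x + h x)"
proof -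
  obtain A where A: "\<And>x. x > 0 \<Longrightarrow> norm (g x) \<le> A \<and> x * norm (g x) \<le> A" using assms(1) by (auto simp: tame_def)
  obtain B where B: "\<And>x. x > 0 \<Longrightarrow> norm (h x) \<le> B \<and> x * norm (h x) \<le> B" using assms(2) by (auto simp: tame_def)
  show ?thesis
  proof (rule tameI[of _ "A + B" "A + B"])
    fix x :: real assume x: "x > 0"
    show "norm (g x + h x) \<le> A + B" using A[OF x] B[OF x] by (intro norm_triangle_le) auto
    have "x * norm (g x + h x) \<le> x * (norm (g x) + norm (h x))" using x by (intro mult_left_mono norm_triangle_ineq) auto
    then show "x * norm (g x + h x) \<le> A + B" using A[OF x] B[OF x] by (simp add: distrib_left)
  qed (use assms in \<open>auto simp: tame_def intro!: continuous_intros\<close>)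
qed

lemma tame_cmult:
  assumes "tame g"
  shows "tame (\<lambda>x. c * g x)"
proof -
  obtain A where A: "\<And>x. x > 0 \<Longrightarrow> norm (g x) \<le> A \<and> x * norm (g x) \<le> A" using assms(1) by (auto simp: tame_def)
  show ?thesis
  proof (rule tameI[of _ "norm c * A" "norm c * A"])
    fix x :: real assume x: "x > 0"
    show "norm (c * g x) \<le> norm c * A" "x * norm (c * g x) \<le> norm c * A"
      using A[OF x] mult_left_mono[of "x * norm (g x)" A "norm c"] mult_left_mono[of "norm (g x)" A "norm c"]
      by (auto simp: norm_mult mult_ac)
  qed (use assms in \<open>auto simp: tame_def intro!: continuous_intros\<close>)
qed

lemma tame_sum: "(\<And>i. i \<in> I \<Longrightarrow> tame (g i)) \<Longrightarrow> tame (\<lambda>x. \<Sum>i\<in>I. g i x)"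
  by (induction I rule: infinite_finite_induct) (auto intro: tame_0 tame_add)

lemma tame_dilation:
  assumes "tame g" and n: "n > 0"
  shows "tame (dilation n g)"
proof -
  obtain A where A: "\<And>x. x > 0 \<Longrightarrow> norm (g x) \<le> A \<and> x * norm (g x) \<le> A" using assms(1) by (auto simp: tame_def)
  show ?thesis
  proof (rule tameI[of _ A "A / n"])
    have "continuous_on {0<..} g" using assms by (simp add: tame_def)
    then have "continuous_on {0<..} (\<lambda>x. g (n * x))"
      by (rule continuous_on_compose2) (use n in \<open>auto intro!: continuous_intros\<close>)
    then show "continuous_on {0<..} (dilation n g)" by (simp add: dilation_def[abs_def])
    fix x :: real assume x: "x > 0"
    show "norm (dilation n g x) \<le> A" using A[of "n * x"] x n by (simp add: dilation_def)
    show "x * norm (dilation n g x) \<le> A / n" using A[of "n * x"] x n by (simp add: dilation_def field_simps)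
  qed
qed

text \<open>The factor exp(y / 2) makes this an isometry from L2(0, infinity) to L2 of the
  line.\<close>

definition log_pullback :: "(real \<Rightarrow> complex) \<Rightarrow> real \<Rightarrow> complex" where
  "log_pullback g y = of_real (exp (y / 2)) * g (exp y)"

text \<open>The value at t is the integral of g(x) x^(s - 1) over (0, infinity) at s = 1/2 +
  it.\<close>

definition mellin :: "(real \<Rightarrow> complex) \<Rightarrow> real \<Rightarrow> complex" where
  "mellin g = fourier (log_pullback g)"

text \<open>For y \<ge> 0 the bound on x |g(x)| is used, as x^(1/2) = x^(-1/2) x; for y < 0 the
  bound on |g(x)|.\<close>

lemma log_pullback_bound:
  assumes "x = exp y" "norm (g x) \<le> C" "x * norm (g x) \<le> C"
  shows "norm (log_pullback g y) \<le> C * exp (- \<bar>y\<bar> / 2)"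
proof (cases "y \<ge> 0")
  case True
  have "norm (log_pullback g y) = exp (- y / 2) * (exp y * norm (g x))"
    using assms(1) by (simp add: log_pullback_def norm_mult exp_add[symmetric] flip: mult.assoc)
  also have "\<dots> \<le> exp (- y / 2) * C" using assms by (intro mult_left_mono) auto
  finally show ?thesis using True by (simp add: mult.commute)
next
  case False
  have "norm (log_pullback g y) \<le> exp (y / 2) * C"
    using assms unfolding log_pullback_def norm_mult by (intro mult_mono) auto
  then show ?thesis using False by (simp add: mult.commute)
qed

lemma tame_pullback_bound:
  assumes "tame g"
  obtains C where "C \<ge> 0" "\<And>y. norm (log_pullback g y) \<le> C * exp (- \<bar>y\<bar> / 2)"
proof -
  obtain C where C: "\<And>x. x > 0 \<Longrightarrow> norm (g x) \<le> C \<and> x * norm (g x) \<le> C" using assms by (auto simp: tame_def)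
  show ?thesis
  proof (rule that[of C])
    show "C \<ge> 0" using C[of 1] norm_ge_zero[of "g 1"] by linarith
    show "norm (log_pullback g y) \<le> C * exp (- \<bar>y\<bar> / 2)" for y
      by (rule log_pullback_bound[OF refl]) (use C in auto)
  qed
qed

lemma integrable_exp_abs: "integrable lborel (\<lambda>y::real. exp (- \<bar>y\<bar> / 2))"
proof (rule integrableI_bounded)
  have half: "(\<integral>\<^sup>+ t. ennreal (exp (- t / 2)) * indicator {0..} t \<partial>lborel) = ennreal (0 - (- 2 * exp (- 0 / 2)))"
  proof (rule nn_integral_FTC_atLeast)
    fix x :: real
    show "((\<lambda>t. - 2 * exp (- t / 2)) has_real_derivative exp (- x / 2)) (at x)"
      by (auto intro!: derivative_eq_intros)
  next
    show "((\<lambda>t::real. - 2 * exp (- t / 2)) \<longlongrightarrow> 0) at_top" by real_asymp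
  qed auto
  have "(\<integral>\<^sup>+ y. ennreal (norm (exp (- \<bar>y :: real\<bar> / 2))) \<partial>lborel) \<le> 2 * (\<integral>\<^sup>+ t. ennreal (exp (- t / 2)) * indicator {0..} t \<partial>lborel)"
    using nn_integral_abs_le[of "\<lambda>t. ennreal (exp (- t / 2))"] by simp
  also have "\<dots> < \<infinity>" unfolding half by (simp add: ennreal_mult_less_top)
  finally show "(\<integral>\<^sup>+ y. ennreal (norm (exp (- \<bar>y :: real\<bar> / 2))) \<partial>lborel) < \<infinity>" .
qed measurable

lemma continuous_log_pullback:
  assumes "continuous_on {0<..} g"
  shows "continuous_on UNIV (log_pullback g)"
  unfolding log_pullback_def
  by (intro continuous_intros continuous_on_compose2[OF assms]) auto

lemma integrable_log_pullback:
  assumes "tame g"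
  shows "integrable lborel (log_pullback g)"
proof -
  obtain C where C: "C \<ge> 0" "\<And>y. norm (log_pullback g y) \<le> C * exp (- \<bar>y\<bar> / 2)" using tame_pullback_bound[OF assms] by blast
  show ?thesis
  proof (rule Bochner_Integration.integrable_bound)
    show "integrable lborel (\<lambda>y. C * exp (- \<bar>y\<bar> / 2))" using integrable_exp_abs by simp
    show "log_pullback g \<in> borel_measurable lborel"
      using continuous_log_pullback[of g] assms by (simp add: tame_def borel_measurable_continuous_onI)
  qed (use C in auto)
qed

lemma mellin_add:
  assumes "tame g" "tame h"
  shows "mellin (\<lambda>x. g x + h x) t = mellin g t + mellin h t"
proof -
  have "mellin (\<lambda>x. g x + h x) t = (\<integral>y. log_pullback g y * cis (t * y) + log_pullback h y * cis (t * y) \<partial>lborel)"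
    by (simp add: mellin_def fourier_def log_pullback_def algebra_simps)
  then show ?thesis
    using integrable_mult_cis[OF integrable_log_pullback[OF assms(1)], of t] integrable_mult_cis[OF integrable_log_pullback[OF assms(2)], of t]
    by (simp add: mellin_def fourier_def)
qed

lemma mellin_cmult: "mellin (\<lambda>x. c * g x) t = c * mellin g t"
proof -
  have "mellin (\<lambda>x. c * g x) t = (\<integral>y. c * (log_pullback g y * cis (t * y)) \<partial>lborel)"
    by (simp add: mellin_def fourier_def log_pullback_def mult_ac)
  then show ?thesis by (simp add: mellin_def fourier_def)
qed

lemma mellin_sum: "(\<And>i. i \<in> I \<Longrightarrow> tame (g i)) \<Longrightarrow> mellin (\<lambda>x. \<Sum>i\<in>I. g i x) t = (\<Sum>i\<in>I. mellin (g i) t)"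
proof (induction I rule: infinite_finite_induct)
  case (insert i I)
  then show ?case by (simp add: mellin_add tame_sum)
qed (simp_all add: mellin_def fourier_def log_pullback_def)

text \<open>Dilation by n translates the pullback by ln n, up to the factor n^(-1/2).\<close>

lemma mellin_dilation:
  assumes n: "n > 0"
  shows "mellin (dilation (real n) g) t = of_nat n powr (- Complex (1/2) t) * mellin g t"
proof -
  define l where "l = ln (real n)"
  have el: "exp l = real n" using n by (simp add: l_def)
  have pw: "of_nat n powr (- Complex (1/2) t) = of_real (exp (- l / 2)) * cis (- t * l)"
  proof -
    have "of_nat n powr (- Complex (1/2) t) = exp (- Complex (1/2) t * of_real l)"
      using n by (simp add: powr_def Ln_of_nat_pos l_def)
    also have "- Complex (1/2) t * of_real l = Complex (- l / 2) (- t * l)" by (simp add: complex_eq_iff)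
    finally show ?thesis by (simp add: exp_eq_polar)
  qed
  have "mellin g t = (\<integral>y. log_pullback g (l + 1 * y) * cis (t * (l + 1 * y)) \<partial>lborel)"
    unfolding mellin_def fourier_def
    by (subst lborel_integral_real_affine[of 1 _ l]) auto
  then have "of_nat n powr (- Complex (1/2) t) * mellin g t =
      (\<integral>y. of_real (exp (- l / 2)) * cis (- t * l) * (log_pullback g (l + 1 * y) * cis (t * (l + 1 * y))) \<partial>lborel)"
    by (simp add: pw)
  also have "\<dots> = mellin (dilation (real n) g) t"
    unfolding mellin_def fourier_def
  proof (intro Bochner_Integration.integral_cong refl)
    fix y :: real
    have 1: "cis (- t * l) * cis (t * (l + 1 * y)) = cis (t * y)" by (simp add: cis_mult algebra_simps)
    have 2: "complex_of_real (exp (- l / 2)) * of_real (exp ((l + 1 * y) / 2)) = of_real (exp (y / 2))"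
      by (simp flip: of_real_mult exp_add add: add_divide_distrib)
    have "of_real (exp (- l / 2)) * cis (- t * l) * (log_pullback g (l + 1 * y) * cis (t * (l + 1 * y))) =
        (of_real (exp (- l / 2)) * of_real (exp ((l + 1 * y) / 2))) * g (exp (l + 1 * y)) * (cis (- t * l) * cis (t * (l + 1 * y)))"
      by (simp only: log_pullback_def mult_ac)
    also have "\<dots> = log_pullback (dilation (real n) g) y * cis (t * y)"
      unfolding 1 2 by (simp add: log_pullback_def dilation_def exp_add el)
    finally show "of_real (exp (- l / 2)) * cis (- t * l) * (log_pullback g (l + 1 * y) * cis (t * (l + 1 * y))) =
        log_pullback (dilation (real n) g) y * cis (t * y)" .
  qed
  finally show ?thesis by simp
qed

lemma mellin_plancherel_le:
  assumes "tame g"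
  shows "ennreal (2 * pi) * (\<integral>\<^sup>+x\<in>{0<..}. ennreal ((norm (g x))\<^sup>2) \<partial>lborel) \<le> (\<integral>\<^sup>+ t. ennreal ((norm (mellin g t))\<^sup>2) \<partial>lborel)"
proof -
  obtain C where C: "C \<ge> 0" "\<And>y. norm (log_pullback g y) \<le> C * exp (- \<bar>y\<bar> / 2)" using tame_pullback_bound[OF assms] by blast
  have bound: "norm (log_pullback g y) \<le> C" for y
    using C(2)[of y] mult_left_mono[of "exp (- \<bar>y\<bar> / 2)" 1 C] C(1) by simp
  \<comment> \<open>Tameness says nothing about g outside (0, infinity); cutting it off there gives
    a measurable function on the whole line.\<close>
  define G where "G x = indicator {0<..} x *\<^sub>R g x" for x
  define k where "k x = (norm (G x))\<^sup>2" for x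
  have [measurable]: "G \<in> borel_measurable borel"
    unfolding G_def using assms by (intro borel_measurable_continuous_on_indicator) (auto simp: tame_def)
  have [measurable]: "k \<in> borel_measurable borel" unfolding k_def by measurable
  have "(\<integral>\<^sup>+x\<in>{0<..}. ennreal ((norm (g x))\<^sup>2) \<partial>lborel) = (\<integral>\<^sup>+ x. ennreal (k x) * indicator {0<..} x \<partial>lborel)"
    by (intro nn_integral_cong) (auto simp: k_def G_def split: split_indicator)
  also have "\<dots> = (\<integral>\<^sup>+ y. ennreal (k (exp y) * exp y) \<partial>lborel)"
    by (rule nn_integral_exp_substitution) (auto simp: k_def)
  also have "\<dots> = (\<integral>\<^sup>+ y. ennreal ((norm (log_pullback g y))\<^sup>2) \<partial>lborel)"
  proof (intro nn_integral_cong arg_cong[of _ _ ennreal])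
    fix y :: real
    have "(exp (y / 2))\<^sup>2 = exp y" by (simp add: power2_eq_square flip: exp_add)
    then show "k (exp y) * exp y = (norm (log_pullback g y))\<^sup>2"
      by (simp add: k_def G_def log_pullback_def norm_mult power_mult_distrib mult.commute)
  qed
  finally show ?thesis
    using plancherel_le[OF continuous_log_pullback integrable_log_pullback[OF assms] bound] assms
    by (simp add: mellin_def tame_def)
qed

section \<open>The Mellin transform of a good kernel\<close>

text \<open>A witness f' of \<open>good_kernel\<close> is fixed, so that the variation of f can be
  expressed by it.\<close>

locale good_kernel_derivative =
  fixes f f' :: "real \<Rightarrow> complex"
  assumes deriv: "\<And>x. x \<ge> 0 \<Longrightarrow> (f has_vector_derivative f' x) (at x within {0..})"
    and cont': "continuous_on {0..} f'"
    and lim: "(f \<longlongrightarrow> 0) at_top"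
    and int_f: "set_integrable lborel {0..} f"
    and int_f': "set_integrable lborel {0..} (\<lambda>t. t * norm (f' t))"
begin

definition h :: "real \<Rightarrow> real" where
  "h t = indicator {0..} t * norm (f' t)"

text \<open>The total variation of f on [x, infinity). It decreases in x and, since f tends to 0,
  majorises |f(x)|; all bounds for f, for Pf and for alternating sums are expressed by it.\<close>

definition W :: "real \<Rightarrow> real" where
  "W x = (\<integral>t. h t * indicator {x..} t \<partial>lborel)"

definition J :: real where
  "J = (\<integral>t. t * h t \<partial>lborel)"

lemma cont: "continuous_on {0..} f"
  using deriv by (auto simp: continuous_on_eq_continuous_within intro: has_vector_derivative_continuous)

lemma h_nonneg: "h t \<ge> 0" by (simp add: h_def)

lemma h_measurable [measurable]: "h \<in> borel_measurable borel"
  unfolding h_def using borel_measurable_continuous_on_indicator[of "{0..}" "\<lambda>t. norm (f' t)"] cont'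
  by (simp add: continuous_intros)

lemma th_integrable: "integrable lborel (\<lambda>t. t * h t)"
  using int_f' by (simp add: set_integrable_def h_def mult_ac)

text \<open>On [0, 1] the derivative is continuous; beyond 1 it is dominated by t |f'(t)|.\<close>

lemma h_integrable: "integrable lborel h"
proof (rule Bochner_Integration.integrable_bound)
  have "set_integrable lborel {0..1} (\<lambda>t. norm (f' t))"
    using cont' by (intro borel_integrable_atLeastAtMost' continuous_intros) (auto intro: continuous_on_subset)
  then show "integrable lborel (\<lambda>t. indicator {0..1} t * norm (f' t) + t * h t)"
    using th_integrable by (simp add: set_integrable_def)
  show "AE t in lborel. norm (h t) \<le> norm (indicator {0..1} t * norm (f' t) + t * h t)"
  proof (rule AE_I2)
    fix t :: real
    show "norm (h t) \<le> norm (indicator {0..1} t * norm (f' t) + t * h t)"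
    proof (cases "t < 1")
      case True
      then show ?thesis by (auto simp: h_def split: split_indicator)
    next
      case False
      then have "h t \<le> t * h t" using h_nonneg[of t] mult_right_mono[of 1 t "h t"] by simp
      then show ?thesis using h_nonneg[of t] False by (auto split: split_indicator)
    qed
  qed
qed measurable

lemma h_ind_integrable: "A \<in> sets borel \<Longrightarrow> integrable lborel (\<lambda>t. h t * indicator A t)"
  using integrable_mult_indicator[OF _ h_integrable, of A] by (simp add: mult.commute)

lemma W_nonneg: "W x \<ge> 0"
  unfolding W_def by (intro integral_nonneg_AE) (auto simp: h_nonneg)

lemma W_antimono: "x \<le> y \<Longrightarrow> W y \<le> W x"
  unfolding W_def by (intro integral_mono h_ind_integrable) (auto simp: h_nonneg split: split_indicator)

lemma W_mult_le: "x > 0 \<Longrightarrow> x * W x \<le> J"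
proof -
  assume x: "x > 0"
  have "x * W x = (\<integral>t. x * (h t * indicator {x..} t) \<partial>lborel)" by (simp add: W_def)
  also have "\<dots> \<le> J"
    unfolding J_def
  proof (rule integral_mono)
    show "integrable lborel (\<lambda>t. x * (h t * indicator {x..} t))" using h_ind_integrable by simp
    show "x * (h t * indicator {x..} t) \<le> t * h t" for t
      using x h_nonneg[of t] by (cases "t \<ge> 0") (auto split: split_indicator intro: mult_right_mono simp: h_def)
  qed (rule th_integrable)
  finally show ?thesis .
qed

text \<open>The sum counts multiples of x that do not exceed t, and there are at most t / x of
  them.\<close>

lemma sum_indicator_le:
  fixes x t :: real
  assumes "x > 0" "t \<ge> 0"
  shows "(\<Sum>n<N. indicator {real (Suc n) * x..} t) * x \<le> t"
proof (induction N)
  case (Suc N)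
  show ?case
  proof (cases "real (Suc N) * x \<le> t")
    case True
    have "(\<Sum>n<Suc N. indicator {real (Suc n) * x..} t :: real) \<le> (\<Sum>n<Suc N. 1)" by (intro sum_mono) (auto split: split_indicator)
    then have "(\<Sum>n<Suc N. indicator {real (Suc n) * x..} t) * x \<le> real (Suc N) * x"
      using assms by (intro mult_right_mono) auto
    then show ?thesis using True by linarith
  next
    case False
    then show ?thesis using Suc by simp
  qed
qed (use assms in simp)

text \<open>After exchanging sum and integral, |f'(t)| is weighted by the number of multiples of x
  below t, at most t / x. This is where the integrability of t |f'(t)| yields the convergence of the
  series in Pf.\<close>

lemma W_sum_le:
  assumes x: "x > 0"
  shows "(\<Sum>n<N. W (real (Suc n) * x)) \<le> J / x"
proof -
  have "(\<Sum>n<N. W (real (Suc n) * x)) * x = (\<integral>t. (\<Sum>n<N. h t * indicator {real (Suc n) * x..} t) * x \<partial>lborel)"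
    unfolding W_def by (subst integral_mult_left_zero, subst Bochner_Integration.integral_sum) (auto intro: h_ind_integrable)
  also have "\<dots> \<le> J"
    unfolding J_def
  proof (rule integral_mono)
    show "integrable lborel (\<lambda>t. (\<Sum>n<N. h t * indicator {real (Suc n) * x..} t) * x)"
      by (intro integrable_mult_left Bochner_Integration.integrable_sum h_ind_integrable) auto
    show "(\<Sum>n<N. h t * indicator {real (Suc n) * x..} t) * x \<le> t * h t" for t
    proof (cases "t \<ge> 0")
      case True
      then show ?thesis using mult_left_mono[OF sum_indicator_le[OF x True, of N] h_nonneg[of t]]
        by (simp add: sum_distrib_left mult_ac)
    qed (simp add: h_def)
  qed (rule th_integrable)
  finally show ?thesis using x by (simp add: pos_le_divide_eq)
qed

lemma f_diff_le:
  assumes "0 \<le> a" "a \<le> b"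
  shows "norm (f b - f a) \<le> W a - W b"
proof -
  have c: "continuous_on {a..b} f'" using cont' assms by (auto intro: continuous_on_subset)
  have "(f' has_integral (f b - f a)) {a..b}"
    using assms by (intro fundamental_theorem_of_calculus has_vector_derivative_within_subset[OF deriv]) auto
  then have "norm (f b - f a) = norm (integral {a..b} f')" by (simp add: integral_unique)
  also have "\<dots> \<le> integral {a..b} (\<lambda>t. norm (f' t))"
    using c by (intro Henstock_Kurzweil_Integration.integral_norm_bound_integral integrable_continuous_real continuous_intros) auto
  also have "\<dots> = (LINT t:{a..b}|lborel. norm (f' t))"
    using c by (intro set_borel_integral_eq_integral(2)[symmetric] borel_integrable_atLeastAtMost' continuous_intros)
  also have "\<dots> = (\<integral>t. h t * indicator {a..} t - h t * indicator {b..} t \<partial>lborel)"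
    unfolding set_lebesgue_integral_def
  proof (rule integral_cong_AE)
    show "(\<lambda>t. indicator {a..b} t *\<^sub>R norm (f' t)) \<in> borel_measurable lborel"
      using borel_measurable_continuous_on_indicator[of "{a..b}" "\<lambda>t. norm (f' t)"] c by (simp add: continuous_intros)
    \<comment> \<open>The difference of the two indicators is that of [a, b), so the endpoint b has
      to be excepted.\<close>
    show "AE t in lborel. indicator {a..b} t *\<^sub>R norm (f' t) = h t * indicator {a..} t - h t * indicator {b..} t"
      using AE_lborel_singleton[of b] by eventually_elim (use assms in \<open>auto simp: h_def split: split_indicator\<close>)
  qed measurable
  also have "\<dots> = W a - W b" unfolding W_def by (intro Bochner_Integration.integral_diff h_ind_integrable) auto
  finally show ?thesis .
qed

lemma f_le_W:
  assumes a: "0 \<le> a"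
  shows "norm (f a) \<le> W a"
proof (rule tendsto_lowerbound)
  have "((\<lambda>b. norm (f b) + W a) \<longlongrightarrow> norm (0 :: complex) + W a) at_top" by (intro tendsto_intros lim)
  then show "((\<lambda>b. norm (f b) + W a) \<longlongrightarrow> W a) at_top" by simp
  show "\<forall>\<^sub>F b in at_top. norm (f a) \<le> norm (f b) + W a"
    using eventually_ge_at_top[of a]
  proof eventually_elim
    case (elim b)
    have "norm (f a) \<le> norm (f b) + norm (f b - f a)" using norm_triangle_ineq4[of "f b" "f b - f a"] by simp
    then show ?case using f_diff_le[OF a elim] W_nonneg[of b] by linarith
  qed
qed simp

lemma tame_f: "tame f"
proof (rule tameI[of _ "W 0" J])
  show "continuous_on {0<..} f" using cont by (auto intro: continuous_on_subset)
  fix x :: real assume x: "x > 0"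
  show "norm (f x) \<le> W 0" using f_le_W[of x] W_antimono[of 0 x] x by simp
  have "x * norm (f x) \<le> x * W x" using f_le_W[of x] x by (intro mult_left_mono) auto
  then show "x * norm (f x) \<le> J" using W_mult_le[OF x] by linarith
qed

lemma W_summable: "x > 0 \<Longrightarrow> summable (\<lambda>n. W (real (Suc n) * x))"
  by (rule summableI_nonneg_bounded[OF W_nonneg W_sum_le])

lemma f_summable:
  assumes "x > 0"
  shows "summable (\<lambda>n. f (real (Suc n) * x))"
  by (rule summable_comparison_test'[OF W_summable[OF assms]]) (use assms in \<open>auto intro!: f_le_W\<close>)

lemma norm_f_series_le:
  assumes x: "x > 0"
  shows "norm (\<Sum>n. f (real (Suc n) * x)) \<le> J / x"
proof -
  have "norm (\<Sum>n. f (real (Suc n) * x)) \<le> (\<Sum>n. W (real (Suc n) * x))"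
    by (rule norm_suminf_le[OF _ W_summable[OF x]]) (use x in \<open>auto intro!: f_le_W\<close>)
  also have "\<dots> \<le> J / x" by (rule suminf_le_const[OF W_summable[OF x] W_sum_le[OF x]])
  finally show ?thesis .
qed

section \<open>Bounds and continuity for the Muntz operator\<close>

definition I :: complex where
  "I = set_lebesgue_integral lborel {0<..} f"

lemma muntz_op_eq: "muntz_op f x = (\<Sum>n. f (real (Suc n) * x)) - I / of_real x"
  by (simp add: muntz_op_def I_def divide_inverse)

text \<open>The sum is a right-endpoint Riemann sum of mesh x. On each cell the error is at most x
  times the variation of f on that cell, and the variations telescope.\<close>

lemma riemann_sum_error:
  assumes x: "x > 0"
  shows "norm (of_real x * (\<Sum>n<N. f (real (Suc n) * x)) - integral {0..real N * x} f) \<le> x * (W 0 - W (real N * x))"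
proof (induction N)
  case (Suc N)
  define a b where "a = real N * x" and "b = real (Suc N) * x"
  have ab: "0 \<le> a" "a \<le> b" "b - a = x" using x by (auto simp: a_def b_def algebra_simps)
  have intg: "f integrable_on {c..d}" if "0 \<le> c" for c d
    using that cont by (intro integrable_continuous_real) (auto intro: continuous_on_subset)
  have split: "integral {0..b} f = integral {0..a} f + integral {a..b} f"
    using ab intg by (intro Henstock_Kurzweil_Integration.integral_combine[symmetric]) auto
  have "of_real x * f b - integral {a..b} f = integral {a..b} (\<lambda>t. f b - f t)"
    using ab intg[of a b] by (subst Henstock_Kurzweil_Integration.integral_diff) (auto simp: scaleR_conv_of_real)
  also have "norm \<dots> \<le> (W a - W b) * (b - a)"
  proof (rule integral_bound[OF ab(2)])
    show "continuous_on {a..b} (\<lambda>t. f b - f t)" using cont ab by (intro continuous_intros) (auto intro: continuous_on_subset)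
    show "norm (f b - f t) \<le> W a - W b" if "t \<in> {a..b}" for t
      using f_diff_le[of t b] W_antimono[of a t] that ab by auto
  qed
  finally have 1: "norm (of_real x * f b - integral {a..b} f) \<le> x * (W a - W b)" using ab by (simp add: mult.commute)
  have "of_real x * (\<Sum>n<Suc N. f (real (Suc n) * x)) - integral {0..real (Suc N) * x} f =
     (of_real x * (\<Sum>n<N. f (real (Suc n) * x)) - integral {0..a} f) + (of_real x * f b - integral {a..b} f)"
    using split by (simp add: a_def b_def algebra_simps)
  also have "norm \<dots> \<le> x * (W 0 - W a) + x * (W a - W b)"
    using Suc 1 unfolding a_def[symmetric] by (rule norm_triangle_mono)
  finally show ?case by (simp add: b_def algebra_simps)
qed simp

text \<open>x Pf(x) is the limit of the Riemann sum errors, hence at most x W(0). So the series,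
  which may grow like 1/x at 0, and the subtracted term cancel there.\<close>

lemma muntz_op_bounded:
  assumes x: "x > 0"
  shows "norm (muntz_op f x) \<le> W 0"
proof -
  have "((\<lambda>b. LINT t:{0..b}|lborel. f t) \<longlongrightarrow> (LINT t:{0..}|lborel. f t)) at_top"
    using int_f by (intro tendsto_set_lebesgue_integral_at_top) auto
  moreover have "(LINT t:{0..}|lborel. f t) = I"
  proof -
    have m: "(\<lambda>t. indicator {0..} t *\<^sub>R f t) \<in> borel_measurable borel" "(\<lambda>t. indicator {0<..} t *\<^sub>R f t) \<in> borel_measurable borel"
      using cont by (intro borel_measurable_continuous_on_indicator; auto intro: continuous_on_subset)+
    show ?thesis unfolding I_def set_lebesgue_integral_def
      by (rule integral_cong_AE) (use m in \<open>auto intro!: eventually_mono[OF AE_lborel_singleton[of 0]] split: split_indicator\<close>)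
  qed
  ultimately have L: "((\<lambda>b. LINT t:{0..b}|lborel. f t) \<longlongrightarrow> I) at_top" by simp
  have "filterlim (\<lambda>N. real N * x) at_top sequentially"
    using x by (intro filterlim_at_top_mult_tendsto_pos[OF tendsto_const] filterlim_real_sequentially) auto
  from filterlim_compose[OF L this] have "(\<lambda>N. LINT t:{0..real N * x}|lborel. f t) \<longlonglongrightarrow> I" .
  moreover have "(LINT t:{0..real N * x}|lborel. f t) = integral {0..real N * x} f" for N
    using cont by (intro set_borel_integral_eq_integral borel_integrable_atLeastAtMost') (auto intro: continuous_on_subset)
  ultimately have IL: "(\<lambda>N. integral {0..real N * x} f) \<longlonglongrightarrow> I" by simp
  have "(\<lambda>N. norm (of_real x * (\<Sum>n<N. f (real (Suc n) * x)) - integral {0..real N * x} f)) \<longlonglongrightarrow>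
      norm (of_real x * (\<Sum>n. f (real (Suc n) * x)) - I)"
    using summable_LIMSEQ[OF f_summable[OF x]] by (intro tendsto_intros IL)
  then have "norm (of_real x * (\<Sum>n. f (real (Suc n) * x)) - I) \<le> x * W 0"
  proof (rule LIMSEQ_le_const2)
    have "norm (of_real x * (\<Sum>n<N. f (real (Suc n) * x)) - integral {0..real N * x} f) \<le> x * W 0" for N
    proof -
      have "x * (W 0 - W (real N * x)) \<le> x * W 0" using x W_nonneg by (intro mult_left_mono) auto
      then show ?thesis using riemann_sum_error[OF x, of N] by linarith
    qed
    then show "\<exists>N. \<forall>n\<ge>N. norm (of_real x * (\<Sum>k<n. f (real (Suc k) * x)) - integral {0..real n * x} f) \<le> x * W 0" by blast
  qed
  also have "of_real x * (\<Sum>n. f (real (Suc n) * x)) - I = of_real x * muntz_op f x"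
    using x by (simp add: muntz_op_eq field_simps)
  finally show ?thesis using x by (simp add: norm_mult)
qed

text \<open>On (a, infinity) the series converges uniformly, since W is decreasing and the values
  W((n + 1) a) are summable.\<close>

lemma continuous_muntz_op: "continuous_on {0<..} (muntz_op f)"
proof -
  have cs: "continuous_on {a<..} (\<lambda>x. \<Sum>n. f (real (Suc n) * x))" if a: "a > 0" for a
  proof (rule uniform_limit_theorem)
    show "uniform_limit {a<..} (\<lambda>N x. \<Sum>n<N. f (real (Suc n) * x)) (\<lambda>x. \<Sum>n. f (real (Suc n) * x)) sequentially"
    proof (rule Weierstrass_m_test[OF _ W_summable[OF a]])
      fix n x assume x: "x \<in> {a<..}"
      have "norm (f (real (Suc n) * x)) \<le> W (real (Suc n) * x)" using x a by (intro f_le_W) auto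
      also have "\<dots> \<le> W (real (Suc n) * a)" using x by (intro W_antimono mult_left_mono) auto
      finally show "norm (f (real (Suc n) * x)) \<le> W (real (Suc n) * a)" .
    qed
    show "\<forall>\<^sub>F N in sequentially. continuous_on {a<..} (\<lambda>x. \<Sum>n<N. f (real (Suc n) * x))"
      using a by (intro always_eventually allI continuous_on_sum continuous_on_compose2[OF cont] continuous_intros) auto
  qed simp
  have "continuous_on {0<..} (\<lambda>x. \<Sum>n. f (real (Suc n) * x))"
  proof (rule continuous_at_imp_continuous_on, rule ballI)
    fix x :: real assume "x \<in> {0<..}"
    then show "isCont (\<lambda>x. \<Sum>n. f (real (Suc n) * x)) x"
      using cs[of "x / 2"] by (simp add: continuous_on_eq_continuous_at)
  qed
  then show ?thesis unfolding muntz_op_eq[abs_def] by (intro continuous_intros) auto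
qed

lemma tame_muntz_op: "tame (muntz_op f)"
proof (rule tameI[OF continuous_muntz_op muntz_op_bounded])
  fix x :: real assume x: "x > 0"
  have "norm (muntz_op f x) \<le> J / x + norm I / x"
    unfolding muntz_op_eq using norm_triangle_ineq4[of "\<Sum>n. f (real (Suc n) * x)" "I / of_real x"] norm_f_series_le[OF x] x
    by (simp add: norm_divide)
  then show "x * norm (muntz_op f x) \<le> J + norm I" using x by (simp add: field_simps)
qed

text \<open>The length 2 N is even so that consecutive terms pair up; the pairs are bounded
  uniformly in N and x, in contrast to the bound J / x for the sums without signs.\<close>

definition alt_sum :: "nat \<Rightarrow> real \<Rightarrow> complex" where
  "alt_sum N x = (\<Sum>n<2 * N. (-1) ^ n * f (real (Suc n) * x))"

text \<open>Each pair is bounded by the variation of f between its two arguments, and the intervals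
  of different pairs do not overlap. The result supplies the majorant for passing to the limit under
  the Mellin integral.\<close>

lemma norm_alt_sum_le:
  assumes x: "x > 0"
  shows "norm (alt_sum N x) \<le> W x"
proof -
  have "norm (alt_sum N x) \<le> W x - W (real (2 * N + 1) * x)"
  proof (induction N)
    case (Suc N)
    define a b where "a = real (2 * N + 1) * x" and "b = real (2 * N + 2) * x"
    have ab: "0 \<le> a" "a \<le> b" "b \<le> real (2 * Suc N + 1) * x" using x by (auto simp: a_def b_def algebra_simps)
    have "alt_sum (Suc N) x = alt_sum N x + (f a - f b)" by (simp add: alt_sum_def a_def b_def algebra_simps)
    also have "norm \<dots> \<le> (W x - W a) + (W a - W b)"
      using Suc f_diff_le[OF ab(1,2)] unfolding a_def[symmetric] by (intro norm_triangle_mono) (auto simp: norm_minus_commute)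
    finally show ?case using W_antimono[OF ab(3)] by simp
  qed (simp add: alt_sum_def)
  then show ?thesis using W_nonneg[of "real (2 * N + 1) * x"] by linarith
qed

lemma alt_sum_eq: "alt_sum N x = (\<Sum>n<2 * N. f (real (Suc n) * x)) - 2 * (\<Sum>n<N. f (real (Suc n) * (2 * x)))"
proof (induction N)
  case (Suc N)
  have "real (Suc (2 * N + 1)) * x = real (Suc N) * (2 * x)" by (simp add: algebra_simps)
  then show ?case using Suc by (simp add: alt_sum_def algebra_simps)
qed (simp add: alt_sum_def)

lemma alt_sum_tendsto:
  assumes x: "x > 0"
  shows "(\<lambda>N. alt_sum N x) \<longlonglongrightarrow> muntz_op f x - 2 * dilation 2 (muntz_op f) x"
proof -
  have "filterlim (\<lambda>N::nat. 2 * N) sequentially sequentially" by (rule mult_nat_left_at_top) simp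
  then have "(\<lambda>N. alt_sum N x) \<longlonglongrightarrow> (\<Sum>n. f (real (Suc n) * x)) - 2 * (\<Sum>n. f (real (Suc n) * (2 * x)))"
    unfolding alt_sum_eq using x
    by (intro tendsto_intros filterlim_compose[OF summable_LIMSEQ[OF f_summable]] summable_LIMSEQ f_summable) auto
  also have "(\<Sum>n. f (real (Suc n) * x)) - 2 * (\<Sum>n. f (real (Suc n) * (2 * x))) = muntz_op f x - 2 * dilation 2 (muntz_op f) x"
    using x by (simp add: dilation_def muntz_op_eq)
  finally show ?thesis .
qed

lemma mellin_alt_sum:
  "mellin (alt_sum N) t = (\<Sum>n<2 * N. (-1) ^ n * of_nat (Suc n) powr (- Complex (1/2) t)) * mellin f t"
proof -
  have "alt_sum N = (\<lambda>x. \<Sum>n<2 * N. (-1) ^ n * dilation (real (Suc n)) f x)"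
    by (simp add: alt_sum_def[abs_def] dilation_def)
  then have "mellin (alt_sum N) t = (\<Sum>n<2 * N. mellin (\<lambda>x. (-1) ^ n * dilation (real (Suc n)) f x) t)"
    by (simp only:) (intro mellin_sum tame_cmult tame_dilation tame_f, simp)
  also have "\<dots> = (\<Sum>n<2 * N. (-1) ^ n * of_nat (Suc n) powr (- Complex (1/2) t) * mellin f t)"
    by (intro sum.cong refl, subst mellin_cmult, subst mellin_dilation) (simp_all add: mult.assoc)
  finally show ?thesis by (simp add: sum_distrib_right)
qed

(* Muntz's formula; the combination Pf(x) - 2 Pf(2x) = f(x) - f(2x) + f(3x) - ... has no 1/x term, and its Mellin
   transform carries the factor eta(s). *)
theorem mellin_muntz_op: "mellin (muntz_op f) t = zeta (Complex (1/2) t) * mellin f t"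
proof -
  define s where "s = Complex (1/2) t"
  have s: "Re s > 0" "s \<noteq> 1" by (auto simp: s_def complex_eq_iff)
  define P where "P = muntz_op f"
  have tP: "tame P" unfolding P_def by (rule tame_muntz_op)
  have "(\<lambda>N. mellin (alt_sum N) t) \<longlonglongrightarrow> mellin (\<lambda>x. P x + (-2) * dilation 2 P x) t"
    unfolding mellin_def fourier_def
  \<comment> \<open>W(0) bounds the alternating sums and J bounds x times them, so
    \<open>log_pullback_bound\<close> applies with their maximum.\<close>
  proof (rule integral_dominated_convergence[where w = "\<lambda>y. max (W 0) J * exp (- \<bar>y\<bar> / 2)"])
    show "AE y in lborel. (\<lambda>N. log_pullback (alt_sum N) y * cis (t * y)) \<longlonglongrightarrow> log_pullback (\<lambda>x. P x + (-2) * dilation 2 P x) y * cis (t * y)"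
      unfolding log_pullback_def using alt_sum_tendsto by (intro AE_I2 tendsto_intros) (auto simp: P_def)
    show "AE y in lborel. norm (log_pullback (alt_sum N) y * cis (t * y)) \<le> max (W 0) J * exp (- \<bar>y\<bar> / 2)" for N
    proof (rule AE_I2)
      fix y :: real
      have x: "exp y > 0" by simp
      have "norm (log_pullback (alt_sum N) y) \<le> max (W 0) J * exp (- \<bar>y\<bar> / 2)"
      proof (rule log_pullback_bound[OF refl])
        show "norm (alt_sum N (exp y)) \<le> max (W 0) J"
          using norm_alt_sum_le[OF x, of N] W_antimono[of 0 "exp y"] by simp
        have "exp y * norm (alt_sum N (exp y)) \<le> exp y * W (exp y)"
          by (intro mult_left_mono norm_alt_sum_le) auto
        then have "exp y * norm (alt_sum N (exp y)) \<le> J" using W_mult_le[OF x] by linarith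
        then show "exp y * norm (alt_sum N (exp y)) \<le> max (W 0) J" by (simp add: le_max_iff_disj)
      qed
      then show "norm (log_pullback (alt_sum N) y * cis (t * y)) \<le> max (W 0) J * exp (- \<bar>y\<bar> / 2)" by (simp add: norm_mult)
    qed
    show "integrable lborel (\<lambda>y. max (W 0) J * exp (- \<bar>y\<bar> / 2))" using integrable_exp_abs by simp
    have c: "continuous_on {0<..} (alt_sum N)" for N
      unfolding alt_sum_def using cont by (intro continuous_intros continuous_on_compose2[OF cont]) auto
    show "(\<lambda>y. log_pullback (alt_sum N) y * cis (t * y)) \<in> borel_measurable lborel" for N
      using borel_measurable_continuous_onI[OF continuous_log_pullback[OF c[of N]]] by simp
    show "(\<lambda>y. log_pullback (\<lambda>x. P x + (-2) * dilation 2 P x) y * cis (t * y)) \<in> borel_measurable lborel"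
      by (intro borel_measurable_integrable integrable_mult_cis integrable_log_pullback tame_add tP tame_cmult tame_dilation) simp
  qed
  moreover have "mellin (\<lambda>x. P x + (-2) * dilation 2 P x) t = (1 - 2 powr (1 - s)) * mellin P t"
  proof -
    have t2: "tame (dilation 2 P)" by (rule tame_dilation[OF tP]) simp
    have "mellin (\<lambda>x. P x + (-2) * dilation 2 P x) t = mellin P t + (-2) * mellin (dilation (real 2) P) t"
      by (simp only: mellin_add[OF tP tame_cmult[OF t2]] mellin_cmult of_nat_numeral)
    also have "mellin (dilation (real 2) P) t = 2 powr (- s) * mellin P t"
      using mellin_dilation[of 2 P t] by (simp add: s_def)
    finally have a: "mellin (\<lambda>x. P x + (-2) * dilation 2 P x) t = mellin P t + (-2) * (2 powr (- s) * mellin P t)" .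
    have b: "2 powr (1 - s) = 2 * 2 powr (- s)" by (simp add: powr_diff powr_minus_divide)
    show ?thesis unfolding a b by (simp add: algebra_simps)
  qed
  moreover have "(\<lambda>N. mellin (alt_sum N) t) \<longlonglongrightarrow> ((1 - 2 powr (1 - s)) * zeta_reg s / (s - 1)) * mellin f t"
  proof -
    have "filterlim (\<lambda>N::nat. 2 * N) sequentially sequentially" by (rule mult_nat_left_at_top) simp
    then have "(\<lambda>N. \<Sum>n<2 * N. (-1) ^ n * of_nat (Suc n) powr (- s)) \<longlonglongrightarrow> (1 - 2 powr (1 - s)) * zeta_reg s / (s - 1)"
      using filterlim_compose[OF eta_sums[OF s, unfolded sums_def]] by simp
    then show ?thesis unfolding mellin_alt_sum s_def[symmetric] by (intro tendsto_intros)
  qed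
  ultimately have "(1 - 2 powr (1 - s)) * mellin P t = (1 - 2 powr (1 - s)) * (zeta s * mellin f t)"
    using LIMSEQ_unique by (fastforce simp: zeta_def)
  moreover have "1 - 2 powr (1 - s) \<noteq> 0"
  proof
    assume "1 - 2 powr (1 - s) = 0"
    then have "norm (2 powr (1 - s)) = 1" by simp
    moreover have "norm (2 powr (1 - s)) = 2 powr (1/2 :: real)"
      by (subst norm_powr_real_powr) (auto simp: s_def)
    moreover have "(2::real) powr (1/2) > 2 powr 0" by (intro powr_less_mono) auto
    ultimately show False by simp
  qed
  ultimately show ?thesis by (simp add: P_def s_def)
qed

text \<open>Integration by parts: s times the transform of f is minus the integral of x^s f'(x),
  which converges absolutely on Re s = 1/2. Dividing by |s| gives the decay.\<close>

lemma mellin_f_decay: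
  obtains C where "C \<ge> 0" "\<And>t. norm (mellin f t) \<le> C / (\<bar>t\<bar> + 4)"
proof -
  define B where "B = (\<integral>y. norm (of_real (exp y) * log_pullback f' y) \<partial>lborel)"
  have int': "integrable lborel (\<lambda>y. of_real (exp y) * log_pullback f' y)"
  proof -
    \<comment> \<open>Integrability of t |f'(t)| alone does not control sqrt t |f'(t)| near 0; the
      bound sqrt t \<le> 1 + t brings in the integrability of |f'| as well.\<close>
    have "set_integrable lborel {0<..} (\<lambda>x. of_real (sqrt x) * f' x)"
      unfolding set_integrable_def
    proof (rule Bochner_Integration.integrable_bound)
      show "integrable lborel (\<lambda>t. h t + t * h t)" using h_integrable th_integrable by simp
      show "(\<lambda>t. indicator {0<..} t *\<^sub>R (of_real (sqrt t) * f' t)) \<in> borel_measurable lborel"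
      proof -
        have "continuous_on {0<..} (\<lambda>t. of_real (sqrt t) * f' t)"
          using cont' by (intro continuous_intros) (auto intro: continuous_on_subset)
        from borel_measurable_continuous_on_indicator[OF _ this] show ?thesis by simp
      qed
      show "AE t in lborel. norm (indicator {0<..} t *\<^sub>R (of_real (sqrt t) * f' t)) \<le> norm (h t + t * h t)"
      proof (rule AE_I2)
        fix t :: real
        show "norm (indicator {0<..} t *\<^sub>R (of_real (sqrt t) * f' t)) \<le> norm (h t + t * h t)"
        proof (cases "t > 0")
          case True
          have "sqrt t \<le> 1 + t" using True by (intro real_le_lsqrt) (auto simp: power2_eq_square algebra_simps)
          then have "sqrt t * norm (f' t) \<le> (1 + t) * norm (f' t)" by (intro mult_right_mono) auto
          then show ?thesis using True by (simp add: h_def norm_mult algebra_simps)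
        qed simp
      qed
    qed
    then have "integrable lborel (\<lambda>y. of_real (exp y) * (of_real (sqrt (exp y)) * f' (exp y)))"
      by (rule exp_substitution_integrable)
    moreover have "sqrt (exp y) = exp (y / 2)" for y
      by (rule real_sqrt_unique) (auto simp: power2_eq_square simp flip: exp_add)
    ultimately show ?thesis by (simp add: log_pullback_def)
  qed
  have B0: "B \<ge> 0" unfolding B_def by (intro integral_nonneg_AE) auto
  have main: "norm (Complex (1/2) t) * norm (mellin f t) \<le> B" for t
  proof -
    define s where "s = Complex (1/2) t"
    define F where "F y = log_pullback f y * cis (t * y)" for y
    define G where "G y = of_real (exp y) * log_pullback f' y * cis (t * y) + s * F y" for y
    have i1: "integrable lborel (\<lambda>y. of_real (exp y) * log_pullback f' y * cis (t * y))"
      by (rule integrable_mult_cis[OF int'])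
    have i2: "integrable lborel F" unfolding F_def by (rule integrable_mult_cis[OF integrable_log_pullback[OF tame_f]])
    have iG: "integrable lborel G" unfolding G_def using i1 i2 by simp
    have Feq: "F y = f (exp y) * exp (of_real y * s)" for y
    proof -
      have "exp (of_real y * s) = of_real (exp (y / 2)) * cis (t * y)"
        by (simp add: exp_eq_polar s_def mult.commute)
      then show ?thesis by (simp add: F_def log_pullback_def)
    qed
    have Geq: "G y = of_real (exp y) * f' (exp y) * exp (of_real y * s) + f (exp y) * (s * exp (of_real y * s))" for y
    proof -
      have "exp (of_real y * s) = of_real (exp (y / 2)) * cis (t * y)"
        by (simp add: exp_eq_polar s_def mult.commute)
      then show ?thesis by (simp add: G_def F_def log_pullback_def algebra_simps)
    qed
    \<comment> \<open>\<open>F\<close> is x^s f(x) in the variable y = ln x and \<open>G\<close> is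
      its derivative. Both boundary values vanish because \<open>F\<close> decays exponentially in
      |y|.\<close>
    have FTC: "(LBINT y=-\<infinity>..\<infinity>. G y) = 0 - 0"
    proof (rule interval_integral_FTC_integrable)
      fix y :: real
      have "(f has_vector_derivative f' (exp y)) (at (exp y) within {0<..})"
        by (rule has_vector_derivative_within_subset[OF deriv]) auto
      then have f_at: "(f has_vector_derivative f' (exp y)) (at (exp y))"
        by (subst (asm) at_within_open) auto
      have exp_at: "(exp has_vector_derivative exp y) (at y)"
        using DERIV_exp[of y] by (simp add: has_real_derivative_iff_has_vector_derivative)
      have d1: "((\<lambda>y. f (exp y)) has_vector_derivative exp y *\<^sub>R f' (exp y)) (at y)"
        using vector_diff_chain_at[OF exp_at f_at] by (simp add: o_def)
      have "((\<lambda>w. exp (w * s)) has_field_derivative s * exp (of_real y * s)) (at (of_real y))"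
        by (auto intro!: derivative_eq_intros)
      then have d2: "((\<lambda>y. exp (of_real y * s)) has_vector_derivative s * exp (of_real y * s)) (at y)"
        by (rule has_vector_derivative_real_field)
      have "((\<lambda>y. f (exp y) * exp (of_real y * s)) has_vector_derivative
          (f (exp y) * (s * exp (of_real y * s)) + exp y *\<^sub>R f' (exp y) * exp (of_real y * s))) (at y)"
        by (rule has_vector_derivative_mult[OF d1 d2])
      then show "(F has_vector_derivative G y) (at y)"
        unfolding Feq[abs_def] Geq by (simp add: scaleR_conv_of_real add.commute)
      have "isCont f' (exp y)" "isCont f (exp y)"
        using cont' cont by (auto simp: continuous_on_interior)
      then have "isCont (\<lambda>y. f' (exp y)) y" "isCont (\<lambda>y. f (exp y)) y"
        by (auto intro: isCont_o2[OF isCont_exp])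
      then show "isCont G y" unfolding Geq[abs_def] by (intro continuous_intros) auto
    next
      show "set_integrable lborel (einterval (-\<infinity>) \<infinity>) G" using iG by (simp add: set_integrable_def)
      obtain C where C: "C \<ge> 0" "\<And>y. norm (log_pullback f y) \<le> C * exp (- \<bar>y\<bar> / 2)" using tame_pullback_bound[OF tame_f] by blast
      have nF: "norm (F y) \<le> C * exp (- \<bar>y\<bar> / 2)" for y using C(2)[of y] by (simp add: F_def norm_mult)
      have "((\<lambda>y::real. exp (- \<bar>y\<bar> / 2)) \<longlongrightarrow> 0) at_top" "((\<lambda>y::real. exp (- \<bar>y\<bar> / 2)) \<longlongrightarrow> 0) at_bot"
        by real_asymp+
      then have l: "((\<lambda>y::real. C * exp (- \<bar>y\<bar> / 2)) \<longlongrightarrow> 0) at_top" "((\<lambda>y::real. C * exp (- \<bar>y\<bar> / 2)) \<longlongrightarrow> 0) at_bot"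
        by (auto intro: tendsto_mult_right_zero)
      have "(F \<longlongrightarrow> 0) at_top" by (rule Lim_null_comparison[OF _ l(1)]) (use nF in auto)
      then show "((F \<circ> real_of_ereal) \<longlongrightarrow> 0) (at_left \<infinity>)"
        by (simp add: ereal_tendsto_simps)
      have "(F \<longlongrightarrow> 0) at_bot" by (rule Lim_null_comparison[OF _ l(2)]) (use nF in auto)
      then show "((F \<circ> real_of_ereal) \<longlongrightarrow> 0) (at_right (-\<infinity>))"
        by (simp add: ereal_tendsto_simps)
    qed simp
    then have "(\<integral>y. G y \<partial>lborel) = 0"
      by (simp add: interval_lebesgue_integral_def set_lebesgue_integral_def)
    then have "s * mellin f t = - (\<integral>y. of_real (exp y) * log_pullback f' y * cis (t * y) \<partial>lborel)"
      unfolding G_def using i1 i2 by (simp add: mellin_def fourier_def F_def[symmetric] eq_neg_iff_add_eq_0 add.commute)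
    also have "norm \<dots> \<le> B"
      unfolding norm_minus_cancel B_def using integral_norm_bound[of lborel "\<lambda>y. of_real (exp y) * log_pullback f' y * cis (t * y)"]
      by (simp add: norm_mult)
    finally show ?thesis by (simp add: s_def norm_mult)
  qed
  \<comment> \<open>The factor 9 converts 1 / |s| into 1 / (|t| + 4): |s| is at least |t| and at
    least 1/2.\<close>
  show ?thesis
  proof (rule that[of "9 * B"])
    fix t :: real
    have "\<bar>t\<bar> + 4 \<le> 9 * norm (Complex (1/2) t)"
      using abs_Re_le_cmod[of "Complex (1/2) t"] abs_Im_le_cmod[of "Complex (1/2) t"] by simp
    then have "(\<bar>t\<bar> + 4) * norm (mellin f t) \<le> 9 * norm (Complex (1/2) t) * norm (mellin f t)" by (intro mult_right_mono) auto
    also have "\<dots> \<le> 9 * B" using main[of t] by simp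
    finally show "norm (mellin f t) \<le> 9 * B / (\<bar>t\<bar> + 4)" by (simp add: pos_le_divide_eq mult.commute)
  qed (use B0 in simp)
qed

theorem RH_imp_in_L2_closure:
  assumes RH: "riemann_hypothesis"
  shows "f \<in> L2_closure (dilation_span (muntz_op f))"
  unfolding L2_closure_def
proof (intro CollectI allI impI)
  fix e :: real assume e: "e > 0"
  obtain C where C: "C \<ge> 0" "\<And>t. norm (mellin f t) \<le> C / (\<bar>t\<bar> + 4)" using mellin_f_decay by blast
  \<comment> \<open>The tolerance will be multiplied by the square of C; adding 1 keeps the result
    strictly below e and covers C = 0.\<close>
  have "e / (C\<^sup>2 + 1) > 0" using e by (simp add: add_nonneg_pos)
  then obtain D where D: "dirichlet_poly D"
    "(\<integral>\<^sup>+ t. ennreal ((norm (1 - zeta (Complex (1/2) t) * D (Complex (1/2) t)))\<^sup>2 / (\<bar>t\<bar> + 4)\<^sup>2) \<partial>lborel) < ennreal (e / (C\<^sup>2 + 1))"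
    using RH_critical_line_approx[OF RH] by blast
  obtain N c where Dc: "\<And>s. D s = (\<Sum>n\<in>{1..N::nat}. c n * of_nat n powr (-s))"
    using D(1) unfolding dirichlet_poly_def by blast
  \<comment> \<open>The coefficients of D become those of the dilations, because dilation by n
    multiplies the transform by n^(-s).\<close>
  define g where "g x = (\<Sum>n\<in>{1..N}. c n * dilation (real n) (muntz_op f) x)" for x
  have g: "g \<in> dilation_span (muntz_op f)" unfolding dilation_span_def g_def by blast
  have tg: "tame (\<lambda>x. c n * dilation (real n) (muntz_op f) x)" if "n \<in> {1..N}" for n
    using that by (intro tame_cmult tame_dilation tame_muntz_op) auto
  have tg': "tame g" unfolding g_def by (intro tame_sum tg)
  have td: "tame (\<lambda>x. f x + (-1) * g x)" by (intro tame_add tame_f tame_cmult tg')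
  have mg: "mellin g t = D (Complex (1/2) t) * (zeta (Complex (1/2) t) * mellin f t)" for t
  proof -
    have "mellin g t = (\<Sum>n\<in>{1..N}. mellin (\<lambda>x. c n * dilation (real n) (muntz_op f) x) t)"
      unfolding g_def by (rule mellin_sum[OF tg])
    also have "\<dots> = (\<Sum>n\<in>{1..N}. c n * of_nat n powr (- Complex (1/2) t) * (zeta (Complex (1/2) t) * mellin f t))"
      by (intro sum.cong refl) (simp add: mellin_cmult mellin_dilation mellin_muntz_op mult.assoc)
    finally show ?thesis by (simp add: Dc sum_distrib_right)
  qed
  have pw: "(norm (mellin (\<lambda>x. f x + (-1) * g x) t))\<^sup>2 \<le> C\<^sup>2 * ((norm (1 - zeta (Complex (1/2) t) * D (Complex (1/2) t)))\<^sup>2 / (\<bar>t\<bar> + 4)\<^sup>2)" for t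
  proof -
    have "mellin (\<lambda>x. f x + (-1) * g x) t = mellin f t * (1 - zeta (Complex (1/2) t) * D (Complex (1/2) t))"
      by (subst mellin_add[OF tame_f tame_cmult[OF tg']], subst mellin_cmult, subst mg) (simp add: algebra_simps)
    then have "norm (mellin (\<lambda>x. f x + (-1) * g x) t) \<le> C / (\<bar>t\<bar> + 4) * norm (1 - zeta (Complex (1/2) t) * D (Complex (1/2) t))"
      using mult_right_mono[OF C(2)[of t] norm_ge_zero] by (simp only: norm_mult)
    then have "(norm (mellin (\<lambda>x. f x + (-1) * g x) t))\<^sup>2 \<le> (C / (\<bar>t\<bar> + 4) * norm (1 - zeta (Complex (1/2) t) * D (Complex (1/2) t)))\<^sup>2"
      by (intro power_mono) auto
    then show ?thesis by (simp add: power_mult_distrib power_divide)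
  qed
  have [measurable]: "(\<lambda>t. D (Complex (1/2) t)) \<in> borel_measurable borel" by (rule dirichlet_poly_measurable[OF D(1)])
  define X where "X = (\<integral>\<^sup>+x\<in>{0<..}. ennreal ((norm (f x - g x))\<^sup>2) \<partial>lborel)"
  \<comment> \<open>The factor 2 pi from Plancherel is at least 1 and stands on the favourable side,
    so it may be dropped.\<close>
  have "ennreal 1 \<le> ennreal (2 * pi)" using pi_gt3 by (intro ennreal_leI) linarith
  from mult_right_mono[OF this, of X] have "X \<le> ennreal (2 * pi) * X" by simp
  also have "\<dots> \<le> (\<integral>\<^sup>+ t. ennreal ((norm (mellin (\<lambda>x. f x + (-1) * g x) t))\<^sup>2) \<partial>lborel)"
    using mellin_plancherel_le[OF td] by (simp add: X_def)
  also have "\<dots> \<le> (\<integral>\<^sup>+ t. ennreal (C\<^sup>2) * ennreal ((norm (1 - zeta (Complex (1/2) t) * D (Complex (1/2) t)))\<^sup>2 / (\<bar>t\<bar> + 4)\<^sup>2) \<partial>lborel)"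
    using pw by (intro nn_integral_mono) (simp flip: ennreal_mult' add: ennreal_leI)
  also have "\<dots> = ennreal (C\<^sup>2) * (\<integral>\<^sup>+ t. ennreal ((norm (1 - zeta (Complex (1/2) t) * D (Complex (1/2) t)))\<^sup>2 / (\<bar>t\<bar> + 4)\<^sup>2) \<partial>lborel)"
    by (rule nn_integral_cmult) measurable
  also have "\<dots> \<le> ennreal (C\<^sup>2) * ennreal (e / (C\<^sup>2 + 1))" using D(2) by (intro mult_left_mono) auto
  also have "\<dots> = ennreal (C\<^sup>2 * (e / (C\<^sup>2 + 1)))" by (rule ennreal_mult'[symmetric]) simp
  also have "\<dots> < ennreal e"
  proof (rule ennreal_lessI[OF e])
    have "C\<^sup>2 * e < (C\<^sup>2 + 1) * e" using e by simp
    then show "C\<^sup>2 * (e / (C\<^sup>2 + 1)) < e" by (simp add: pos_divide_less_eq add_nonneg_pos mult.commute)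
  qed
  finally show "\<exists>g\<in>dilation_span (muntz_op f). (\<integral>\<^sup>+x\<in>{0<..}. ennreal ((norm (f x - g x))\<^sup>2) \<partial>lborel) < ennreal e"
    using g unfolding X_def by blast
qed

end

theorem mainTheorem1:
  assumes "riemann_hypothesis"
  shows "\<forall>f. good_kernel f \<longrightarrow> f \<in> L2_closure (dilation_span (muntz_op f))"
proof (intro allI impI)
  fix f assume "good_kernel f"
  then obtain f' where "good_kernel_derivative f f'"
    unfolding good_kernel_def good_kernel_derivative_def by auto
  then show "f \<in> L2_closure (dilation_span (muntz_op f))"
    by (rule good_kernel_derivative.RH_imp_in_L2_closure[OF _ assms])
qed

end
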